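(* Let $n\in\mathbb N$ and $a\in(2,8/3)$. Assume $f\in C^{[n/2]+4}(\mathbb R^n\times(0,\infty))$, $t^af(x,t)\in C(\mathbb R^n\times[0,\infty))$, and for some $T>0$, \[ |\partial_x^\alpha f(x,t)|+|t\,\partial_t\partial_x^\beta f(x,t)|\le C_\alpha t^{-a}\quad\text{for all }t\in(0,T),\ x\in\mathbb R^n, \] for all $|\alpha|\le[n/2]+4$, $|\beta|\le[n/2]+1$. Let $f_0(x):=\lim_{t\to0}t^af(x,t)$, assume $f_0\in C^{[n/2]+4}(\mathbb R^n)$ and that for some $\varepsilon>0$, \[ |\partial_x^\alpha(tf(x,t)-t^{1-a}f_0(x))|+|t\,\partial_t\partial_x^\beta(tf(x,t)-t^{1-a}f_0(x))|\le C_\alpha t^{\varepsilon-1}\quad\text{for all }t\in(0,T),\ x\in\mathbb R^n, \] for all $|\alpha|\le[n/2]+2$, $|\beta|\le[n/2]+1$. Let $\tau(t):=\frac{t^{3-a}}{(3-a)(2-a)}$ and $\phi(t):=3t^{1/3}$. Then the function \[ \psi(x,t)=\frac1t f_0(x)\tau(t)+\frac1{18t}\int_0^t dl\int_0^{\phi(t)-\phi(l)}dr\,\big(\phi^2(t)+\phi^2(l)-r^2\big)\Big(l\,v_f(x,r;l)-l^{1-a}v_{f_0}(x,r)+l^{-4/3}\tau(l)\Delta v_{f_0}(x,r)\Big) \] solves $\psi_{tt}-t^{-4/3}\Delta\psi+2t^{-1}\psi_t=f(x,t)$ for $t>0$, $x\in\mathbb R^n$, with \[ \lim_{t\to0}\Big(t\psi(x,t)-\tfrac{1}{(3-a)(2-a)}t^{3-a}f_0(x)\Big)=0,\qquad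 \lim_{t\to0}\Big(t\psi_t(x,t)+\psi(x,t)-\tfrac1{2-a}t^{2-a}f_0(x)\Big)=0,\quad x\in\mathbb R^n. \]
   Context: $\Delta=\sum_{i=1}^n\partial_{x_i}^2$ and $[n/2]$ is the integer part of $n/2$. For a function $h(x,b)$ of $x\in\mathbb R^n$ and a parameter $b$, $v_h(x,r;b)$ denotes the solution $v$ of the Cauchy problem for the free wave equation $v_{rr}-\Delta v=0$, $v(x,0)=h(x,b)$, $v_r(x,0)=0$, evaluated at time $r$. If $h=h(x)$ does not depend on a parameter, one writes $v_h(x,r)$. *)

theory Defs
  imports "HOL-Analysis.Analysis"
begin

definition pd :: "'a::real_normed_vector \<Rightarrow> ('a \<Rightarrow> real) \<Rightarrow> 'a \<Rightarrow> real" where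
  "pd v g x = deriv (\<lambda>s. g (x + s *\<^sub>R v)) 0"

definition iter_pd :: "'a::real_normed_vector list \<Rightarrow> ('a \<Rightarrow> real) \<Rightarrow> 'a \<Rightarrow> real" where
  "iter_pd vs g = foldr pd vs g"

definition Ck_on :: "nat \<Rightarrow> 'a::euclidean_space set \<Rightarrow> ('a \<Rightarrow> real) \<Rightarrow> bool" where
  "Ck_on k S g \<longleftrightarrow>
     (\<forall>vs. set vs \<subseteq> Basis \<and> length vs \<le> k \<longrightarrow> continuous_on S (iter_pd vs g)) \<and>
     (\<forall>vs v. set vs \<subseteq> Basis \<and> length vs < k \<and> v \<in> Basis \<longrightarrow>
        (\<forall>x\<in>S. (\<lambda>s. iter_pd vs g (x + s *\<^sub>R v)) differentiable (at 0)))"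

definition xdir :: "'n::finite \<Rightarrow> (real^'n) \<times> real" where
  "xdir i = (axis i 1, 0)"

definition tdir :: "(real^'n::finite) \<times> real" where
  "tdir = (0, 1)"

definition lap :: "(real^'n::finite \<Rightarrow> real) \<Rightarrow> real^'n \<Rightarrow> real" where
  "lap g x = (\<Sum>i\<in>UNIV. pd (axis i 1) (pd (axis i 1) g) x)"

definition wave_cauchy :: "(real^'n::finite \<Rightarrow> real) \<Rightarrow> (real^'n \<Rightarrow> real \<Rightarrow> real) \<Rightarrow> bool" where
  "wave_cauchy h v \<longleftrightarrow>
     Ck_on 2 UNIV (case_prod v) \<and>
     (\<forall>x r. pd tdir (pd tdir (case_prod v)) (x, r)
              = (\<Sum>i\<in>UNIV. pd (xdir i) (pd (xdir i) (case_prod v)) (x, r))) \<and>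
     (\<forall>x. v x 0 = h x) \<and>
     (\<forall>x. pd tdir (case_prod v) (x, 0) = 0)"

definition wave_sol :: "(real^'n::finite \<Rightarrow> real) \<Rightarrow> real^'n \<Rightarrow> real \<Rightarrow> real" where
  "wave_sol h = (THE v. wave_cauchy h v)"

definition tau :: "real \<Rightarrow> real \<Rightarrow> real" where
  "tau a t = t powr (3 - a) / ((3 - a) * (2 - a))"

definition phi :: "real \<Rightarrow> real" where
  "phi t = 3 * t powr (1/3)"

definition psi :: "real \<Rightarrow> (real^'n::finite \<Rightarrow> real \<Rightarrow> real) \<Rightarrow> (real^'n \<Rightarrow> real)
                    \<Rightarrow> real^'n \<Rightarrow> real \<Rightarrow> real" where
  "psi a f f0 x t =
     1 / t * f0 x * tau a t
     + 1 / (18 * t) * integral {0..t} (\<lambda>l. integral {0..phi t - phi l} (\<lambda>r.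
         ((phi t)\<^sup>2 + (phi l)\<^sup>2 - r\<^sup>2) *
         (l * wave_sol (\<lambda>y. f y l) x r - l powr (1 - a) * wave_sol f0 x r
          + l powr (-4/3) * tau a l * lap (\<lambda>y. wave_sol f0 y r) x)))"

end

theory Submission
  imports Defs
begin

text \<open>
  With \<open>u = t \<psi>\<close> the equation becomes \<open>u\<^sub>t\<^sub>t - t\<^bsup>-4/3\<^esup> \<Delta>u = t f\<close>, and subtracting \<open>\<tau> f\<^sub>0\<close> leaves a source
  \<open>g\<close> of size \<open>t\<^bsup>\<delta>-1\<^esup>\<close>, hence integrable at \<open>t = 0\<close>. Duhamel's principle in the variable \<open>\<phi>(t)\<close> then
  expresses the solution through the wave propagators applied to \<open>g(\<cdot>, l)\<close>.

  The propagators are represented without surface measures. For \<open>n = 2k\<close> or \<open>n = 2k + 1\<close> the mean of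
  \<open>h(x + ry)\<close> over the unit ball with weight \<open>(1 - |y|\<^sup>2)\<^bsup>k+1/2-n/2\<^esup>\<close> solves the Euler--Poisson--Darboux
  equation with parameter \<open>p = 2k + 2\<close>, and \<open>F \<mapsto> F + r F\<^sub>r / (p - 1)\<close> lowers \<open>p\<close> by 2 at the price of one
  derivative. After \<open>k\<close> steps one reaches \<open>p = 2\<close>, where \<open>Z = r F\<close> solves the wave equation with
  data \<open>(0, h)\<close> and \<open>Z\<^sub>r\<close> has data \<open>(h, 0)\<close>. As an operator on \<open>h\<close>, \<open>Z\<^sub>r\<close> costs one derivative more than
  necessary, but the Duhamel integral, integrated by parts in \<open>r\<close>, involves only \<open>Z\<close> and its primitive, so \<open>k + 2\<close> derivatives of \<open>g\<close> suffice.

  Uniqueness, needed to identify \<^const>\<open>wave_sol\<close>, is the energy estimate with the weight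
  \<open>max(0, (R - r)\<^sup>2 - |x - x\<^sub>0|\<^sup>2)\<^sup>2\<close>, which vanishes outside the backward light cone.
\<close>

section \<open>Directional derivatives and the classes \<open>C\<^sup>k\<close>\<close>

text \<open>The time change is dictated by \<phi>' = t^(-2/3), whose square is the coefficient of
  the Laplacian. In s = \<phi>(t) the operator for u becomes a multiple of u_ss - (2/s) u_s -
  \<Delta>u; its lower-order term is the reason why the Duhamel kernel is the quadratic polynomial
  \<phi>(t)^2 + \<phi>(l)^2 - r^2 and not a constant. \<tau> satisfies \<tau>'' = t^(1-a), so \<tau>
  f0 absorbs the part of t f that is not integrable at 0. It leaves behind t^(-4/3) \<tau>
  \<Delta>f0, of size t^(5/3-a), and 5/3 - a > -1 is exactly a < 8/3. The decay of the renormalized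
  source is assumed for k + 2 derivatives, and two of them must remain for the equation itself;
  hence every operator below carries an explicit bound on the number of derivatives that it takes.
  \<open>Ck_on\<close> speaks of iterated derivatives along basis vectors only, so the chain rule
  along arbitrary lines and the symmetry of mixed derivatives have to be derived from it.
  \<open>wave_sol\<close> is a definite description over all real r, so propagators and uniqueness
  must cover negative r too.\<close>

definition has_pd :: "'a::real_normed_vector \<Rightarrow> ('a \<Rightarrow> real) \<Rightarrow> real \<Rightarrow> 'a \<Rightarrow> bool" where
  "has_pd b g d x \<longleftrightarrow> ((\<lambda>s. g (x + s *\<^sub>R b)) has_real_derivative d) (at 0)"

lemma has_pd_imp_pd: "has_pd b g d x \<Longrightarrow> pd b g x = d"
  by (simp add: has_pd_def pd_def DERIV_imp_deriv)

text \<open>\<open>pd\<close> rests on \<open>deriv\<close>, which has some value even where no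
  derivative exists, so an equation for \<open>pd\<close> alone asserts no existence;
  \<open>has_pd\<close> records both. This equivalence lets the differentiability clause of
  \<open>Ck_on\<close> be read as \<open>has_pd\<close>.\<close>

lemma has_pd_iff: "has_pd b g (pd b g x) x \<longleftrightarrow> (\<lambda>s. g (x + s *\<^sub>R b)) differentiable (at 0)"
  unfolding has_pd_def pd_def
  by (metis DERIV_deriv_iff_real_differentiable)

lemma has_pd_line:
  "has_pd b g d (x + s0 *\<^sub>R b) \<longleftrightarrow> ((\<lambda>s. g (x + s *\<^sub>R b)) has_real_derivative d) (at s0)"
  using DERIV_shift[of "\<lambda>s. g (x + s *\<^sub>R b)" d 0 s0]
  by (simp add: has_pd_def algebra_simps)

lemma has_pd_const: "has_pd b (\<lambda>x. c) 0 x"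
  by (simp add: has_pd_def)

lemma has_pd_add: "has_pd b g d x \<Longrightarrow> has_pd b g' d' x \<Longrightarrow> has_pd b (\<lambda>x. g x + g' x) (d + d') x"
  unfolding has_pd_def by (rule DERIV_add)

lemma has_pd_diff: "has_pd b g d x \<Longrightarrow> has_pd b g' d' x \<Longrightarrow> has_pd b (\<lambda>x. g x - g' x) (d - d') x"
  unfolding has_pd_def by (rule DERIV_diff)

lemma has_pd_mult:
  "has_pd b g d x \<Longrightarrow> has_pd b g' d' x \<Longrightarrow> has_pd b (\<lambda>x. g x * g' x) (g x * d' + d * g' x) x"
  unfolding has_pd_def
  by (rule DERIV_cong[OF DERIV_mult]) (auto simp: algebra_simps)

lemma has_pd_cmult: "has_pd b g d x \<Longrightarrow> has_pd b (\<lambda>x. c * g x) (c * d) x"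
  unfolding has_pd_def by (rule DERIV_cmult)

lemma has_pd_sum:
  "finite A \<Longrightarrow> (\<And>i. i \<in> A \<Longrightarrow> has_pd b (g i) (d i) x) \<Longrightarrow> has_pd b (\<lambda>x. \<Sum>i\<in>A. g i x) (\<Sum>i\<in>A. d i) x"
  unfolding has_pd_def by (rule DERIV_sum)

lemma has_pd_chain:
  assumes "has_pd b g d x" "(c has_real_derivative e) (at (g x))"
  shows "has_pd b (\<lambda>x. c (g x)) (e * d) x"
  using assms DERIV_chain2[of c e "\<lambda>s. g (x + s *\<^sub>R b)" 0 d UNIV] by (simp add: has_pd_def)

lemma eventually_line_in_open:
  fixes x b :: "'a::real_normed_vector"
  assumes "open S" "x \<in> S"
  shows "\<forall>\<^sub>F s in nhds 0. x + s *\<^sub>R b \<in> S"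
proof -
  have "open ((\<lambda>s. x + s *\<^sub>R b) -` S)"
    by (intro open_vimage assms(1) continuous_intros)
  then show ?thesis
    unfolding eventually_nhds using assms(2) by (intro exI[of _ "(\<lambda>s. x + s *\<^sub>R b) -` S"]) auto
qed

lemma has_pd_cong_open:
  assumes "open S" "x \<in> S" "\<And>y. y \<in> S \<Longrightarrow> g y = g' y" "has_pd b g d x"
  shows "has_pd b g' d x"
proof -
  from eventually_line_in_open[OF assms(1,2)]
  have "\<forall>\<^sub>F s in nhds 0. g (x + s *\<^sub>R b) = g' (x + s *\<^sub>R b)"
    by (rule eventually_mono) (use assms(3) in auto)
  then show ?thesis
    using assms(4) unfolding has_pd_def by (simp add: DERIV_cong_ev)
qed

lemma has_pd_inner: "b \<in> Basis \<Longrightarrow> has_pd b (\<lambda>x. x \<bullet> c) (b \<bullet> c) x"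
  unfolding has_pd_def by (auto intro!: derivative_eq_intros simp: inner_add_left)

lemma has_pd_fst: "has_pd b g d (fst p) \<Longrightarrow> has_pd (b, 0) (\<lambda>p. g (fst p)) d p"
  by (simp add: has_pd_def)

lemma has_pd_fst_0: "has_pd (0, 1::real) (\<lambda>p. g (fst p)) 0 p"
  by (simp add: has_pd_def)

lemma has_pd_snd: "(c has_real_derivative d) (at (snd p)) \<Longrightarrow> has_pd (0, 1::real) (\<lambda>p. c (snd p)) d p"
  using DERIV_shift[of c d 0 "snd p"] by (simp add: has_pd_def add.commute)

lemma has_pd_snd_0: "has_pd (b, 0) (\<lambda>p. c (snd p)) 0 p"
  by (simp add: has_pd_def)

lemma iter_pd_Nil [simp]: "iter_pd [] g = g"
  and iter_pd_Cons [simp]: "iter_pd (v # vs) g = pd v (iter_pd vs g)"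
  and iter_pd_append: "iter_pd (vs @ ws) g = iter_pd vs (iter_pd ws g)"
  by (simp_all add: iter_pd_def)

lemma Ck_on_0: "Ck_on 0 S g \<longleftrightarrow> continuous_on S g"
  by (auto simp: Ck_on_def)

text \<open>\<open>foldr\<close> applies the last vector of a list first, so lists are taken apart
  at their end. The recursion replaces the quantifiers over lists in all later inductions on the
  order.\<close>

lemma Ck_on_Suc:
  "Ck_on (Suc k) S g \<longleftrightarrow> continuous_on S g \<and>
     (\<forall>b\<in>Basis. (\<forall>x\<in>S. has_pd b g (pd b g x) x) \<and> Ck_on k S (pd b g))"
proof
  assume L: "Ck_on (Suc k) S g"
  have 1: "continuous_on S (iter_pd vs g)" if "set vs \<subseteq> Basis" "length vs \<le> Suc k" for vs
    using L that by (auto simp: Ck_on_def)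
  have 2: "has_pd v (iter_pd vs g) (pd v (iter_pd vs g) x) x"
    if "set vs \<subseteq> Basis" "length vs < Suc k" "v \<in> Basis" "x \<in> S" for vs v x
    using L that unfolding has_pd_iff by (simp add: Ck_on_def)
  show "continuous_on S g \<and>
     (\<forall>b\<in>Basis. (\<forall>x\<in>S. has_pd b g (pd b g x) x) \<and> Ck_on k S (pd b g))"
  proof (intro conjI ballI)
    show "continuous_on S g" using 1[of "[]"] by simp
    fix b :: 'a assume b: "b \<in> Basis"
    show "has_pd b g (pd b g x) x" if "x \<in> S" for x using 2[of "[]" b x] that b by simp
    show "Ck_on k S (pd b g)"
      unfolding Ck_on_def has_pd_iff[symmetric]
    proof (intro conjI allI impI ballI)
      fix vs assume "set vs \<subseteq> (Basis :: 'a set) \<and> length vs \<le> k"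
      then show "continuous_on S (iter_pd vs (pd b g))"
        using 1[of "vs @ [b]"] b by (simp add: iter_pd_append)
    next
      fix vs and v x :: 'a assume "set vs \<subseteq> (Basis :: 'a set) \<and> length vs < k \<and> v \<in> Basis" "x \<in> S"
      then show "has_pd v (iter_pd vs (pd b g)) (pd v (iter_pd vs (pd b g)) x) x"
        using 2[of "vs @ [b]" v x] b by (simp add: iter_pd_append)
    qed
  qed
next
  assume R: "continuous_on S g \<and>
     (\<forall>b\<in>Basis. (\<forall>x\<in>S. has_pd b g (pd b g x) x) \<and> Ck_on k S (pd b g))"
  show "Ck_on (Suc k) S g"
    unfolding Ck_on_def has_pd_iff[symmetric]
  proof (intro conjI allI impI ballI)
    fix vs assume vs: "set vs \<subseteq> (Basis :: 'a set) \<and> length vs \<le> Suc k"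
    show "continuous_on S (iter_pd vs g)"
    proof (cases vs rule: rev_cases)
      case Nil then show ?thesis using R by simp
    next
      case (snoc ws b)
      then have "Ck_on k S (pd b g)" "set ws \<subseteq> Basis" "length ws \<le> k" using R vs by auto
      then show ?thesis using snoc by (simp add: iter_pd_append Ck_on_def)
    qed
  next
    fix vs and v x :: 'a assume vs: "set vs \<subseteq> (Basis :: 'a set) \<and> length vs < Suc k \<and> v \<in> Basis" and x: "x \<in> S"
    show "has_pd v (iter_pd vs g) (pd v (iter_pd vs g) x) x"
    proof (cases vs rule: rev_cases)
      case Nil then show ?thesis using R vs x by simp
    next
      case (snoc ws b)
      then have "Ck_on k S (pd b g)" "set ws \<subseteq> Basis" "length ws < k" using R vs by auto
      then show ?thesis using snoc vs x by (simp add: iter_pd_append Ck_on_def has_pd_iff)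
    qed
  qed
qed

lemma Ck_on_Suc_has_pd: "Ck_on (Suc k) S g \<Longrightarrow> b \<in> Basis \<Longrightarrow> x \<in> S \<Longrightarrow> has_pd b g (pd b g x) x"
  and Ck_on_pd: "Ck_on (Suc k) S g \<Longrightarrow> b \<in> Basis \<Longrightarrow> Ck_on k S (pd b g)"
  and Ck_on_continuous: "Ck_on k S g \<Longrightarrow> continuous_on S g"
  by (auto simp: Ck_on_Suc Ck_on_0) (metis Ck_on_0 Ck_on_Suc not0_implies_Suc)

lemma Ck_on_mono: "Ck_on k S g \<Longrightarrow> j \<le> k \<Longrightarrow> Ck_on j S g"
  by (auto simp: Ck_on_def)

lemma Ck_on_SucD: "Ck_on (Suc k) S g \<Longrightarrow> Ck_on k S g"
  by (rule Ck_on_mono[of "Suc k"]) simp_all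

lemma Ck_on_iter_pd:
  "Ck_on (k + length vs) S g \<Longrightarrow> set vs \<subseteq> Basis \<Longrightarrow> Ck_on k S (iter_pd vs g)"
  by (induction vs arbitrary: k) (auto simp: Ck_on_pd)

lemma pd_cong_open:
  assumes "open S" "x \<in> S" "\<And>y. y \<in> S \<Longrightarrow> g y = g' y"
  shows "pd b g x = pd b g' x"
proof -
  from eventually_line_in_open[OF assms(1,2)]
  have "\<forall>\<^sub>F s in nhds 0. g (x + s *\<^sub>R b) = g' (x + s *\<^sub>R b)"
    by (rule eventually_mono) (use assms(3) in auto)
  then show ?thesis unfolding pd_def by (rule deriv_cong_ev) simp
qed

lemma Ck_on_cong_open:
  assumes "open S" "\<And>y. y \<in> S \<Longrightarrow> g y = g' y" "Ck_on k S g"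
  shows "Ck_on k S g'"
  using assms(2,3)
proof (induction k arbitrary: g g')
  case 0 then show ?case using continuous_on_cong[of S S g g'] by (simp add: Ck_on_0)
next
  case (Suc k)
  have "continuous_on S g'"
    using Ck_on_continuous[OF Suc.prems(2)] Suc.prems(1) continuous_on_cong[of S S g g'] by simp
  moreover have "has_pd b g' (pd b g' x) x" if "b \<in> Basis" "x \<in> S" for b x
  proof -
    have "has_pd b g' (pd b g x) x"
      by (rule has_pd_cong_open[OF assms(1) \<open>x \<in> S\<close> Suc.prems(1) Ck_on_Suc_has_pd[OF Suc.prems(2) that]])
    then show ?thesis using has_pd_imp_pd[of b g' "pd b g x" x] by simp
  qed
  moreover have "Ck_on k S (pd b g')" if "b \<in> Basis" for b
  proof (rule Suc.IH)
    show "pd b g y = pd b g' y" if "y \<in> S" for y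
      using pd_cong_open[OF assms(1) that Suc.prems(1)] .
    show "Ck_on k S (pd b g)" by (rule Ck_on_pd[OF Suc.prems(2) that])
  qed
  ultimately show ?case by (simp add: Ck_on_Suc)
qed

text \<open>\<open>g' b\<close> is an explicit formula for the derivative, known on S only. Since S
  is open, it agrees with \<open>pd b g\<close> near each point of S, and its own regularity carries
  over.\<close>

lemma Ck_on_SucI:
  assumes "open S" "continuous_on S g"
    and "\<And>b x. b \<in> Basis \<Longrightarrow> x \<in> S \<Longrightarrow> has_pd b g (g' b x) x"
    and "\<And>b. b \<in> Basis \<Longrightarrow> Ck_on k S (g' b)"
  shows "Ck_on (Suc k) S g"
  unfolding Ck_on_Suc
proof (intro conjI ballI assms(2))
  fix b :: 'a assume b: "b \<in> Basis"
  have eq: "pd b g x = g' b x" if "x \<in> S" for x using has_pd_imp_pd[OF assms(3)[OF b that]] .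
  show "has_pd b g (pd b g x) x" if "x \<in> S" for x using assms(3)[OF b that] eq[OF that] by simp
  show "Ck_on k S (pd b g)" by (rule Ck_on_cong_open[OF assms(1) _ assms(4)[OF b]]) (simp add: eq)
qed

lemma Ck_on_const: "open S \<Longrightarrow> Ck_on k S (\<lambda>x. c)"
proof (induction k arbitrary: c)
  case (Suc k) then show ?case by (intro Ck_on_SucI[where g'="\<lambda>_ _. 0"]) (auto simp: has_pd_const)
qed (simp add: Ck_on_0)

lemma Ck_on_add:
  assumes "open S" shows "Ck_on k S g \<Longrightarrow> Ck_on k S g' \<Longrightarrow> Ck_on k S (\<lambda>x. g x + g' x)"
proof (induction k arbitrary: g g')
  case (Suc k)
  show ?case
    by (rule Ck_on_SucI[where g'="\<lambda>b x. pd b g x + pd b g' x"])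
      (use Suc assms in \<open>auto intro!: has_pd_add Ck_on_Suc_has_pd Ck_on_pd continuous_on_add intro: Ck_on_continuous\<close>)
qed (simp add: Ck_on_0 continuous_on_add)

lemma Ck_on_mult:
  assumes "open S" shows "Ck_on k S g \<Longrightarrow> Ck_on k S g' \<Longrightarrow> Ck_on k S (\<lambda>x. g x * g' x)"
proof (induction k arbitrary: g g')
  case (Suc k)
  have "Ck_on k S g" "Ck_on k S g'" using Suc.prems Ck_on_SucD by auto
  then show ?case
    by (intro Ck_on_SucI[where g'="\<lambda>b x. g x * pd b g' x + pd b g x * g' x"])
      (use Suc assms in \<open>auto intro!: has_pd_mult Ck_on_Suc_has_pd Ck_on_pd continuous_on_mult Ck_on_add intro: Ck_on_continuous\<close>)
qed (simp add: Ck_on_0 continuous_on_mult)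

lemma Ck_on_cmult: "open S \<Longrightarrow> Ck_on k S g \<Longrightarrow> Ck_on k S (\<lambda>x. c * g x)"
  by (intro Ck_on_mult Ck_on_const)

lemma Ck_on_diff: "open S \<Longrightarrow> Ck_on k S g \<Longrightarrow> Ck_on k S g' \<Longrightarrow> Ck_on k S (\<lambda>x. g x - g' x)"
  using Ck_on_add[of S k g "\<lambda>x. -1 * g' x"] Ck_on_cmult[of S k g' "-1"] by simp

lemma Ck_on_sum:
  assumes "open S" shows "finite A \<Longrightarrow> (\<And>i. i \<in> A \<Longrightarrow> Ck_on k S (g i)) \<Longrightarrow> Ck_on k S (\<lambda>x. \<Sum>i\<in>A. g i x)"
  by (induction A rule: finite_induct) (auto simp: assms intro!: Ck_on_const Ck_on_add)

lemma iter_pd_add: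
  assumes "open S" "Ck_on (length vs) S g" "Ck_on (length vs) S g'" "set vs \<subseteq> Basis" "x \<in> S"
  shows "iter_pd vs (\<lambda>x. g x + g' x) x = iter_pd vs g x + iter_pd vs g' x"
  using assms(2-)
proof (induction vs arbitrary: x)
  case (Cons v vs)
  have c: "Ck_on (length vs) S g" "Ck_on (length vs) S g'" using Cons.prems by (auto intro: Ck_on_SucD)
  have "pd v (iter_pd vs (\<lambda>x. g x + g' x)) x = pd v (\<lambda>x. iter_pd vs g x + iter_pd vs g' x) x"
    by (rule pd_cong_open[OF assms(1)]) (use Cons c in auto)
  also have "\<dots> = pd v (iter_pd vs g) x + pd v (iter_pd vs g') x"
    using Cons.prems assms(1)
    by (intro has_pd_imp_pd has_pd_add Ck_on_Suc_has_pd[of 0 S] Ck_on_iter_pd) auto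
  finally show ?case by simp
qed simp

lemma iter_pd_cmult:
  assumes "open S" "Ck_on (length vs) S g" "set vs \<subseteq> Basis" "x \<in> S"
  shows "iter_pd vs (\<lambda>x. c * g x) x = c * iter_pd vs g x"
  using assms(2-)
proof (induction vs arbitrary: x)
  case (Cons v vs)
  have c: "Ck_on (length vs) S g" using Cons.prems by (auto intro: Ck_on_SucD)
  have "pd v (iter_pd vs (\<lambda>x. c * g x)) x = pd v (\<lambda>x. c * iter_pd vs g x) x"
    by (rule pd_cong_open[OF assms(1)]) (use Cons c in auto)
  also have "\<dots> = c * pd v (iter_pd vs g) x"
    using Cons.prems assms(1)
    by (intro has_pd_imp_pd has_pd_cmult Ck_on_Suc_has_pd[of 0 S] Ck_on_iter_pd) auto
  finally show ?case by simp
qed simp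

text \<open>The coordinates are switched on one at a time: each new direction changes
  \<open>h\<close> by a one-dimensional mean value estimate, whose error is controlled by the
  continuity of that partial derivative at x. Total differentiability is wanted because the means
  below move along arbitrary directions y.\<close>

lemma C1_has_derivative:
  fixes h :: "'a::euclidean_space \<Rightarrow> real"
  assumes "Ck_on 1 UNIV h"
  shows "(h has_derivative (\<lambda>v. \<Sum>b\<in>Basis. (v \<bullet> b) * pd b h x)) (at x)"
proof -
  have pdb: "has_pd b h (pd b h y) y" if "b \<in> Basis" for b y
    using assms that Ck_on_Suc_has_pd[of 0 UNIV h b y] by simp
  have cont: "continuous_on UNIV (pd b h)" if "b \<in> Basis" for b
    using assms that Ck_on_pd[of 0 UNIV h b] by (simp add: Ck_on_0)
  \<comment> \<open>Differentiability at x for increments \<open>v\<close> supported in the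
    coordinates B; the case B = Basis is the claim.\<close>
  have main: "\<forall>e>0. \<exists>d>0. \<forall>v. norm v < d \<and> (\<forall>b\<in>Basis - B. v \<bullet> b = 0) \<longrightarrow>
      \<bar>h (x + v) - h x - (\<Sum>b\<in>B. (v \<bullet> b) * pd b h x)\<bar> \<le> e * norm v" if "finite B" "B \<subseteq> Basis" for B
    using that
  proof (induction B rule: finite_induct)
    case empty
    have "v = 0" if "\<forall>b\<in>Basis - {}. v \<bullet> b = 0" for v :: 'a
      using that by (simp add: euclidean_all_zero_iff)
    then have "\<bar>h (x + v) - h x - (\<Sum>b\<in>{}. (v \<bullet> b) * pd b h x)\<bar> \<le> e * norm v"
      if "\<forall>b\<in>Basis - {}. v \<bullet> b = 0" for v and e :: real
      using that by fastforce
    then show ?case by (intro allI impI exI[of _ 1]) auto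
  next
    case (insert b B)
    have b: "b \<in> Basis" using insert by auto
    show ?case
    proof (intro allI impI)
      fix e :: real assume e: "e > 0"
      have "B \<subseteq> Basis" and e3: "e / 3 > 0" using insert.prems e by auto
      from insert.IH[OF this(1), rule_format, OF e3]
      obtain d1 where d1: "d1 > 0" "\<And>v. norm v < d1 \<Longrightarrow> (\<forall>b\<in>Basis - B. v \<bullet> b = 0) \<Longrightarrow>
        \<bar>h (x + v) - h x - (\<Sum>b\<in>B. (v \<bullet> b) * pd b h x)\<bar> \<le> e/3 * norm v"
        by blast
      have "isCont (pd b h) x" using cont[OF b] by (simp add: continuous_on_eq_continuous_at)
      then obtain d2 where d2: "d2 > 0" "\<And>z. norm (z - x) < d2 \<Longrightarrow> \<bar>pd b h z - pd b h x\<bar> < e/3"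
        using e3 unfolding continuous_at_eps_delta dist_norm real_norm_def by blast
      show "\<exists>d>0. \<forall>v. norm v < d \<and> (\<forall>b\<in>Basis - insert b B. v \<bullet> b = 0) \<longrightarrow>
        \<bar>h (x + v) - h x - (\<Sum>b\<in>insert b B. (v \<bullet> b) * pd b h x)\<bar> \<le> e * norm v"
      \<comment> \<open>With v = w + t b one has |t| \<le> |v| and |w| \<le> 2 |v|, so the segment
        from x + w to x + v stays within 3 |v| of x. The two errors add up to e/3 (2 |v|) + e/3 |v|
        = e |v|.\<close>
      proof (intro exI[of _ "min d1 d2 / 3"] conjI allI impI)
        show "0 < min d1 d2 / 3" using d1 d2 by simp
        fix v assume v: "norm v < min d1 d2 / 3 \<and> (\<forall>b\<in>Basis - insert b B. v \<bullet> b = 0)"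
        define t where "t = v \<bullet> b"
        define w where "w = v - t *\<^sub>R b"
        have nt: "\<bar>t\<bar> \<le> norm v" unfolding t_def using Basis_le_norm b by blast
        have nw: "norm w \<le> 2 * norm v"
          unfolding w_def using norm_triangle_ineq4[of v "t *\<^sub>R b"] nt b by simp
        have wc: "w \<bullet> c = (if c = b then 0 else v \<bullet> c)" if "c \<in> Basis" for c
          using that b by (auto simp: w_def t_def inner_diff_left inner_Basis)
        have vd: "3 * norm v < d1" "3 * norm v < d2" using v by auto
        have "norm w < d1" using vd(1) nw norm_ge_zero[of v] by linarith
        then have "\<bar>h (x + w) - h x - (\<Sum>c\<in>B. (w \<bullet> c) * pd c h x)\<bar> \<le> e/3 * norm w"
          using v wc by (intro d1) auto
        moreover have "(\<Sum>c\<in>B. (w \<bullet> c) * pd c h x) = (\<Sum>c\<in>B. (v \<bullet> c) * pd c h x)"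
        proof (rule sum.cong[OF refl])
          fix c assume "c \<in> B"
          then have "c \<in> Basis" "c \<noteq> b" using insert by auto
          then show "(w \<bullet> c) * pd c h x = (v \<bullet> c) * pd c h x" by (simp add: wc)
        qed
        moreover have "\<bar>h (x + w + t *\<^sub>R b) - h (x + w) - t * pd b h x\<bar> \<le> e/3 * \<bar>t\<bar>"
        proof -
          have D: "((\<lambda>s. h (x + w + s *\<^sub>R b) - s * pd b h x) has_real_derivative (pd b h (x + w + s *\<^sub>R b) - pd b h x)) (at s)" for s
            using pdb[OF b, of "x + w + s *\<^sub>R b"] unfolding has_pd_line
            by (auto intro!: derivative_eq_intros)
          have bd: "norm (pd b h (x + w + s *\<^sub>R b) - pd b h x) \<le> e/3" if "s \<in> closed_segment 0 t" for s
          proof -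
            have "\<bar>s\<bar> \<le> \<bar>t\<bar>" using that by (auto simp: closed_segment_eq_real_ivl split: if_splits)
            then have "norm (w + s *\<^sub>R b) \<le> 3 * norm v"
              using norm_triangle_ineq[of w "s *\<^sub>R b"] nw nt b by simp
            then have "norm (x + w + s *\<^sub>R b - x) < d2" using vd(2) by (simp add: add.assoc)
            from d2(2)[OF this] show ?thesis by simp
          qed
          have "norm ((h (x + w + t *\<^sub>R b) - t * pd b h x) - (h (x + w + 0 *\<^sub>R b) - 0 * pd b h x)) \<le> e/3 * norm (t - 0)"
            using D bd
            by (intro field_differentiable_bound[of "closed_segment 0 t" "\<lambda>s. h (x + w + s *\<^sub>R b) - s * pd b h x" "\<lambda>s. pd b h (x + w + s *\<^sub>R b) - pd b h x"])
              (auto intro: has_field_derivative_at_within)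
          then show ?thesis by (simp add: algebra_simps)
        qed
        moreover have "h (x + w + t *\<^sub>R b) = h (x + v)" by (simp add: w_def)
        moreover have "(\<Sum>c\<in>insert b B. (v \<bullet> c) * pd c h x) = t * pd b h x + (\<Sum>c\<in>B. (v \<bullet> c) * pd c h x)"
          using insert by (simp add: t_def)
        moreover have "e/3 * norm w + e/3 * \<bar>t\<bar> \<le> e * norm v"
        proof -
          have "e/3 * norm w \<le> e/3 * (2 * norm v)" "e/3 * \<bar>t\<bar> \<le> e/3 * norm v"
            using nw nt e by (intro mult_left_mono; simp)+
          then show ?thesis by simp
        qed
        ultimately show "\<bar>h (x + v) - h x - (\<Sum>b\<in>insert b B. (v \<bullet> b) * pd b h x)\<bar> \<le> e * norm v"
          by linarith
      qed
    qed
  qed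
  have bl: "bounded_linear (\<lambda>v. \<Sum>b\<in>Basis. (v \<bullet> b) * pd b h x)"
    by (intro bounded_linear_sum bounded_linear_mult_const bounded_linear_inner_left)
  show ?thesis
    unfolding has_derivative_at_alt
  proof (intro conjI bl allI impI)
    fix e :: real assume "0 < e"
    then obtain d where "d > 0" "\<forall>v. norm v < d \<longrightarrow>
       \<bar>h (x + v) - h x - (\<Sum>b\<in>Basis. (v \<bullet> b) * pd b h x)\<bar> \<le> e * norm v"
      using main[of Basis] by auto
    then show "\<exists>d>0. \<forall>y. norm (y - x) < d \<longrightarrow>
       norm (h y - h x - (\<Sum>b\<in>Basis. (y - x) \<bullet> b * pd b h x)) \<le> e * norm (y - x)"
      proof (intro exI[of _ d] conjI allI impI)
      fix y assume "0 < d" and *: "\<forall>v. norm v < d \<longrightarrow>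
       \<bar>h (x + v) - h x - (\<Sum>b\<in>Basis. (v \<bullet> b) * pd b h x)\<bar> \<le> e * norm v" and "norm (y - x) < d"
      then show "norm (h y - h x - (\<Sum>b\<in>Basis. (y - x) \<bullet> b * pd b h x)) \<le> e * norm (y - x)"
        using *[rule_format, of "y - x"] by simp
    qed simp
  qed
qed

lemma C1_line_derivative:
  fixes h :: "'a::euclidean_space \<Rightarrow> real"
  assumes "Ck_on 1 UNIV h"
  shows "((\<lambda>s. h (x + s *\<^sub>R y)) has_real_derivative (\<Sum>b\<in>Basis. (y \<bullet> b) * pd b h (x + s *\<^sub>R y))) (at s)"
proof -
  have 1: "((\<lambda>s. x + s *\<^sub>R y) has_derivative (\<lambda>s. s *\<^sub>R y)) (at s)"
    by (auto intro!: derivative_eq_intros)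
  show ?thesis
    using has_derivative_compose[OF 1 C1_has_derivative[OF assms]]
    unfolding has_field_derivative_def
    by (rule has_derivative_eq_rhs) (simp add: fun_eq_iff sum_distrib_left mult_ac)
qed

text \<open>The integral of \<open>pd b g\<close> along b from 0 to s is a difference of values of
  g. Differentiating it along c under the integral sign, and the outcome in s, produces the two
  mixed derivatives.\<close>

lemma pd_commute:
  fixes g :: "'a::euclidean_space \<Rightarrow> real"
  assumes "Ck_on 2 UNIV g" "b \<in> Basis" "c \<in> Basis"
  shows "pd b (pd c g) x = pd c (pd b g) x"
proof -
  have C: "Ck_on (Suc (Suc 0)) UNIV g" using assms(1) by (simp add: numeral_2_eq_2)
  have C1: "Ck_on (Suc 0) UNIV g" using Ck_on_mono[OF C] by simp
  \<comment> \<open>From this base point x is reached at s = 1, so the integral formula for s \<ge>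
    0 holds on both sides of it and a two-sided derivative can be taken.\<close>
  define y where "y = x - b"
  have Db: "((\<lambda>s. g (z + s *\<^sub>R b)) has_real_derivative pd b g (z + s *\<^sub>R b)) (at s)" for z s
    using Ck_on_Suc_has_pd[OF C1 assms(2)] unfolding has_pd_line[symmetric] by simp
  have Dc: "((\<lambda>s. g (z + s *\<^sub>R c)) has_real_derivative pd c g (z + s *\<^sub>R c)) (at s)" for z s
    using Ck_on_Suc_has_pd[OF C1 assms(3)] unfolding has_pd_line[symmetric] by simp
  have Dcb: "((\<lambda>s. pd b g (z + s *\<^sub>R c)) has_real_derivative pd c (pd b g) (z + s *\<^sub>R c)) (at s)" for z s
    using Ck_on_Suc_has_pd[OF Ck_on_pd[OF C assms(2)] assms(3)] unfolding has_pd_line[symmetric] by simp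
  have Dbc: "((\<lambda>s. pd c g (z + s *\<^sub>R b)) has_real_derivative pd b (pd c g) (z + s *\<^sub>R b)) (at s)" for z s
    using Ck_on_Suc_has_pd[OF Ck_on_pd[OF C assms(3)] assms(2)] unfolding has_pd_line[symmetric] by simp
  have ccb: "continuous_on UNIV (pd c (pd b g))"
    using Ck_on_pd[OF Ck_on_pd[OF C assms(2)] assms(3)] by (simp add: Ck_on_0)
  have int: "((\<lambda>\<sigma>. pd b g (y + t *\<^sub>R c + \<sigma> *\<^sub>R b)) has_integral g (y + t *\<^sub>R c + s *\<^sub>R b) - g (y + t *\<^sub>R c + 0 *\<^sub>R b)) {0..s}"
    if "0 \<le> s" for s t
    using that Db by (intro fundamental_theorem_of_calculus)
      (auto simp: has_real_derivative_iff_has_vector_derivative[symmetric] intro: has_field_derivative_at_within)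
  have eq: "pd c g (y + s *\<^sub>R b) = pd c g y + integral {0..s} (\<lambda>\<sigma>. pd c (pd b g) (y + \<sigma> *\<^sub>R b))" if s: "0 \<le> s" for s
  proof -
    have "((\<lambda>t. integral (cbox 0 s) (\<lambda>\<sigma>. pd b g (y + t *\<^sub>R c + \<sigma> *\<^sub>R b))) has_field_derivative
           integral (cbox 0 s) (\<lambda>\<sigma>. pd c (pd b g) (y + 0 *\<^sub>R c + \<sigma> *\<^sub>R b))) (at 0 within UNIV)"
    proof (rule leibniz_rule_field_derivative)
      show "((\<lambda>t. pd b g (y + t *\<^sub>R c + \<sigma> *\<^sub>R b)) has_real_derivative pd c (pd b g) (y + t *\<^sub>R c + \<sigma> *\<^sub>R b)) (at t)" for t \<sigma>
        using Dcb[of "y + \<sigma> *\<^sub>R b" t] by (simp add: algebra_simps)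
      show "(\<lambda>\<sigma>. pd b g (y + t *\<^sub>R c + \<sigma> *\<^sub>R b)) integrable_on cbox 0 s" for t
        using int[OF s, of t] by (auto simp: integrable_on_def)
      show "continuous_on (UNIV \<times> cbox 0 s) (\<lambda>(t, \<sigma>). pd c (pd b g) (y + t *\<^sub>R c + \<sigma> *\<^sub>R b))"
        unfolding split_beta
        by (rule continuous_on_compose2[OF ccb]) (auto intro!: continuous_intros)
    qed auto
    moreover have "((\<lambda>t. g (y + t *\<^sub>R c + s *\<^sub>R b) - g (y + t *\<^sub>R c)) has_real_derivative
        pd c g (y + s *\<^sub>R b) - pd c g y) (at 0)"
      using Dc[of "y + s *\<^sub>R b" 0] Dc[of y 0]
      by (auto intro!: derivative_eq_intros simp: algebra_simps)
    moreover have "integral (cbox 0 s) (\<lambda>\<sigma>. pd b g (y + t *\<^sub>R c + \<sigma> *\<^sub>R b)) = g (y + t *\<^sub>R c + s *\<^sub>R b) - g (y + t *\<^sub>R c)" for t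
      using int[OF s, of t] by (simp add: integral_unique)
    ultimately have "integral (cbox 0 s) (\<lambda>\<sigma>. pd c (pd b g) (y + 0 *\<^sub>R c + \<sigma> *\<^sub>R b)) = pd c g (y + s *\<^sub>R b) - pd c g y"
      by (simp add: DERIV_unique)
    then show ?thesis by simp
  qed
  have "((\<lambda>s. integral {0..s} (\<lambda>\<sigma>. pd c (pd b g) (y + \<sigma> *\<^sub>R b))) has_real_derivative pd c (pd b g) (y + 1 *\<^sub>R b)) (at 1 within {0..2})"
    by (rule integral_has_real_derivative) (auto intro!: continuous_intros continuous_on_compose2[OF ccb])
  then have "((\<lambda>s. integral {0..s} (\<lambda>\<sigma>. pd c (pd b g) (y + \<sigma> *\<^sub>R b))) has_real_derivative pd c (pd b g) (y + 1 *\<^sub>R b)) (at 1)"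
    using at_within_Icc_at[of 0 "1::real" 2] by simp
  then have A: "((\<lambda>s. pd c g y + integral {0..s} (\<lambda>\<sigma>. pd c (pd b g) (y + \<sigma> *\<^sub>R b))) has_real_derivative 0 + pd c (pd b g) (y + 1 *\<^sub>R b)) (at 1)"
    by (intro DERIV_add DERIV_const)
  have B: "\<forall>\<^sub>F s in nhds 1. pd c g y + integral {0..s} (\<lambda>\<sigma>. pd c (pd b g) (y + \<sigma> *\<^sub>R b)) = pd c g (y + s *\<^sub>R b)"
    unfolding eventually_nhds
  proof (intro exI[of _ "{0<..}"] conjI ballI)
    fix s :: real assume "s \<in> {0<..}"
    then have "0 \<le> s" by simp
    from eq[OF this] show "pd c g y + integral {0..s} (\<lambda>\<sigma>. pd c (pd b g) (y + \<sigma> *\<^sub>R b)) = pd c g (y + s *\<^sub>R b)"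
      by (rule sym)
  qed auto
  have "((\<lambda>s. pd c g (y + s *\<^sub>R b)) has_real_derivative 0 + pd c (pd b g) (y + 1 *\<^sub>R b)) (at 1)"
    by (rule iffD1[OF DERIV_cong_ev[OF refl B refl] A])
  from DERIV_unique[OF Dbc[of y 1] this] show ?thesis by (simp add: y_def)
qed

lemma iter_pd_pd_commute:
  fixes g :: "'a::euclidean_space \<Rightarrow> real"
  assumes "Ck_on (Suc (length vs)) UNIV g" "b \<in> Basis" "set vs \<subseteq> Basis"
  shows "iter_pd vs (pd b g) = pd b (iter_pd vs g)"
  using assms
proof (induction vs)
  case (Cons v vs)
  have "iter_pd vs (pd b g) = pd b (iter_pd vs g)"
    using Cons.prems Ck_on_SucD[of "Suc (length vs)" UNIV g] by (intro Cons.IH) auto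
  moreover have "Ck_on 2 UNIV (iter_pd vs g)" using Cons.prems by (intro Ck_on_iter_pd) auto
  ultimately show ?case using pd_commute[of "iter_pd vs g" v b] Cons.prems by auto
qed simp

section \<open>Functionals bounded by the supremum over the unit ball\<close>

text \<open>
  Only the values on the closed unit ball matter, but continuity is required everywhere: all integrands
  below are defined on the whole space.
\<close>

definition ball_functional :: "(('a::euclidean_space \<Rightarrow> real) \<Rightarrow> real) \<Rightarrow> bool" where
  "ball_functional \<Phi> \<longleftrightarrow>
     (\<forall>G H. continuous_on UNIV G \<longrightarrow> continuous_on UNIV H \<longrightarrow> \<Phi> (\<lambda>y. G y + H y) = \<Phi> G + \<Phi> H) \<and>
     (\<forall>c G. continuous_on UNIV G \<longrightarrow> \<Phi> (\<lambda>y. c * G y) = c * \<Phi> G) \<and>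
     (\<exists>C\<ge>0. \<forall>G B. continuous_on UNIV G \<longrightarrow> (\<forall>y\<in>cball 0 1. \<bar>G y\<bar> \<le> B) \<longrightarrow> \<bar>\<Phi> G\<bar> \<le> C * B)"

lemma ball_functional_add: "ball_functional \<Phi> \<Longrightarrow> continuous_on UNIV G \<Longrightarrow> continuous_on UNIV H \<Longrightarrow> \<Phi> (\<lambda>y. G y + H y) = \<Phi> G + \<Phi> H"
  and ball_functional_cmult: "ball_functional \<Phi> \<Longrightarrow> continuous_on UNIV G \<Longrightarrow> \<Phi> (\<lambda>y. c * G y) = c * \<Phi> G"
  by (simp_all add: ball_functional_def)

lemma ball_functional_bound:
  assumes "ball_functional \<Phi>"
  obtains C where "C \<ge> 0"
    "\<And>G B. continuous_on UNIV G \<Longrightarrow> (\<And>y. y \<in> cball 0 1 \<Longrightarrow> \<bar>G y\<bar> \<le> B) \<Longrightarrow> \<bar>\<Phi> G\<bar> \<le> C * B"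
  using assms unfolding ball_functional_def by blast

lemma ball_functional_diff:
  assumes "ball_functional \<Phi>" "continuous_on UNIV G" "continuous_on UNIV H"
  shows "\<Phi> (\<lambda>y. G y - H y) = \<Phi> G - \<Phi> H"
proof -
  have "\<Phi> (\<lambda>y. G y + (-1) * H y) = \<Phi> G + \<Phi> (\<lambda>y. (-1) * H y)"
    using assms by (intro ball_functional_add continuous_intros)
  also have "\<Phi> (\<lambda>y. (-1) * H y) = - 1 * \<Phi> H" by (rule ball_functional_cmult[OF assms(1,3)])
  finally show ?thesis by simp
qed

lemma ball_functional_zero: "ball_functional \<Phi> \<Longrightarrow> \<Phi> (\<lambda>y. 0) = 0"
  using ball_functional_cmult[of \<Phi> "\<lambda>y. 0" 0] by simp

lemma ball_functional_sum:
  assumes "ball_functional \<Phi>" "finite A" "\<And>i. i \<in> A \<Longrightarrow> continuous_on UNIV (G i)"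
  shows "\<Phi> (\<lambda>y. \<Sum>i\<in>A. G i y) = (\<Sum>i\<in>A. \<Phi> (G i))"
  using assms(2,3)
proof (induction A rule: finite_induct)
  case empty then show ?case using ball_functional_zero[OF assms(1)] by simp
next
  case (insert i A)
  have "\<Phi> (\<lambda>y. \<Sum>i\<in>insert i A. G i y) = \<Phi> (\<lambda>y. G i y + (\<Sum>i\<in>A. G i y))"
    using insert by simp
  also have "\<dots> = \<Phi> (G i) + \<Phi> (\<lambda>y. \<Sum>i\<in>A. G i y)"
    using insert by (intro ball_functional_add[OF assms(1)] continuous_on_sum) auto
  finally show ?case using insert by simp
qed

text \<open>Weights y \<bullet> b arise whenever h(x + r y) is differentiated in r; absorbing them
  keeps the result a functional of the same kind.\<close>

lemma ball_functional_weight: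
  assumes "ball_functional \<Phi>" "continuous_on UNIV q"
  shows "ball_functional (\<lambda>G. \<Phi> (\<lambda>y. q y * G y))"
proof -
  obtain C where C: "C \<ge> 0"
    "\<And>G B. continuous_on UNIV G \<Longrightarrow> (\<And>y. y \<in> cball 0 1 \<Longrightarrow> \<bar>G y\<bar> \<le> B) \<Longrightarrow> \<bar>\<Phi> G\<bar> \<le> C * B"
    using ball_functional_bound[OF assms(1)] by blast
  have "compact (q ` cball 0 1)"
    using assms(2) by (intro compact_continuous_image) (auto intro: continuous_on_subset)
  then obtain K where K: "\<And>y. y \<in> cball 0 1 \<Longrightarrow> \<bar>q y\<bar> \<le> K"
    using compact_imp_bounded[THEN bounded_pos[THEN iffD1]] by fastforce
  have K0: "K \<ge> 0" using K[of 0] by simp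
  have "\<bar>\<Phi> (\<lambda>y. q y * G y)\<bar> \<le> (C * K) * B"
    if "continuous_on UNIV G" "\<forall>y\<in>cball 0 1. \<bar>G y\<bar> \<le> B" for G B
  proof -
    have "\<bar>\<Phi> (\<lambda>y. q y * G y)\<bar> \<le> C * (K * B)"
      by (rule C(2)) (use that assms(2) K K0 in \<open>auto intro!: continuous_intros mult_mono simp: abs_mult\<close>)
    then show ?thesis by (simp add: mult.assoc)
  qed
  moreover have "\<Phi> (\<lambda>y. q y * (G y + H y)) = \<Phi> (\<lambda>y. q y * G y) + \<Phi> (\<lambda>y. q y * H y)"
    if "continuous_on UNIV G" "continuous_on UNIV H" for G H
    unfolding distrib_left using that assms by (intro ball_functional_add continuous_intros)
  moreover have "\<Phi> (\<lambda>y. q y * (c * G y)) = c * \<Phi> (\<lambda>y. q y * G y)"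
    if "continuous_on UNIV G" for G c
    using ball_functional_cmult[OF assms(1), of "\<lambda>y. q y * G y" c] that assms(2)
    by (simp add: continuous_on_mult mult.left_commute)
  ultimately show ?thesis
    unfolding ball_functional_def using C(1) K0 by (intro conjI allI impI exI[of _ "C * K"]) auto
qed

text \<open>By compactness of the unit ball, \<open>K p\<close> tends to \<open>K p0\<close>
  uniformly there, and the sup bound passes this on to \<Phi>.\<close>

lemma ball_functional_continuous_param:
  fixes K :: "'p::topological_space \<Rightarrow> 'a::euclidean_space \<Rightarrow> real"
  assumes "ball_functional \<Phi>" "continuous_on (A \<times> UNIV) (\<lambda>(p, y). K p y)"
  shows "continuous_on A (\<lambda>p. \<Phi> (K p))"
proof -
  obtain C where C: "C \<ge> 0"
    "\<And>G B. continuous_on UNIV G \<Longrightarrow> (\<And>y. y \<in> cball 0 1 \<Longrightarrow> \<bar>G y\<bar> \<le> B) \<Longrightarrow> \<bar>\<Phi> G\<bar> \<le> C * B"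
    using ball_functional_bound[OF assms(1)] by blast
  have cK: "continuous_on UNIV (K p)" if "p \<in> A" for p
    using that by (auto intro!: continuous_on_compose2[OF assms(2), of UNIV "\<lambda>y. (p, y)", simplified] continuous_intros)
  have cc: "continuous_on (A \<times> cball 0 1) (\<lambda>(p, y). K p y)"
    by (rule continuous_on_subset[OF assms(2)]) auto
  have "\<forall>\<^sub>F p in at p0 within A. dist (\<Phi> (K p)) (\<Phi> (K p0)) < e" if p0: "p0 \<in> A" and e: "e > 0" for p0 e
  proof -
    \<comment> \<open>The 1 in C + 1 covers C = 0, and the factor 1/2 makes the final inequality
      strict.\<close>
    define e' where "e' = e / (C + 1) / 2"
    have e': "e' > 0" using e C(1) by (simp add: e'_def)
    obtain X0 where X0: "p0 \<in> X0" "open X0"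
      and X: "\<forall>p\<in>X0 \<inter> A. \<forall>y\<in>cball 0 1. dist (case (p, y) of (p, y) \<Rightarrow> K p y) (case (p0, y) of (p, y) \<Rightarrow> K p y) \<le> e'"
      by (rule continuous_on_prod_compactE[OF cc compact_cball p0 e'])
    have "dist (\<Phi> (K p)) (\<Phi> (K p0)) < e" if "p \<in> X0" "p \<in> A" for p
    proof -
      have "\<bar>\<Phi> (\<lambda>y. K p y - K p0 y)\<bar> \<le> C * e'"
        using X that p0 by (intro C(2) continuous_intros cK) (auto simp: dist_real_def)
      moreover have "\<Phi> (\<lambda>y. K p y - K p0 y) = \<Phi> (K p) - \<Phi> (K p0)"
        using that p0 by (intro ball_functional_diff[OF assms(1)] cK)
      moreover have "C * e' < e"
      proof -
        have "C * e' \<le> (C + 1) * e'" using e' by simp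
        also have "\<dots> = e / 2" using C(1) by (simp add: e'_def field_simps)
        also have "\<dots> < e" using e by simp
        finally show ?thesis .
      qed
      ultimately show ?thesis by (simp add: dist_real_def)
    qed
    then show ?thesis using X0 unfolding eventually_at_topological by blast
  qed
  then show ?thesis unfolding continuous_on_def tendsto_iff by blast
qed

text \<open>A mean value estimate for \<open>K s y - s * K' s0 y\<close> makes the first-order
  remainder small uniformly for y in the unit ball; the sup bound on \<Phi> then gives
  differentiability.\<close>

lemma ball_functional_deriv:
  fixes K K' :: "real \<Rightarrow> 'a::euclidean_space \<Rightarrow> real"
  assumes "ball_functional \<Phi>" "\<And>s y. ((\<lambda>s. K s y) has_real_derivative K' s y) (at s)"
    and cK: "\<And>s. continuous_on UNIV (K s)"
    and cK': "continuous_on UNIV (\<lambda>(s, y). K' s y)"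
  shows "((\<lambda>s. \<Phi> (K s)) has_real_derivative \<Phi> (K' s0)) (at s0)"
proof -
  obtain C where C: "C \<ge> 0"
    "\<And>G B. continuous_on UNIV G \<Longrightarrow> (\<And>y. y \<in> cball 0 1 \<Longrightarrow> \<bar>G y\<bar> \<le> B) \<Longrightarrow> \<bar>\<Phi> G\<bar> \<le> C * B"
    using ball_functional_bound[OF assms(1)] by blast
  have cKs: "continuous_on UNIV (K' s)" for s
    by (auto intro!: continuous_on_compose2[OF cK', of UNIV "\<lambda>y. (s, y)", simplified] continuous_intros)
  have cc: "continuous_on (UNIV \<times> cball 0 1) (\<lambda>(s, y). K' s y)"
    by (rule continuous_on_subset[OF cK']) auto
  show ?thesis
    unfolding has_field_derivative_def has_derivative_at_alt
  proof (intro conjI allI impI)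
    show "bounded_linear ((*) (\<Phi> (K' s0)))" by (rule bounded_linear_mult_right)
    fix e :: real assume e: "0 < e"
    define e' where "e' = e / (C + 1)"
    have e': "e' > 0" using e C(1) by (simp add: e'_def)
    obtain X0 where X0: "s0 \<in> X0" "open X0"
      and X: "\<forall>s\<in>X0 \<inter> UNIV. \<forall>y\<in>cball 0 1. dist (case (s, y) of (s, y) \<Rightarrow> K' s y) (case (s0, y) of (s, y) \<Rightarrow> K' s y) \<le> e'"
      by (rule continuous_on_prod_compactE[OF cc compact_cball UNIV_I e'])
    obtain d where d: "d > 0" "ball s0 d \<subseteq> X0" using X0 open_contains_ball by blast
    show "\<exists>d>0. \<forall>y. norm (y - s0) < d \<longrightarrow>
         norm (\<Phi> (K y) - \<Phi> (K s0) - \<Phi> (K' s0) * (y - s0)) \<le> e * norm (y - s0)"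
    proof (intro exI[of _ d] conjI d(1) allI impI)
      fix s assume s: "norm (s - s0) < d"
      have "\<bar>K s y - K s0 y - (s - s0) * K' s0 y\<bar> \<le> e' * \<bar>s - s0\<bar>" if y: "y \<in> cball 0 1" for y
      proof -
        have D: "((\<lambda>s. K s y - s * K' s0 y) has_real_derivative (K' u y - K' s0 y)) (at u)" for u
          using assms(2)[of y u] by (auto intro!: derivative_eq_intros)
        have bd: "norm (K' u y - K' s0 y) \<le> e'" if "u \<in> closed_segment s0 s" for u
        proof -
          have "\<bar>u - s0\<bar> \<le> \<bar>s - s0\<bar>" using that by (auto simp: closed_segment_eq_real_ivl split: if_splits)
          then have "u \<in> X0" using d s by (auto simp: dist_real_def subset_iff)
          then show ?thesis using X y by (auto simp: dist_real_def)
        qed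
        have "norm ((K s y - s * K' s0 y) - (K s0 y - s0 * K' s0 y)) \<le> e' * norm (s - s0)"
          by (rule field_differentiable_bound[of "closed_segment s0 s" "\<lambda>s. K s y - s * K' s0 y" "\<lambda>u. K' u y - K' s0 y"])
            (use D bd in \<open>auto intro: has_field_derivative_at_within\<close>)
        then show ?thesis by (simp add: algebra_simps)
      qed
      then have "\<bar>\<Phi> (\<lambda>y. K s y - K s0 y - (s - s0) * K' s0 y)\<bar> \<le> C * (e' * \<bar>s - s0\<bar>)"
        by (intro C(2) continuous_intros cK cKs) auto
      moreover have "\<Phi> (\<lambda>y. K s y - K s0 y - (s - s0) * K' s0 y) = \<Phi> (K s) - \<Phi> (K s0) - (s - s0) * \<Phi> (K' s0)"
        using ball_functional_diff[OF assms(1), of "\<lambda>y. K s y - K s0 y" "\<lambda>y. (s - s0) * K' s0 y"]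
          ball_functional_diff[OF assms(1) cK cK] ball_functional_cmult[OF assms(1) cKs]
        by (simp add: continuous_intros cK cKs)
      moreover have "C * (e' * \<bar>s - s0\<bar>) \<le> e * \<bar>s - s0\<bar>"
      proof -
        have "C * e' \<le> (C + 1) * e'" using e' by simp
        also have "\<dots> = e" using C(1) by (simp add: e'_def)
        finally show ?thesis using mult_right_mono[of "C * e'" e "\<bar>s - s0\<bar>"] by (simp add: mult.assoc)
      qed
      ultimately show "norm (\<Phi> (K s) - \<Phi> (K s0) - \<Phi> (K' s0) * (s - s0)) \<le> e * norm (s - s0)"
        by (simp add: mult.commute)
    qed
  qed
qed

text \<open>The integral of r^m \<Phi>(h(x + r y)) over 0 \<le> r \<le> R takes this form, up to a
  power of R, under r = R \<mu> with G(y) = h(x + R y). Since \<mu> \<le> 1 maps the unit ball into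
  itself, the sup bound survives; this is how primitives in r stay within the class.\<close>

lemma ball_functional_average:
  assumes "ball_functional \<Phi>"
  shows "ball_functional (\<lambda>G. integral {0..1} (\<lambda>\<mu>. \<mu> ^ m * \<Phi> (\<lambda>y. G (\<mu> *\<^sub>R y))))"
    and "continuous_on UNIV G \<Longrightarrow> (\<lambda>\<mu>. \<mu> ^ m * \<Phi> (\<lambda>y. G (\<mu> *\<^sub>R y))) integrable_on {0..1}"
proof -
  obtain C where C: "C \<ge> 0"
    "\<And>G B. continuous_on UNIV G \<Longrightarrow> (\<And>y. y \<in> cball 0 1 \<Longrightarrow> \<bar>G y\<bar> \<le> B) \<Longrightarrow> \<bar>\<Phi> G\<bar> \<le> C * B"
    using ball_functional_bound[OF assms(1)] by blast
  have c: "continuous_on UNIV (\<lambda>y. G (\<mu> *\<^sub>R y))" if "continuous_on UNIV G" for G :: "'a \<Rightarrow> real" and \<mu>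
    by (rule continuous_on_compose2[OF that]) (auto intro!: continuous_intros)
  have cp: "continuous_on UNIV (\<lambda>\<mu>. \<Phi> (\<lambda>y. G (\<mu> *\<^sub>R y)))" if "continuous_on UNIV G" for G
    using that by (intro ball_functional_continuous_param[OF assms])
      (auto simp: split_beta intro!: continuous_intros continuous_on_compose2[OF that])
  have int: "(\<lambda>\<mu>. \<mu> ^ m * \<Phi> (\<lambda>y. G (\<mu> *\<^sub>R y))) integrable_on {0..1}" if "continuous_on UNIV G" for G
    by (intro integrable_continuous_real continuous_intros continuous_on_subset[OF cp[OF that]]) auto
  then show "continuous_on UNIV G \<Longrightarrow> (\<lambda>\<mu>. \<mu> ^ m * \<Phi> (\<lambda>y. G (\<mu> *\<^sub>R y))) integrable_on {0..1}" .
  have "\<bar>integral {0..1} (\<lambda>\<mu>. \<mu> ^ m * \<Phi> (\<lambda>y. G (\<mu> *\<^sub>R y)))\<bar> \<le> C * B"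
    if G: "continuous_on UNIV G" and B: "\<forall>y\<in>cball 0 1. \<bar>G y\<bar> \<le> B" for G B
  proof -
    have "\<bar>\<mu> ^ m * \<Phi> (\<lambda>y. G (\<mu> *\<^sub>R y))\<bar> \<le> C * B" if "\<mu> \<in> {0..1}" for \<mu>
    proof -
      have "norm (\<mu> *\<^sub>R y) \<le> 1" if "norm y \<le> 1" for y :: 'a
        using that \<open>\<mu> \<in> {0..1}\<close> mult_mono[of "\<bar>\<mu>\<bar>" 1 "norm y" 1] by simp
      then have "\<bar>\<Phi> (\<lambda>y. G (\<mu> *\<^sub>R y))\<bar> \<le> C * B" using B by (intro C(2) c G) auto
      moreover have "\<bar>\<mu> ^ m\<bar> \<le> 1" using that by (simp add: power_le_one power_abs)
      ultimately show ?thesis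
        using mult_mono[of "\<bar>\<mu> ^ m\<bar>" 1 "\<bar>\<Phi> (\<lambda>y. G (\<mu> *\<^sub>R y))\<bar>" "C * B"] by (simp add: abs_mult)
    qed
    then have "norm (integral {0..1} (\<lambda>\<mu>. \<mu> ^ m * \<Phi> (\<lambda>y. G (\<mu> *\<^sub>R y)))) \<le> integral {0..1} (\<lambda>\<mu>::real. C * B)"
      by (intro integral_norm_bound_integral int G) auto
    then show ?thesis by simp
  qed
  then show "ball_functional (\<lambda>G. integral {0..1} (\<lambda>\<mu>. \<mu> ^ m * \<Phi> (\<lambda>y. G (\<mu> *\<^sub>R y))))"
    unfolding ball_functional_def using C(1)
    by (intro conjI allI impI exI[of _ C])
      (auto simp: ball_functional_add[OF assms c c] ball_functional_cmult[OF assms c] distrib_left int integral_add mult.left_commute[of _ "_::real"] simp flip: integral_mult_right)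
qed

section \<open>Mean-value operators\<close>

lemma ball_functional_scale:
  assumes "ball_functional \<Phi>" shows "ball_functional (\<lambda>G. c * \<Phi> G)"
proof -
  obtain C where C: "C \<ge> 0"
    "\<And>G B. continuous_on UNIV G \<Longrightarrow> (\<And>y. y \<in> cball 0 1 \<Longrightarrow> \<bar>G y\<bar> \<le> B) \<Longrightarrow> \<bar>\<Phi> G\<bar> \<le> C * B"
    using ball_functional_bound[OF assms(1)] by blast
  have "\<bar>c * \<Phi> G\<bar> \<le> (\<bar>c\<bar> * C) * B" if "continuous_on UNIV G" "\<forall>y\<in>cball 0 1. \<bar>G y\<bar> \<le> B" for G B
    using C(2)[OF that(1)] that(2) mult_left_mono[of "\<bar>\<Phi> G\<bar>" "C * B" "\<bar>c\<bar>"] by (simp add: abs_mult mult.assoc)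
  then show ?thesis
    unfolding ball_functional_def using C(1) ball_functional_add[OF assms(1)] ball_functional_cmult[OF assms(1)]
    by (intro conjI allI impI exI[of _ "\<bar>c\<bar> * C"]) (auto simp: distrib_left)
qed

text \<open>\<open>m\<close> bounds the number of derivatives of the argument \<open>h\<close> that enter.\<close>

inductive mean_operator :: "nat \<Rightarrow> (('a::euclidean_space \<Rightarrow> real) \<Rightarrow> 'a \<times> real \<Rightarrow> real) \<Rightarrow> bool" for m where
  base: "ball_functional \<Phi> \<Longrightarrow> set \<gamma> \<subseteq> Basis \<Longrightarrow> length \<gamma> \<le> m \<Longrightarrow>
    mean_operator m (\<lambda>h p. snd p ^ a * \<Phi> (\<lambda>y. iter_pd \<gamma> h (fst p + snd p *\<^sub>R y)))"
| add: "mean_operator m S \<Longrightarrow> mean_operator m T \<Longrightarrow> mean_operator m (\<lambda>h p. S h p + T h p)"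

lemma mean_operator_mono: "mean_operator m T \<Longrightarrow> m \<le> m' \<Longrightarrow> mean_operator m' T"
  by (induction rule: mean_operator.induct) (auto intro!: mean_operator.intros)

lemma mean_operator_cmult: "mean_operator m T \<Longrightarrow> mean_operator m (\<lambda>h p. c * T h p)"
proof (induction rule: mean_operator.induct)
  case (base \<Phi> \<gamma> a)
  from mean_operator.base[OF ball_functional_scale[OF base(1), of c] base(2,3), of a]
  show ?case by (simp add: mult.left_commute)
next
  case (add S T)
  from mean_operator.add[OF add.IH] show ?case by (simp add: distrib_left)
qed

lemma mean_operator_times_r: "mean_operator m T \<Longrightarrow> mean_operator m (\<lambda>h p. snd p * T h p)"
proof (induction rule: mean_operator.induct)
  case (base \<Phi> \<gamma> a)
  from mean_operator.base[OF base, of "Suc a"]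
  show ?case by (simp add: mult.assoc)
next
  case (add S T)
  from mean_operator.add[OF add.IH] show ?case by (simp add: distrib_left)
qed

lemma ball_functional_0: "ball_functional (\<lambda>G. 0)"
  by (auto simp: ball_functional_def)

lemma mean_operator_0: "mean_operator m (\<lambda>h p. 0)"
  using mean_operator.base[OF ball_functional_0, of "[]" m 0] by simp

lemma mean_operator_sum:
  "finite A \<Longrightarrow> (\<And>i. i \<in> A \<Longrightarrow> mean_operator m (T i)) \<Longrightarrow> mean_operator m (\<lambda>h p. \<Sum>i\<in>A. T i h p)"
  by (induction A rule: finite_induct) (auto intro!: mean_operator_0 mean_operator.add)

lemma mean_operator_pd: "mean_operator m T \<Longrightarrow> b \<in> Basis \<Longrightarrow> mean_operator (Suc m) (\<lambda>h. T (pd b h))"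
proof (induction rule: mean_operator.induct)
  case (base \<Phi> \<gamma> a)
  from mean_operator.base[OF base(1), of "\<gamma> @ [b]" "Suc m" a] base
  show ?case by (simp add: iter_pd_append)
next
  case (add S T)
  then show ?case by (intro mean_operator.add) auto
qed

lemma mean_operator_continuous_param:
  fixes h :: "'c::topological_space \<Rightarrow> 'a::euclidean_space \<Rightarrow> real"
  assumes "mean_operator m T"
    and h: "\<And>\<gamma>. set \<gamma> \<subseteq> Basis \<Longrightarrow> length \<gamma> \<le> m \<Longrightarrow> continuous_on (A \<times> UNIV) (\<lambda>(l, z). iter_pd \<gamma> (h l) z)"
  shows "continuous_on (A \<times> UNIV) (\<lambda>(l, p). T (h l) p)"
  using assms(1)
proof (induction rule: mean_operator.induct)
  case (base \<Phi> \<gamma> a)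
  note c = h[OF base(2,3), unfolded split_beta]
  have "continuous_on (A \<times> UNIV) (\<lambda>q. \<Phi> (\<lambda>y. iter_pd \<gamma> (h (fst q)) (fst (snd q) + snd (snd q) *\<^sub>R y)))"
  proof (rule ball_functional_continuous_param[OF base(1)])
    show "continuous_on ((A \<times> UNIV) \<times> UNIV) (\<lambda>(q, y). iter_pd \<gamma> (h (fst q)) (fst (snd q) + snd (snd q) *\<^sub>R y))"
      unfolding split_beta
    proof -
      define \<theta> where "\<theta> = (\<lambda>w :: ('c \<times> 'a \<times> real) \<times> 'a. (fst (fst w), fst (snd (fst w)) + snd (snd (fst w)) *\<^sub>R snd w))"
      have "continuous_on ((A \<times> UNIV) \<times> UNIV) \<theta>" unfolding \<theta>_def by (intro continuous_intros)
      moreover have "\<theta> ` ((A \<times> UNIV) \<times> UNIV) \<subseteq> A \<times> UNIV" by (auto simp: \<theta>_def)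
      ultimately have "continuous_on ((A \<times> UNIV) \<times> UNIV) (\<lambda>w. iter_pd \<gamma> (h (fst (\<theta> w))) (snd (\<theta> w)))"
        by (rule continuous_on_compose2[OF c])
      then show "continuous_on ((A \<times> UNIV) \<times> UNIV)
         (\<lambda>p. iter_pd \<gamma> (h (fst (fst p))) (fst (snd (fst p)) + snd (snd (fst p)) *\<^sub>R snd p))"
        by (simp add: \<theta>_def)
    qed
  qed
  then show ?case unfolding split_beta by (intro continuous_intros)
next
  case (add S T)
  then show ?case unfolding split_beta by (intro continuous_intros)
qed

lemma mean_operator_continuous:
  assumes "mean_operator m T" "Ck_on m UNIV h"
  shows "continuous_on UNIV (T h)"
proof -
  have "continuous_on (UNIV \<times> UNIV) (\<lambda>(l :: real, p). T h p)"
  proof (rule mean_operator_continuous_param[OF assms(1)])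
    fix \<gamma> :: "'a list" assume \<gamma>: "set \<gamma> \<subseteq> Basis" "length \<gamma> \<le> m"
    have "continuous_on UNIV (iter_pd \<gamma> h)" using assms(2) \<gamma> by (auto simp: Ck_on_def)
    then show "continuous_on (UNIV \<times> UNIV) (\<lambda>(l :: real, z). iter_pd \<gamma> h z)"
      unfolding split_beta by (rule continuous_on_compose2) (auto intro!: continuous_intros)
  qed
  then have "continuous_on UNIV (\<lambda>p. case (0 :: real, p) of (l, p) \<Rightarrow> T h p)"
    by (rule continuous_on_compose2) (auto intro!: continuous_intros)
  then show ?thesis by simp
qed

text \<open>The points x + r y with |x|, |r| \<le> \<rho> and |y| \<le> 1 lie in the ball of radius
  2 \<rho>, so only h there matters. The constant is independent of h, which lets a bound by
  l^(\<delta>-1) on the sources pass to everything built from them.\<close>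

lemma mean_operator_bound:
  assumes "mean_operator m T"
  shows "\<exists>C\<ge>0. \<forall>h B x r. Ck_on m UNIV h \<longrightarrow> norm x \<le> \<rho> \<longrightarrow> \<bar>r\<bar> \<le> \<rho> \<longrightarrow>
     (\<forall>\<gamma> z. set \<gamma> \<subseteq> Basis \<longrightarrow> length \<gamma> \<le> m \<longrightarrow> norm z \<le> 2 * \<rho> \<longrightarrow> \<bar>iter_pd \<gamma> h z\<bar> \<le> B) \<longrightarrow>
     \<bar>T h (x, r)\<bar> \<le> C * B"
  using assms
proof (induction rule: mean_operator.induct)
  case (base \<Phi> \<gamma> a)
  obtain C where C: "C \<ge> 0"
    "\<And>G B. continuous_on UNIV G \<Longrightarrow> (\<And>y. y \<in> cball 0 1 \<Longrightarrow> \<bar>G y\<bar> \<le> B) \<Longrightarrow> \<bar>\<Phi> G\<bar> \<le> C * B"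
    using ball_functional_bound[OF base(1)] by blast
  show ?case
  proof (intro exI[of _ "\<bar>\<rho>\<bar> ^ a * C"] conjI allI impI)
    show "0 \<le> \<bar>\<rho>\<bar> ^ a * C" using C by simp
    fix h :: "'a \<Rightarrow> real" and B r :: real and x :: 'a
    assume h: "Ck_on m UNIV h" and x: "norm x \<le> \<rho>" and r: "\<bar>r\<bar> \<le> \<rho>"
      and B: "\<forall>\<gamma> z. set \<gamma> \<subseteq> Basis \<longrightarrow> length \<gamma> \<le> m \<longrightarrow> norm z \<le> 2 * \<rho> \<longrightarrow> \<bar>iter_pd \<gamma> h z\<bar> \<le> B"
    have ch: "continuous_on UNIV (iter_pd \<gamma> h)" using h base by (auto simp: Ck_on_def)
    have n: "norm (x + r *\<^sub>R y) \<le> 2 * \<rho>" if "norm y \<le> 1" for y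
    proof -
      have "norm (r *\<^sub>R y) \<le> \<rho> * 1" using that r by (simp only: norm_scaleR, intro mult_mono) auto
      then show ?thesis using norm_triangle_ineq[of x "r *\<^sub>R y"] x by simp
    qed
    have "\<bar>\<Phi> (\<lambda>y. iter_pd \<gamma> h (x + r *\<^sub>R y))\<bar> \<le> C * B"
    proof (rule C(2))
      show "continuous_on UNIV (\<lambda>y. iter_pd \<gamma> h (x + r *\<^sub>R y))"
        by (rule continuous_on_compose2[OF ch]) (auto intro!: continuous_intros)
      show "\<bar>iter_pd \<gamma> h (x + r *\<^sub>R y)\<bar> \<le> B" if "y \<in> cball 0 1" for y
        using B base n[of y] that by simp
    qed
    moreover have "\<bar>r\<bar> ^ a \<le> \<bar>\<rho>\<bar> ^ a" using r by (intro power_mono) auto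
    ultimately show "\<bar>snd (x, r) ^ a * \<Phi> (\<lambda>y. iter_pd \<gamma> h (fst (x, r) + snd (x, r) *\<^sub>R y))\<bar> \<le> \<bar>\<rho>\<bar> ^ a * C * B"
      using mult_mono[of "\<bar>r\<bar> ^ a" "\<bar>\<rho>\<bar> ^ a" "\<bar>\<Phi> (\<lambda>y. iter_pd \<gamma> h (x + r *\<^sub>R y))\<bar>" "C * B"]
      by (simp add: abs_mult power_abs mult.assoc)
  qed
next
  case (add S T)
  obtain C where C: "C\<ge>0" "\<forall>h B x r. Ck_on m UNIV h \<longrightarrow> norm x \<le> \<rho> \<longrightarrow> \<bar>r\<bar> \<le> \<rho> \<longrightarrow>
     (\<forall>\<gamma> z. set \<gamma> \<subseteq> Basis \<longrightarrow> length \<gamma> \<le> m \<longrightarrow> norm z \<le> 2 * \<rho> \<longrightarrow> \<bar>iter_pd \<gamma> h z\<bar> \<le> B) \<longrightarrow>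
     \<bar>S h (x, r)\<bar> \<le> C * B" using add.IH(1) by blast
  obtain D where D: "D\<ge>0" "\<forall>h B x r. Ck_on m UNIV h \<longrightarrow> norm x \<le> \<rho> \<longrightarrow> \<bar>r\<bar> \<le> \<rho> \<longrightarrow>
     (\<forall>\<gamma> z. set \<gamma> \<subseteq> Basis \<longrightarrow> length \<gamma> \<le> m \<longrightarrow> norm z \<le> 2 * \<rho> \<longrightarrow> \<bar>iter_pd \<gamma> h z\<bar> \<le> B) \<longrightarrow>
     \<bar>T h (x, r)\<bar> \<le> D * B" using add.IH(2) by blast
  show ?case
  proof (intro exI[of _ "C + D"] conjI allI impI)
    show "0 \<le> C + D" using C D by simp
    fix h :: "'a \<Rightarrow> real" and B r :: real and x :: 'a
    assume h: "Ck_on m UNIV h" and x: "norm x \<le> \<rho>" and r: "\<bar>r\<bar> \<le> \<rho>"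
      and B: "\<forall>\<gamma> z. set \<gamma> \<subseteq> Basis \<longrightarrow> length \<gamma> \<le> m \<longrightarrow> norm z \<le> 2 * \<rho> \<longrightarrow> \<bar>iter_pd \<gamma> h z\<bar> \<le> B"
    show "\<bar>S h (x, r) + T h (x, r)\<bar> \<le> (C + D) * B"
      using C(2)[rule_format, OF h x r B[rule_format]] D(2)[rule_format, OF h x r B[rule_format]]
        abs_triangle_ineq[of "S h (x, r)" "T h (x, r)"] by (simp add: distrib_right)
  qed
qed

lemma mean_operator_add_arg:
  assumes "mean_operator m T" "Ck_on m UNIV h" "Ck_on m UNIV h'"
  shows "T (\<lambda>z. h z + h' z) p = T h p + T h' p"
  using assms(1)
proof (induction rule: mean_operator.induct)
  case (base \<Phi> \<gamma> a)
  have c: "continuous_on UNIV (iter_pd \<gamma> h)" "continuous_on UNIV (iter_pd \<gamma> h')"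
    using assms base by (auto simp: Ck_on_def)
  have eq: "iter_pd \<gamma> (\<lambda>z. h z + h' z) z = iter_pd \<gamma> h z + iter_pd \<gamma> h' z" for z
    using assms base by (intro iter_pd_add[of UNIV]) (auto intro: Ck_on_mono)
  have "\<Phi> (\<lambda>y. iter_pd \<gamma> h (fst p + snd p *\<^sub>R y) + iter_pd \<gamma> h' (fst p + snd p *\<^sub>R y)) =
    \<Phi> (\<lambda>y. iter_pd \<gamma> h (fst p + snd p *\<^sub>R y)) + \<Phi> (\<lambda>y. iter_pd \<gamma> h' (fst p + snd p *\<^sub>R y))"
    by (intro ball_functional_add[OF base(1)] continuous_on_compose2[OF c(1)] continuous_on_compose2[OF c(2)])
      (auto intro!: continuous_intros)
  then show ?case by (simp add: eq distrib_left)
qed simp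

lemma mean_operator_cmult_arg:
  assumes "mean_operator m T" "Ck_on m UNIV h"
  shows "T (\<lambda>z. c * h z) p = c * T h p"
  using assms(1)
proof (induction rule: mean_operator.induct)
  case (base \<Phi> \<gamma> a)
  have ct: "continuous_on UNIV (iter_pd \<gamma> h)"
    using assms base by (auto simp: Ck_on_def)
  have eq: "iter_pd \<gamma> (\<lambda>z. c * h z) z = c * iter_pd \<gamma> h z" for z
    using assms base by (intro iter_pd_cmult[of UNIV]) (auto intro: Ck_on_mono)
  have "\<Phi> (\<lambda>y. c * iter_pd \<gamma> h (fst p + snd p *\<^sub>R y)) = c * \<Phi> (\<lambda>y. iter_pd \<gamma> h (fst p + snd p *\<^sub>R y))"
    by (intro ball_functional_cmult[OF base(1)] continuous_on_compose2[OF ct]) (auto intro!: continuous_intros)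
  then show ?case by (simp add: eq mult.left_commute)
qed (simp add: distrib_left)

text \<open>x enters by translation only, so the operator commutes with x-derivatives; symmetry of
  mixed derivatives moves b past \<gamma>.\<close>

lemma mean_operator_has_pd_x:
  assumes "mean_operator m T" "b \<in> Basis" "Ck_on (Suc m) UNIV h"
  shows "has_pd (b, 0) (T h) (T (pd b h) p) p"
  using assms(1)
proof (induction rule: mean_operator.induct)
  case (base \<Phi> \<gamma> a)
  have C: "Ck_on (Suc 0) UNIV (iter_pd \<gamma> h)"
    by (rule Ck_on_iter_pd[OF Ck_on_mono[OF assms(3)]]) (use base in auto)
  have c0: "continuous_on UNIV (iter_pd \<gamma> h)" by (rule Ck_on_continuous[OF C])
  have c1: "continuous_on UNIV (pd b (iter_pd \<gamma> h))" by (rule Ck_on_continuous[OF Ck_on_pd[OF C assms(2)]])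
  have eq: "iter_pd \<gamma> (pd b h) = pd b (iter_pd \<gamma> h)"
    using assms base by (intro iter_pd_pd_commute) (auto intro: Ck_on_mono)
  have "((\<lambda>s. \<Phi> (\<lambda>y. iter_pd \<gamma> h (fst p + s *\<^sub>R b + snd p *\<^sub>R y))) has_real_derivative
     \<Phi> (\<lambda>y. pd b (iter_pd \<gamma> h) (fst p + 0 *\<^sub>R b + snd p *\<^sub>R y))) (at 0)"
  proof (rule ball_functional_deriv[OF base(1)])
    fix s y
    show "((\<lambda>s. iter_pd \<gamma> h (fst p + s *\<^sub>R b + snd p *\<^sub>R y)) has_real_derivative
        pd b (iter_pd \<gamma> h) (fst p + s *\<^sub>R b + snd p *\<^sub>R y)) (at s)"
      using Ck_on_Suc_has_pd[OF C assms(2) UNIV_I, of "fst p + snd p *\<^sub>R y + s *\<^sub>R b"]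
      unfolding has_pd_line by (simp add: add_ac)
  next
    fix s show "continuous_on UNIV (\<lambda>y. iter_pd \<gamma> h (fst p + s *\<^sub>R b + snd p *\<^sub>R y))"
      by (rule continuous_on_compose2[OF c0]) (auto intro!: continuous_intros)
  next
    show "continuous_on UNIV (\<lambda>(s, y). pd b (iter_pd \<gamma> h) (fst p + s *\<^sub>R b + snd p *\<^sub>R y))"
      unfolding split_beta by (rule continuous_on_compose2[OF c1]) (auto intro!: continuous_intros)
  qed
  then show ?case unfolding has_pd_def eq by (auto intro!: DERIV_cmult)
next
  case (add S T)
  then show ?case by (intro has_pd_add)
qed

text \<open>The product rule splits off the derivative of the power of r. The chain rule along r
  \<mapsto> x + r y gives the sum of the (y \<bullet> b) \<open>pd b\<close>, and the factors y
  \<bullet> b go into the functional. One more derivative of h is taken, hence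
  \<open>Suc m\<close>.\<close>

lemma mean_operator_has_pd_r:
  assumes "mean_operator m T"
  shows "\<exists>T'. mean_operator (Suc m) T' \<and> (\<forall>h p. Ck_on (Suc m) UNIV h \<longrightarrow> has_pd (0, 1) (T h) (T' h p) p)"
  using assms
proof (induction rule: mean_operator.induct)
  case (base \<Phi> \<gamma> a)
  \<comment> \<open>For a = 0 the truncated exponent \<open>a - 1\<close> does no harm, because the
    factor \<open>real a\<close> vanishes.\<close>
  define T' where "T' = (\<lambda>h p. real a * (snd p ^ (a - 1) * \<Phi> (\<lambda>y. iter_pd \<gamma> h (fst p + snd p *\<^sub>R y))) +
     (\<Sum>b\<in>Basis. snd p ^ a * \<Phi> (\<lambda>y. (y \<bullet> b) * iter_pd (b # \<gamma>) h (fst p + snd p *\<^sub>R y))))"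
  have cb: "continuous_on UNIV (\<lambda>y. y \<bullet> b)" for b :: 'a by (intro continuous_intros)
  have "mean_operator (Suc m) T'"
    unfolding T'_def
    by (intro mean_operator.add mean_operator_cmult mean_operator_sum mean_operator.base ball_functional_weight base(1) cb) (use base in auto)
  moreover have "has_pd (0, 1) (\<lambda>p. snd p ^ a * \<Phi> (\<lambda>y. iter_pd \<gamma> h (fst p + snd p *\<^sub>R y))) (T' h p) p"
    if h: "Ck_on (Suc m) UNIV h" for h p
  proof -
    have C: "Ck_on (Suc 0) UNIV (iter_pd \<gamma> h)"
      by (rule Ck_on_iter_pd[OF Ck_on_mono[OF h]]) (use base in auto)
    have c0: "continuous_on UNIV (iter_pd \<gamma> h)" by (rule Ck_on_continuous[OF C])
    have c1: "continuous_on UNIV (pd b (iter_pd \<gamma> h))" if "b \<in> Basis" for b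
      by (rule Ck_on_continuous[OF Ck_on_pd[OF C that]])
    have D: "((\<lambda>s. \<Phi> (\<lambda>y. iter_pd \<gamma> h (fst p + (snd p + s) *\<^sub>R y))) has_real_derivative
       \<Phi> (\<lambda>y. \<Sum>b\<in>Basis. (y \<bullet> b) * pd b (iter_pd \<gamma> h) (fst p + (snd p + 0) *\<^sub>R y))) (at 0)"
    proof (rule ball_functional_deriv[OF base(1)])
      fix s y
      show "((\<lambda>s. iter_pd \<gamma> h (fst p + (snd p + s) *\<^sub>R y)) has_real_derivative
          (\<Sum>b\<in>Basis. (y \<bullet> b) * pd b (iter_pd \<gamma> h) (fst p + (snd p + s) *\<^sub>R y))) (at s)"
        using C1_line_derivative[of "iter_pd \<gamma> h" "fst p + snd p *\<^sub>R y" y s] C by (simp add: algebra_simps)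
    next
      fix s show "continuous_on UNIV (\<lambda>y. iter_pd \<gamma> h (fst p + (snd p + s) *\<^sub>R y))"
        by (rule continuous_on_compose2[OF c0]) (auto intro!: continuous_intros)
    next
      show "continuous_on UNIV (\<lambda>(s, y). \<Sum>b\<in>Basis. (y \<bullet> b) * pd b (iter_pd \<gamma> h) (fst p + (snd p + s) *\<^sub>R y))"
        unfolding split_beta
        by (intro continuous_intros continuous_on_compose2[OF c1]) auto
    qed
    have S: "\<Phi> (\<lambda>y. \<Sum>b\<in>Basis. (y \<bullet> b) * pd b (iter_pd \<gamma> h) (fst p + snd p *\<^sub>R y)) =
       (\<Sum>b\<in>Basis. \<Phi> (\<lambda>y. (y \<bullet> b) * pd b (iter_pd \<gamma> h) (fst p + snd p *\<^sub>R y)))"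
      by (intro ball_functional_sum[OF base(1)] continuous_intros continuous_on_compose2[OF c1]) auto
    have "((\<lambda>s. (snd p + s) ^ a) has_real_derivative real a * (snd p + 0) ^ (a - 1)) (at 0)"
      by (auto intro!: derivative_eq_intros)
    from DERIV_mult[OF this D]
    show ?thesis unfolding has_pd_def T'_def
      by (simp add: S sum_distrib_left[symmetric] mult_ac)
  qed
  ultimately show ?case by blast
next
  case (add S T)
  then obtain S' T' where
    "mean_operator (Suc m) S'" "\<And>h p. Ck_on (Suc m) UNIV h \<Longrightarrow> has_pd (0, 1) (S h) (S' h p) p"
    "mean_operator (Suc m) T'" "\<And>h p. Ck_on (Suc m) UNIV h \<Longrightarrow> has_pd (0, 1) (T h) (T' h p) p" by blast
  then show ?case
    by (intro exI[of _ "\<lambda>h p. S' h p + T' h p"]) (auto intro!: mean_operator.add has_pd_add)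
qed

lemma Basis_prod_real:
  assumes "c \<in> (Basis :: ('a::euclidean_space \<times> real) set)"
  obtains b where "b \<in> Basis" "c = (b, 0)" | "c = (0, 1)"
  using assms by (auto simp: Basis_prod_def)

lemma Ck_on_pair_SucI:
  fixes S :: "('a::euclidean_space \<times> real) set"
  assumes "open S" "continuous_on S g"
    and "\<And>b x. b \<in> Basis \<Longrightarrow> x \<in> S \<Longrightarrow> has_pd (b, 0) g (g' b x) x"
    and "\<And>b. b \<in> Basis \<Longrightarrow> Ck_on k S (g' b)"
    and "\<And>x. x \<in> S \<Longrightarrow> has_pd (0, 1) g (g'' x) x"
    and "Ck_on k S g''"
  shows "Ck_on (Suc k) S g"
proof (rule Ck_on_SucI[where g'="\<lambda>c. if snd c = 0 then g' (fst c) else g''", OF assms(1,2)])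
  fix c :: "'a \<times> real" and x assume c: "c \<in> Basis" and x: "x \<in> S"
  from c show "has_pd c g ((if snd c = 0 then g' (fst c) else g'') x) x"
    by (rule Basis_prod_real) (use assms(3,5) x in auto)
next
  fix c :: "'a \<times> real" assume "c \<in> Basis"
  then show "Ck_on k S (if snd c = 0 then g' (fst c) else g'')"
    by (rule Basis_prod_real) (use assms(4,6) in auto)
qed

text \<open>Derivatives in x and in r are again mean operators with index one higher, so q
  derivatives of \<open>T h\<close> cost q derivatives of h beyond m.\<close>

lemma mean_operator_Ck:
  assumes "mean_operator m T" "Ck_on (m + q) UNIV h"
  shows "Ck_on q UNIV (T h)"
  using assms
proof (induction q arbitrary: m T)
  case 0 then show ?case by (simp add: Ck_on_0 mean_operator_continuous)
next
  case (Suc q)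
  obtain T' where T': "mean_operator (Suc m) T'" "\<And>h p. Ck_on (Suc m) UNIV h \<Longrightarrow> has_pd (0, 1) (T h) (T' h p) p"
    using mean_operator_has_pd_r[OF Suc.prems(1)] by blast
  have h: "Ck_on (Suc m + q) UNIV h" "Ck_on (Suc m) UNIV h" "Ck_on m UNIV h"
    using Suc.prems(2) by (auto elim: Ck_on_mono)
  show ?case
  proof (rule Ck_on_pair_SucI)
    show "continuous_on UNIV (T h)" using mean_operator_continuous[OF Suc.prems(1) h(3)] .
    show "has_pd (b, 0) (T h) (T (pd b h) x) x" if "b \<in> Basis" for b x
      by (rule mean_operator_has_pd_x[OF Suc.prems(1) that h(2)])
    show "Ck_on q UNIV (T (pd b h))" if "b \<in> Basis" for b
      using Suc.IH[OF mean_operator_pd[OF Suc.prems(1) that] h(1)] .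
    show "has_pd (0, 1) (T h) (T' h x) x" for x by (rule T'(2)[OF h(2)])
    show "Ck_on q UNIV (T' h)" by (rule Suc.IH[OF T'(1) h(1)])
  qed simp
qed

text \<open>The scaled form is the oriented integral of \<zeta> from 0 to R: it has the right sign
  for R < 0 and treats R = 0 like any other point.\<close>

lemma has_derivative_scaled_integral:
  fixes \<zeta> :: "real \<Rightarrow> real"
  assumes "continuous_on UNIV \<zeta>"
  shows "((\<lambda>R. R * integral {0..1} (\<lambda>\<mu>. \<zeta> (R * \<mu>))) has_real_derivative \<zeta> R) (at R)"
proof -
  \<comment> \<open>Any interval with 0 and R in its interior serves.\<close>
  define c where "c = \<bar>R\<bar> + 1"
  have "continuous_on {-c..c} \<zeta>" by (rule continuous_on_subset[OF assms]) simp
  from antiderivative_continuous[OF this]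
  obtain X where X: "\<And>x. x \<in> {-c..c} \<Longrightarrow> (X has_vector_derivative \<zeta> x) (at x within {-c..c})" by blast
  have XD: "(X has_real_derivative \<zeta> x) (at x)" if "\<bar>x\<bar> < c" for x
    using X[of x] that at_within_Icc_at[of "-c" x c]
    by (simp add: has_real_derivative_iff_has_vector_derivative abs_less_iff)
  have eq: "r * integral {0..1} (\<lambda>\<mu>. \<zeta> (r * \<mu>)) = X r - X 0" if r: "\<bar>r\<bar> < c" for r
  proof -
    have "((\<lambda>\<mu>. \<zeta> (r * \<mu>) * r) has_integral X (r * 1) - X (r * 0)) {0..1}"
    proof (rule fundamental_theorem_of_calculus)
      fix \<mu> :: real assume \<mu>: "\<mu> \<in> {0..1}"
      have "\<bar>r\<bar> * \<bar>\<mu>\<bar> \<le> \<bar>r\<bar> * 1" using \<mu> by (intro mult_left_mono) auto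
      then have "\<bar>r * \<mu>\<bar> < c" using r by (simp add: abs_mult)
      from DERIV_chain2[where f = X and g = "\<lambda>\<mu>. r * \<mu>", OF XD[OF this], of r "{0..1}"]
      show "((\<lambda>\<mu>. X (r * \<mu>)) has_vector_derivative \<zeta> (r * \<mu>) * r) (at \<mu> within {0..1})"
        by (auto simp: has_real_derivative_iff_has_vector_derivative[symmetric] intro!: derivative_eq_intros)
    qed simp
    then show ?thesis by (simp add: integral_unique mult.commute[of r] flip: integral_mult_left)
  qed
  have "((\<lambda>r. X r - X 0) has_real_derivative \<zeta> R) (at R)"
    using XD[of R] by (auto intro!: derivative_eq_intros simp: c_def)
  moreover have "\<forall>\<^sub>F r in nhds R. X r - X 0 = r * integral {0..1} (\<lambda>\<mu>. \<zeta> (r * \<mu>))"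
    unfolding eventually_nhds
    by (rule exI[of _ "{-c<..<c}"]) (auto simp: eq abs_less_iff c_def)
  ultimately show ?thesis
    using DERIV_cong_ev[OF refl, of "\<lambda>r. X r - X 0" "\<lambda>r. r * integral {0..1} (\<lambda>\<mu>. \<zeta> (r * \<mu>))" R] by simp
qed

text \<open>Integration in r costs no derivative: r = R \<mu> turns the primitive of r^(a+1) times
  the mean into R^(a+2) times an averaged functional, so the index m is unchanged.\<close>

lemma mean_operator_antiderivative:
  assumes "mean_operator m T"
  shows "\<exists>N. mean_operator m N \<and> (\<forall>h. Ck_on m UNIV h \<longrightarrow>
     (\<forall>x. N h (x, 0) = 0) \<and> (\<forall>p. has_pd (0, 1) (N h) (snd p * T h p) p))"
  using assms
proof (induction rule: mean_operator.induct)
  case (base \<Phi> \<gamma> a)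
  define \<Psi> where "\<Psi> = (\<lambda>G. integral {0..1} (\<lambda>\<mu>. \<mu> ^ Suc a * \<Phi> (\<lambda>y. G (\<mu> *\<^sub>R y))))"
  define N where "N = (\<lambda>h p. snd p ^ (a + 2) * \<Psi> (\<lambda>y. iter_pd \<gamma> h (fst p + snd p *\<^sub>R y)))"
  have "mean_operator m N" unfolding N_def \<Psi>_def
    by (intro mean_operator.base ball_functional_average base)
  moreover have "N h (x, 0) = 0" for h x by (simp add: N_def)
  moreover have "has_pd (0, 1) (N h) (snd p * (snd p ^ a * \<Phi> (\<lambda>y. iter_pd \<gamma> h (fst p + snd p *\<^sub>R y)))) p"
    if h: "Ck_on m UNIV h" for h p
  proof -
    define \<zeta> where "\<zeta> = (\<lambda>r. r ^ Suc a * \<Phi> (\<lambda>y. iter_pd \<gamma> h (fst p + r *\<^sub>R y)))"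
    have ch: "continuous_on UNIV (iter_pd \<gamma> h)" using h base by (auto simp: Ck_on_def)
    have c: "continuous_on UNIV \<zeta>" unfolding \<zeta>_def
      by (intro continuous_intros ball_functional_continuous_param[OF base(1)])
        (auto simp: split_beta intro!: continuous_intros continuous_on_compose2[OF ch])
    have "N h (fst p, R) = R * integral {0..1} (\<lambda>\<mu>. \<zeta> (R * \<mu>))" for R
      unfolding N_def \<Psi>_def \<zeta>_def
      by (simp add: power_mult_distrib mult.assoc mult.left_commute power_add flip: integral_mult_right)
    then have "((\<lambda>R. N h (fst p, R)) has_real_derivative \<zeta> (snd p)) (at (snd p))"
      using has_derivative_scaled_integral[OF c, of "snd p"] by simp
    then show ?thesis
      using DERIV_shift[of "\<lambda>R. N h (fst p, R)" "\<zeta> (snd p)" 0 "snd p"]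
      by (cases p) (simp add: has_pd_def \<zeta>_def add.commute mult.assoc)
  qed
  ultimately show ?case by blast
next
  case (add S T)
  then obtain M N where
    "mean_operator m M" "\<And>h. Ck_on m UNIV h \<Longrightarrow> (\<forall>x. M h (x, 0) = 0) \<and> (\<forall>p. has_pd (0, 1) (M h) (snd p * S h p) p)"
    "mean_operator m N" "\<And>h. Ck_on m UNIV h \<Longrightarrow> (\<forall>x. N h (x, 0) = 0) \<and> (\<forall>p. has_pd (0, 1) (N h) (snd p * T h p) p)"
    by blast
  then show ?case
    by (intro exI[of _ "\<lambda>h p. M h p + N h p"]) (auto intro!: mean_operator.add has_pd_add simp: distrib_left)
qed

lemma mean_operator_sum_arg:
  assumes "mean_operator m T" "finite A" "\<And>i. i \<in> A \<Longrightarrow> Ck_on m UNIV (h i)"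
  shows "T (\<lambda>z. \<Sum>i\<in>A. h i z) p = (\<Sum>i\<in>A. T (h i) p)"
  using assms(2,3)
proof (induction A rule: finite_induct)
  case empty
  then show ?case using mean_operator_cmult_arg[OF assms(1) Ck_on_const[OF open_UNIV], of 0] by simp
next
  case (insert i A)
  then show ?case
    using mean_operator_add_arg[OF assms(1), of "h i" "\<lambda>z. \<Sum>i\<in>A. h i z" p] by (simp add: Ck_on_sum)
qed

section \<open>Weighted ball means\<close>

text \<open>Translation invariance: the integral of F(y + s b) does not depend on s, and
  differentiating it under the integral sign at s = 0 gives the integral of F'.\<close>

lemma has_integral_pd_compact_support:
  fixes F F' :: "'a::euclidean_space \<Rightarrow> real"
  assumes b: "b \<in> Basis" and F: "\<And>y. has_pd b F (F' y) y" and cF: "continuous_on UNIV F"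
    and cF': "continuous_on UNIV F'" and supp: "\<And>y. norm y \<ge> R \<Longrightarrow> F y = 0"
  shows "(F' has_integral 0) UNIV"
proof -
  \<comment> \<open>The margin 1 beyond the radius leaves room for the shifts with |s| < 1.\<close>
  define B :: "'a set" where "B = cbox (-((\<bar>R\<bar> + 1) *\<^sub>R One)) ((\<bar>R\<bar> + 1) *\<^sub>R One)"
  have inB: "y \<in> B" if "norm y < \<bar>R\<bar> + 1" for y
  proof -
    have "- (\<bar>R\<bar> + 1) \<le> y \<bullet> i" "y \<bullet> i \<le> \<bar>R\<bar> + 1" if "i \<in> Basis" for i
      using Basis_le_norm[OF that, of y] \<open>norm y < \<bar>R\<bar> + 1\<close> by linarith+
    then show ?thesis unfolding B_def mem_box by auto
  qed
  have F0: "F (y + s *\<^sub>R b) = 0" if "y \<notin> B" "\<bar>s\<bar> < 1" for y s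
  proof -
    have "norm y \<ge> \<bar>R\<bar> + 1" using inB that(1) by force
    moreover have "norm y \<le> norm (y + s *\<^sub>R b) + norm (s *\<^sub>R b)"
      using norm_triangle_ineq4[of "y + s *\<^sub>R b" "s *\<^sub>R b"] by simp
    ultimately show ?thesis using that(2) b by (intro supp) simp
  qed
  have F'0: "F' y = 0" if "y \<notin> B" for y
  proof -
    have "has_pd b F 0 y"
    proof (rule has_pd_cong_open[where S="- B" and g="\<lambda>y. 0"])
      show "open (- B)" unfolding B_def by (rule open_Compl[OF closed_cbox])
      show "0 = F z" if "z \<in> - B" for z using F0[of z 0] that by simp
    qed (use that in \<open>auto simp: has_pd_const\<close>)
    then show ?thesis using F[of y] has_pd_imp_pd by metis
  qed
  define I where "I = integral B F"
  have FI: "(F has_integral I) B" unfolding I_def B_def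
    by (intro integrable_integral integrable_continuous continuous_on_subset[OF cF]) auto
  have shift: "((\<lambda>y. F (y + s *\<^sub>R b)) has_integral I) B" if s: "\<bar>s\<bar> < 1" for s
  proof -
    \<comment> \<open>An affinity with factor 1, that is, a translation.\<close>
    have "((\<lambda>y. F (1 *\<^sub>R y + s *\<^sub>R b)) has_integral ((1 / \<bar>1\<bar> ^ DIM('a)) *\<^sub>R I)) ((\<lambda>y. (1 / 1) *\<^sub>R y + -((1 / 1) *\<^sub>R (s *\<^sub>R b))) ` B)"
      using FI unfolding B_def by (intro has_integral_affinity) auto
    then have "((\<lambda>y. F (y + s *\<^sub>R b)) has_integral I) ((\<lambda>y. y - s *\<^sub>R b) ` B)" by simp
    then have "((\<lambda>y. F (y + s *\<^sub>R b)) has_integral I) UNIV"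
    proof (rule has_integral_on_superset)
      fix y assume "y \<notin> (\<lambda>y. y - s *\<^sub>R b) ` B"
      then have "y + s *\<^sub>R b \<notin> B" by (metis add_diff_cancel_right' image_eqI)
      then show "F (y + s *\<^sub>R b) = 0" using F0[of "y + s *\<^sub>R b" 0] by simp
    qed simp
    moreover have "(\<lambda>y. F (y + s *\<^sub>R b)) = (\<lambda>y. if y \<in> B then F (y + s *\<^sub>R b) else 0)"
      using F0 s by auto
    ultimately show ?thesis by (metis has_integral_restrict_UNIV)
  qed
  have "((\<lambda>s. integral B (\<lambda>y. F (y + s *\<^sub>R b))) has_real_derivative integral B (\<lambda>y. F' (y + 0 *\<^sub>R b))) (at 0 within {-1<..<1})"
    unfolding B_def
  proof (rule leibniz_rule_field_derivative, fold B_def)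
    fix s :: real and y assume "s \<in> {-1<..<1}" "y \<in> B"
    show "((\<lambda>s. F (y + s *\<^sub>R b)) has_real_derivative F' (y + s *\<^sub>R b)) (at s within {-1<..<1})"
      using F[of "y + s *\<^sub>R b"] unfolding has_pd_line by (rule has_field_derivative_at_within)
  next
    fix s :: real assume "s \<in> {-1<..<1}"
    then show "(\<lambda>y. F (y + s *\<^sub>R b)) integrable_on B" using shift[of s] by (auto simp: integrable_on_def abs_less_iff)
  next
    show "continuous_on ({-1<..<1} \<times> B) (\<lambda>(s, y). F' (y + s *\<^sub>R b))"
      unfolding split_beta by (rule continuous_on_compose2[OF cF']) (auto intro!: continuous_intros)
  qed auto
  then have D: "((\<lambda>s. integral B (\<lambda>y. F (y + s *\<^sub>R b))) has_real_derivative integral B F') (at 0)"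
    by (simp add: at_within_open[of 0 "{-1<..<1::real}"])
  have "((\<lambda>s. I) has_real_derivative integral B F') (at 0)"
  proof (rule iffD1[OF DERIV_cong_ev[OF refl _ refl] D])
    show "\<forall>\<^sub>F s in nhds 0. integral B (\<lambda>y. F (y + s *\<^sub>R b)) = I"
      unfolding eventually_nhds by (rule exI[of _ "{-1<..<1}"]) (auto intro!: integral_unique shift)
  qed
  then have "integral B F' = 0" using DERIV_const DERIV_unique by blast
  moreover have "(F' has_integral integral B F') B" unfolding B_def
    by (intro integrable_integral integrable_continuous continuous_on_subset[OF cF']) auto
  ultimately show ?thesis using has_integral_on_superset[of F' 0 B UNIV] F'0 by auto
qed

text \<open>The square makes the positive part continuously differentiable. Both cut-off weights,
  the one on the unit ball and the one on the light cone, are differentiated through this.\<close>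

lemma DERIV_max_0_power2: "((\<lambda>x::real. (max 0 x)\<^sup>2) has_real_derivative 2 * max 0 x) (at x)"
proof -
  consider "x > 0" | "x < 0" | "x = 0" by linarith
  then show ?thesis
  proof cases
    case 1
    have "((\<lambda>x::real. x\<^sup>2) has_real_derivative 2 * max 0 x) (at x)"
      using 1 by (auto intro!: derivative_eq_intros)
    moreover have "\<forall>\<^sub>F y in nhds x. y\<^sup>2 = (max 0 y)\<^sup>2"
      unfolding eventually_nhds using 1 by (intro exI[of _ "{0<..}"]) auto
    ultimately show ?thesis using DERIV_cong_ev[OF refl, of "\<lambda>x. x\<^sup>2" "\<lambda>x. (max 0 x)\<^sup>2" x] by simp
  next
    case 2
    have "((\<lambda>x::real. 0) has_real_derivative 2 * max 0 x) (at x)" using 2 by simp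
    moreover have "\<forall>\<^sub>F y in nhds x. 0 = (max 0 y)\<^sup>2"
      unfolding eventually_nhds using 2 by (intro exI[of _ "{..<0}"]) auto
    ultimately show ?thesis using DERIV_cong_ev[OF refl, of "\<lambda>x. 0" "\<lambda>x. (max 0 x)\<^sup>2" x] by simp
  next
    case 3
    have "((\<lambda>h::real. max 0 h) \<longlongrightarrow> max 0 0) (at 0)" by (intro tendsto_intros)
    moreover have "\<forall>\<^sub>F h in at 0. max 0 h = ((max 0 (0 + h))\<^sup>2 - (max 0 0)\<^sup>2) / (h::real)"
      unfolding eventually_at_filter by (auto simp: max_def power2_eq_square)
    ultimately show ?thesis unfolding 3 DERIV_def by (simp add: tendsto_cong)
  qed
qed

text \<open>
  The integrand is the divergence of \<open>\<omega>(y) ((y \<cdot> \<nabla>H) y - \<nabla>H)\<close>, where \<open>\<omega>\<close> regularizes the weight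
  \<open>(1 - |y|\<^sup>2)\<^bsup>2\<beta>+2\<^esup>\<close> at the boundary of the ball.
\<close>

lemma ball_weight_divergence:
  fixes H :: "'a::euclidean_space \<Rightarrow> real" and \<epsilon> \<beta> :: real
  assumes H: "Ck_on 2 UNIV H" and \<epsilon>: "\<epsilon> > 0"
  defines "P \<equiv> \<lambda>y::'a. (max 0 (1 - y \<bullet> y))\<^sup>2"
    and "D \<equiv> \<lambda>y. \<Sum>c\<in>Basis. (y \<bullet> c) * pd c H y"
    and "Q \<equiv> \<lambda>y. \<Sum>b\<in>Basis. \<Sum>c\<in>Basis. (y \<bullet> b) * (y \<bullet> c) * pd b (pd c H) y"
    and "L \<equiv> \<lambda>y. \<Sum>b\<in>Basis. pd b (pd b H) y"
  shows "((\<lambda>y. 4 * (P y * (P y + \<epsilon>) powr \<beta> + \<beta> * (P y)\<^sup>2 * (P y + \<epsilon>) powr (\<beta> - 1)) * D y +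
     P y * (P y + \<epsilon>) powr \<beta> * ((real DIM('a) + 1) * D y + Q y - L y)) has_integral 0) UNIV"
proof -
  have C2: "Ck_on (Suc (Suc 0)) UNIV H" using H by (simp add: numeral_2_eq_2)
  have C1: "Ck_on (Suc 0) UNIV H" using Ck_on_SucD[OF C2] .
  have pH2: "has_pd b (pd c H) (pd b (pd c H) y) y" if "b \<in> Basis" "c \<in> Basis" for b c y
    by (rule Ck_on_Suc_has_pd[OF Ck_on_pd[OF C2 that(2)] that(1) UNIV_I])
  have cH: "continuous_on UNIV (pd b H)" if "b \<in> Basis" for b
    by (rule Ck_on_continuous[OF Ck_on_pd[OF C1 that]])
  have cH2: "continuous_on UNIV (pd b (pd c H))" if "b \<in> Basis" "c \<in> Basis" for b c
    by (rule Ck_on_continuous[OF Ck_on_pd[OF Ck_on_pd[OF C2 that(2)] that(1)]])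
  define m where "m = (\<lambda>y::'a. max 0 (1 - y \<bullet> y))"
  have P: "P = (\<lambda>y. (m y)\<^sup>2)" by (simp add: P_def m_def)
  have Ppos: "P y + \<epsilon> > 0" for y using \<epsilon> zero_le_power2[of "m y"] by (simp add: P add_nonneg_pos)
  define \<omega> where "\<omega> = (\<lambda>y. P y * (P y + \<epsilon>) powr \<beta>)"
  \<comment> \<open>\<open>X\<close> is the radial factor of the gradient: the derivative of
    \<omega> along b is X (y \<bullet> b). Its factor \<open>m\<close> stems from differentiating P
    = m^2.\<close>
  define X where "X = (\<lambda>y. - 4 * m y * ((P y + \<epsilon>) powr \<beta> + \<beta> * P y * (P y + \<epsilon>) powr (\<beta> - 1)))"
  have cm: "continuous_on UNIV m" unfolding m_def by (intro continuous_intros)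
  have cP: "continuous_on UNIV P" unfolding P by (intro continuous_intros cm)
  have c\<omega>: "continuous_on UNIV \<omega>" unfolding \<omega>_def
    by (intro continuous_intros cP) (use Ppos in \<open>auto simp: less_imp_neq[symmetric]\<close>)
  have cX: "continuous_on UNIV X" unfolding X_def
    by (intro continuous_intros cP cm) (use Ppos in \<open>auto simp: less_imp_neq[symmetric]\<close>)
  have cD: "continuous_on UNIV D" unfolding D_def by (intro continuous_intros cH)
  have pP: "has_pd b P (2 * m y * (- 2 * (y \<bullet> b))) y" if "b \<in> Basis" for b y
  proof -
    have "has_pd b (\<lambda>y. 1 - y \<bullet> y) (- 2 * (y \<bullet> b)) y"
      unfolding has_pd_def inner_add_left inner_add_right inner_scaleR_left inner_scaleR_right
      by (auto intro!: derivative_eq_intros simp: inner_commute)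
    from has_pd_chain[OF this DERIV_max_0_power2] show ?thesis by (simp add: P m_def)
  qed
  have p\<omega>: "has_pd b \<omega> (X y * (y \<bullet> b)) y" if "b \<in> Basis" for b y
  proof -
    have "((\<lambda>p. p * (p + \<epsilon>) powr \<beta>) has_real_derivative
        ((P y + \<epsilon>) powr \<beta> + P y * (\<beta> * (P y + \<epsilon>) powr (\<beta> - 1)))) (at (P y))"
      using Ppos[of y] by (auto intro!: derivative_eq_intros)
    from has_pd_chain[OF pP[OF that] this] show ?thesis
      unfolding \<omega>_def X_def by (simp add: algebra_simps)
  qed
  define F where "F = (\<lambda>b y. \<omega> y * ((y \<bullet> b) * D y - pd b H y))"
  define F' where "F' = (\<lambda>b y. \<omega> y * ((y \<bullet> b) * (pd b H y + (\<Sum>c\<in>Basis. (y \<bullet> c) * pd b (pd c H) y)) + D y - pd b (pd b H) y)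
     + X y * (y \<bullet> b) * ((y \<bullet> b) * D y - pd b H y))"
  have "(F' b has_integral 0) UNIV" if b: "b \<in> Basis" for b
  proof (rule has_integral_pd_compact_support[OF b, of "F b" _ 1])
    fix y
    have "has_pd b D (\<Sum>c\<in>Basis. (y \<bullet> c) * pd b (pd c H) y + (b \<bullet> c) * pd c H y) y"
      unfolding D_def by (intro has_pd_sum has_pd_mult has_pd_inner pH2 b) auto
    moreover have "(\<Sum>c\<in>Basis. (y \<bullet> c) * pd b (pd c H) y + (b \<bullet> c) * pd c H y) =
       pd b H y + (\<Sum>c\<in>Basis. (y \<bullet> c) * pd b (pd c H) y)"
    proof -
      have "(\<Sum>c\<in>Basis. (b \<bullet> c) * pd c H y) = (\<Sum>c\<in>Basis. if c = b then pd b H y else 0)"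
        by (rule sum.cong) (use b in \<open>auto simp: inner_Basis\<close>)
      then show ?thesis using b by (simp add: sum.distrib)
    qed
    ultimately have "has_pd b D (pd b H y + (\<Sum>c\<in>Basis. (y \<bullet> c) * pd b (pd c H) y)) y" by simp
    then have "has_pd b (\<lambda>y. \<omega> y * ((y \<bullet> b) * D y - pd b H y))
      (\<omega> y * (((y \<bullet> b) * (pd b H y + (\<Sum>c\<in>Basis. (y \<bullet> c) * pd b (pd c H) y)) + (b \<bullet> b) * D y) - pd b (pd b H) y)
       + (X y * (y \<bullet> b)) * ((y \<bullet> b) * D y - pd b H y)) y"
      by (intro has_pd_mult has_pd_diff p\<omega> pH2 b has_pd_inner)
    then show "has_pd b (F b) (F' b y) y" using b by (simp add: F_def F'_def)
  next
    show "continuous_on UNIV (F b)" unfolding F_def by (intro continuous_intros c\<omega> cD cH b)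
    show "continuous_on UNIV (F' b)" unfolding F'_def by (intro continuous_intros c\<omega> cX cD cH cH2 b)
    fix y :: 'a assume "1 \<le> norm y"
    then have "y \<bullet> y \<ge> 1" by (simp add: dot_square_norm)
    then show "F b y = 0" by (simp add: F_def \<omega>_def P m_def)
  qed
  then have "((\<lambda>y. \<Sum>b\<in>Basis. F' b y) has_integral (\<Sum>b\<in>(Basis::'a set). 0)) UNIV"
    by (intro has_integral_sum) auto
  moreover have "(\<Sum>b\<in>Basis. F' b y) = 4 * (P y * (P y + \<epsilon>) powr \<beta> + \<beta> * (P y)\<^sup>2 * (P y + \<epsilon>) powr (\<beta> - 1)) * D y +
     P y * (P y + \<epsilon>) powr \<beta> * ((real DIM('a) + 1) * D y + Q y - L y)" for y
  proof -
    have yy: "(\<Sum>b\<in>Basis. (y \<bullet> b) * (y \<bullet> b)) = y \<bullet> y" by (simp add: euclidean_inner[of y y])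
    have "(\<Sum>b\<in>Basis. F' b y) = \<omega> y * (D y + Q y + real DIM('a) * D y - L y) + X y * ((y \<bullet> y) * D y - D y)"
    proof -
      have "F' b y = \<omega> y * ((y \<bullet> b) * pd b H y + (\<Sum>c\<in>Basis. (y \<bullet> b) * (y \<bullet> c) * pd b (pd c H) y) + D y - pd b (pd b H) y)
        + X y * ((y \<bullet> b) * (y \<bullet> b) * D y - (y \<bullet> b) * pd b H y)" for b
        unfolding F'_def by (simp add: algebra_simps sum_distrib_left)
      then show ?thesis
        by (simp add: sum.distrib sum_subtractf sum_distrib_left[symmetric] sum_distrib_right[symmetric] yy)
          (simp add: D_def Q_def L_def)
    qed
    moreover have "X y * ((y \<bullet> y) * D y - D y) = 4 * (\<omega> y + \<beta> * (P y)\<^sup>2 * (P y + \<epsilon>) powr (\<beta> - 1)) * D y"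
    proof -
      \<comment> \<open>Inside the ball |y|^2 - 1 is -m, outside m is 0; so the factor m of
        \<open>X\<close> is completed to \<open>P\<close>.\<close>
      have "m y * (y \<bullet> y - 1) = - P y" by (simp add: P m_def max_def power2_eq_square algebra_simps)
      moreover define K where "K = (P y + \<epsilon>) powr \<beta> + \<beta> * P y * (P y + \<epsilon>) powr (\<beta> - 1)"
      have "X y = - 4 * m y * K" by (simp only: X_def K_def)
      then have "X y * ((y \<bullet> y) * D y - D y) = - 4 * K * D y * (m y * (y \<bullet> y - 1))"
        by (simp add: algebra_simps)
      ultimately have "X y * ((y \<bullet> y) * D y - D y) = 4 * (P y * K) * D y" by simp
      moreover have "P y * K = \<omega> y + \<beta> * (P y)\<^sup>2 * (P y + \<epsilon>) powr (\<beta> - 1)"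
        by (simp add: K_def \<omega>_def power2_eq_square algebra_simps)
      ultimately show ?thesis by simp
    qed
    ultimately show ?thesis by (simp add: \<omega>_def algebra_simps)
  qed
  ultimately show ?thesis by simp
qed

text \<open>In the limit the divergence identity has the weight P^\<kappa> and the coefficient 4
  \<kappa> + n + 1 in front of (y \<bullet> \<nabla>)H; \<kappa> is chosen to make this the even
  number 2k + 2, whatever the parity of n. As \<kappa> < 1, the weight is too rough at the sphere
  for a direct integration by parts, so the regularization is removed by dominated
  convergence.\<close>

lemma ex_EPD_mean:
  fixes k :: nat
  defines "k \<equiv> DIM('a::euclidean_space) div 2"
  shows "\<exists>\<Phi> :: ('a \<Rightarrow> real) \<Rightarrow> real. ball_functional \<Phi> \<and> \<Phi> (\<lambda>y. 1) = 1 \<and>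
    (\<forall>H. Ck_on 2 UNIV H \<longrightarrow> \<Phi> (\<lambda>y. real (2 * k + 2) * (\<Sum>c\<in>Basis. (y \<bullet> c) * pd c H y)
       + (\<Sum>b\<in>Basis. \<Sum>c\<in>Basis. (y \<bullet> b) * (y \<bullet> c) * pd b (pd c H) y)
       - (\<Sum>b\<in>Basis. pd b (pd b H) y)) = 0)"
proof -
  \<comment> \<open>This is 0 in odd and 1/4 in even dimensions. For \<kappa> = 0 the weight
    \<open>P y powr \<kappa>\<close> is the indicator function of the open ball, because
    \<open>0 powr 0\<close> is 0.\<close>
  define \<kappa> where "\<kappa> = (real k + 1/2 - DIM('a) / 2) / 2"
  define \<beta> where "\<beta> = \<kappa> - 1"
  have \<kappa>: "0 \<le> \<kappa>" "\<kappa> \<le> 1" and p: "4 * \<kappa> + DIM('a) + 1 = 2 * k + 2"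
    unfolding \<kappa>_def k_def by (cases "even DIM('a)"; auto elim!: evenE oddE)+
  define B :: "'a set" where "B = cbox (- One) One"
  define P where "P = (\<lambda>y::'a. (max 0 (1 - y \<bullet> y))\<^sup>2)"
  have P01: "0 \<le> P y" "P y \<le> 1" for y by (auto simp: P_def intro: power_le_one)
  have cP: "continuous_on UNIV P" unfolding P_def by (intro continuous_intros)
  have inB: "y \<in> B" if "norm y \<le> 1" for y
  proof -
    have "\<bar>y \<bullet> i\<bar> \<le> 1" if "i \<in> Basis" for i
      using Basis_le_norm[OF that, of y] \<open>norm y \<le> 1\<close> by simp
    then show ?thesis unfolding B_def mem_box by (auto simp: abs_le_iff)
  qed
  have P0: "P y = 0" if "norm y \<ge> 1" for y
  proof -
    have "y \<bullet> y \<ge> 1" using that by (simp add: dot_square_norm)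
    then show ?thesis by (simp add: P_def)
  qed
  define \<epsilon> where "\<epsilon> = (\<lambda>j::nat. 1 / (real j + 1))"
  have \<epsilon>: "0 < \<epsilon> j" "\<epsilon> j \<le> 1" for j by (auto simp: \<epsilon>_def)
  have \<epsilon>0: "\<epsilon> \<longlonglongrightarrow> 0" unfolding \<epsilon>_def using LIMSEQ_inverse_real_of_nat by (simp add: inverse_eq_divide add.commute)
  define E where "E = (\<lambda>j y. P y * (P y + \<epsilon> j) powr \<beta>)"
  define E' where "E' = (\<lambda>j y. \<beta> * (P y)\<^sup>2 * (P y + \<epsilon> j) powr (\<beta> - 1))"
  have Ppos: "P y + \<epsilon> j > 0" for y j using \<epsilon>[of j] P01[of y] by linarith
  have cE: "continuous_on UNIV (E j)" "continuous_on UNIV (E' j)" for j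
    unfolding E_def E'_def by (intro continuous_intros cP; use Ppos in \<open>auto simp: less_imp_neq[symmetric]\<close>)+
  have pw: "(P y + \<epsilon> j) powr \<kappa> \<le> 2" for y j
  proof -
    have "(P y + \<epsilon> j) powr \<kappa> \<le> 2 powr \<kappa>" using P01[of y] \<epsilon>[of j] \<kappa> by (intro powr_mono2) auto
    also have "\<dots> \<le> 2 powr 1" using \<kappa> by (intro powr_mono) auto
    finally show ?thesis by simp
  qed
  have Eb: "\<bar>E j y\<bar> \<le> 2" for j y
  proof -
    have "E j y \<le> (P y + \<epsilon> j) * (P y + \<epsilon> j) powr \<beta>" unfolding E_def using \<epsilon>[of j] by (intro mult_right_mono) auto
    also have "\<dots> = (P y + \<epsilon> j) powr \<kappa>" using Ppos[of y j] powr_mult_base[of "P y + \<epsilon> j" \<beta>] by (simp add: \<beta>_def)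
    finally show ?thesis using pw[of y j] P01[of y] by (simp add: E_def)
  qed
  have E'b: "\<bar>E' j y\<bar> \<le> 2 * \<bar>\<beta>\<bar>" for j y
  proof -
    have "(P y)\<^sup>2 * (P y + \<epsilon> j) powr (\<beta> - 1) \<le> (P y + \<epsilon> j)\<^sup>2 * (P y + \<epsilon> j) powr (\<beta> - 1)"
      using \<epsilon>[of j] P01[of y] by (intro mult_right_mono power_mono) auto
    also have "\<dots> = (P y + \<epsilon> j) powr (2 + (\<beta> - 1))" using Ppos[of y j] by (subst powr_add) simp
    also have "\<dots> \<le> 2" using pw[of y j] by (simp add: \<beta>_def algebra_simps)
    finally have "(P y)\<^sup>2 * (P y + \<epsilon> j) powr (\<beta> - 1) \<le> 2" .
    then have "\<bar>\<beta>\<bar> * ((P y)\<^sup>2 * (P y + \<epsilon> j) powr (\<beta> - 1)) \<le> \<bar>\<beta>\<bar> * 2" by (intro mult_left_mono) auto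
    then show ?thesis unfolding E'_def by (simp add: abs_mult mult.assoc)
  qed
  \<comment> \<open>\<open>E\<close> and \<open>E'\<close> are the two weights of the divergence
    identity. Where P y = 0, both sequences and both limits are 0; elsewhere the powers are
    continuous at \<epsilon> = 0.\<close>
  have Elim: "(\<lambda>j. E j y) \<longlonglongrightarrow> P y powr \<kappa>" and E'lim: "(\<lambda>j. E' j y) \<longlonglongrightarrow> \<beta> * P y powr \<kappa>" for y
  proof -
    have "(\<lambda>j. E j y) \<longlonglongrightarrow> P y powr \<kappa> \<and> (\<lambda>j. E' j y) \<longlonglongrightarrow> \<beta> * P y powr \<kappa>"
    proof (cases "P y = 0")
      case True then show ?thesis by (simp add: E_def E'_def)
    next
      case False
      then have pp: "P y > 0" using P01[of y] by simp
      have l: "(\<lambda>j. (P y + \<epsilon> j) powr c) \<longlonglongrightarrow> (P y + 0) powr c" for c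
        using pp by (intro tendsto_intros \<epsilon>0) auto
      have 1: "(\<lambda>j. P y * (P y + \<epsilon> j) powr \<beta>) \<longlonglongrightarrow> P y * (P y + 0) powr \<beta>" by (intro tendsto_intros l)
      have 2: "(\<lambda>j. \<beta> * (P y)\<^sup>2 * (P y + \<epsilon> j) powr (\<beta> - 1)) \<longlonglongrightarrow> \<beta> * (P y)\<^sup>2 * (P y + 0) powr (\<beta> - 1)" by (intro tendsto_intros l)
      have 3: "P y * P y powr \<beta> = P y powr \<kappa>" using pp powr_mult_base[of "P y" \<beta>] by (simp add: \<beta>_def)
      have "(P y)\<^sup>2 * P y powr (\<beta> - 1) = P y powr (2 + (\<beta> - 1))" using pp by (subst powr_add) simp
      then have 4: "(P y)\<^sup>2 * P y powr (\<beta> - 1) = P y powr \<kappa>" by (simp add: \<beta>_def algebra_simps)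
      show ?thesis using 1 2 3 4 by (simp add: E_def E'_def mult.assoc)
    qed
    then show "(\<lambda>j. E j y) \<longlonglongrightarrow> P y powr \<kappa>" "(\<lambda>j. E' j y) \<longlonglongrightarrow> \<beta> * P y powr \<kappa>" by auto
  qed
  have bdd: "\<exists>K\<ge>0. \<forall>y\<in>B. \<bar>G y\<bar> \<le> K" if "continuous_on UNIV G" for G :: "'a \<Rightarrow> real"
  proof -
    have "compact (G ` B)" using that unfolding B_def
      by (intro compact_continuous_image compact_cbox) (auto intro: continuous_on_subset)
    from compact_imp_bounded[OF this] obtain K where "K > 0" "\<forall>x\<in>G ` B. norm x \<le> K"
      unfolding bounded_pos by blast
    then show ?thesis by (intro exI[of _ K]) auto
  qed
  \<comment> \<open>For \<kappa> = 0 the weight is discontinuous at the sphere, so integrability is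
    obtained through a dominated limit of the continuous \<open>E j\<close>.\<close>
  have int: "(\<lambda>y. P y powr \<kappa> * G y) integrable_on B" if G: "continuous_on UNIV G" for G
  proof -
    obtain K where K: "K \<ge> 0" "\<forall>y\<in>B. \<bar>G y\<bar> \<le> K" using bdd[OF G] by blast
    show ?thesis
    proof (rule dominated_convergence(1)[where f="\<lambda>j y. E j y * G y" and h="\<lambda>y. 2 * K"])
      show "(\<lambda>y. E j y * G y) integrable_on B" for j unfolding B_def
        by (intro integrable_continuous continuous_on_subset[OF continuous_on_mult[OF cE(1) G]]) auto
      show "(\<lambda>y. 2 * K) integrable_on B" unfolding B_def by (rule integrable_const)
      show "norm (E j y * G y) \<le> 2 * K" if "y \<in> B" for j y
        using Eb K that by (simp add: abs_mult) (intro mult_mono; simp)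
      show "(\<lambda>j. E j y * G y) \<longlonglongrightarrow> P y powr \<kappa> * G y" for y by (intro tendsto_intros Elim)
    qed
  qed
  define I where "I = (\<lambda>G. integral B (\<lambda>y. P y powr \<kappa> * G y))"
  define c where "c = I (\<lambda>y. 1)"
  \<comment> \<open>From 0 \<le> P \<le> 1 and \<kappa> \<le> 1 follows P \<le> P^\<kappa>, and P is
    continuous and nonnegative with P 0 = 1. Division by c will normalize \<Phi> to the value 1 on
    constants equal to 1.\<close>
  have cpos: "c > 0"
  proof -
    have "integral B P \<le> c" unfolding c_def I_def
    proof (rule integral_le)
      show "P integrable_on B" unfolding B_def
        by (intro integrable_continuous continuous_on_subset[OF cP]) auto
      show "(\<lambda>y. P y powr \<kappa> * 1) integrable_on B" by (intro int) simp
      show "P y \<le> P y powr \<kappa> * 1" for y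
      proof (cases "P y = 0")
        case False
        then have "P y powr 1 \<le> P y powr \<kappa>" using P01[of y] \<kappa> by (intro powr_mono') auto
        then show ?thesis using P01[of y] by simp
      qed simp
    qed
    moreover have "integral B P \<noteq> 0"
    proof
      assume "integral B P = 0"
      then have "\<forall>y\<in>B. P y = 0" unfolding B_def
        by (subst (asm) integral_cbox_eq_0_iff) (use P01 in \<open>auto intro: continuous_on_subset[OF cP] simp: box_ne_empty inner_sum_left inner_Basis\<close>)
      then have "P 0 = 0" using inB[of 0] by auto
      then show False by (simp add: P_def)
    qed
    moreover have "integral B P \<ge> 0" by (rule integral_nonneg) (use P01 in \<open>auto simp: B_def intro!: integrable_continuous continuous_on_subset[OF cP]\<close>)
    ultimately show ?thesis by simp
  qed
  define \<Phi> where "\<Phi> = (\<lambda>G. I G / c)"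
  have "ball_functional \<Phi>"
    unfolding ball_functional_def
  proof (intro conjI allI impI exI[of _ 1])
    fix G H :: "'a \<Rightarrow> real" assume GH: "continuous_on UNIV G" "continuous_on UNIV H"
    have "I (\<lambda>y. G y + H y) = I G + I H"
      unfolding I_def distrib_left by (intro integral_add int GH)
    then show "\<Phi> (\<lambda>y. G y + H y) = \<Phi> G + \<Phi> H" by (simp add: \<Phi>_def add_divide_distrib)
  next
    fix d and G :: "'a \<Rightarrow> real" assume G: "continuous_on UNIV G"
    have "I (\<lambda>y. d * G y) = d * I G"
      unfolding I_def by (simp add: mult.left_commute[of _ d] flip: integral_mult_right)
    then show "\<Phi> (\<lambda>y. d * G y) = d * \<Phi> G" by (simp add: \<Phi>_def)
  next
    fix G :: "'a \<Rightarrow> real" and K assume G: "continuous_on UNIV G" and K: "\<forall>y\<in>cball 0 1. \<bar>G y\<bar> \<le> K"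
    have "norm (I G) \<le> integral B (\<lambda>y. P y powr \<kappa> * K)"
      unfolding I_def
    proof (rule integral_norm_bound_integral)
      show "(\<lambda>y. P y powr \<kappa> * K) integrable_on B" by (intro int) simp
      show "norm (P y powr \<kappa> * G y) \<le> P y powr \<kappa> * K" for y
        using K P0[of y] by (cases "norm y \<le> 1") (auto simp: abs_mult intro!: mult_left_mono)
    qed (intro int G)
    also have "\<dots> = K * c" unfolding c_def I_def by (simp add: mult.commute)
    finally show "\<bar>\<Phi> G\<bar> \<le> 1 * K" using cpos by (simp add: \<Phi>_def divide_le_eq)
  qed simp
  moreover have "\<Phi> (\<lambda>y. 1) = 1" using cpos by (simp add: \<Phi>_def c_def[symmetric])
  moreover have "\<Phi> (\<lambda>y. real (2 * k + 2) * (\<Sum>c\<in>Basis. (y \<bullet> c) * pd c H y)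
       + (\<Sum>b\<in>Basis. \<Sum>c\<in>Basis. (y \<bullet> b) * (y \<bullet> c) * pd b (pd c H) y)
       - (\<Sum>b\<in>Basis. pd b (pd b H) y)) = 0" if H: "Ck_on 2 UNIV H" for H
  proof -
    have C2: "Ck_on (Suc (Suc 0)) UNIV H" using H by (simp add: numeral_2_eq_2)
    have cH: "continuous_on UNIV (pd b H)" if "b \<in> Basis" for b
      by (rule Ck_on_continuous[OF Ck_on_pd[OF C2 that]])
    have cH2: "continuous_on UNIV (pd b (pd c H))" if "b \<in> Basis" "c \<in> Basis" for b c
      by (rule Ck_on_continuous[OF Ck_on_pd[OF Ck_on_pd[OF C2 that(2)] that(1)]])
    define D where "D = (\<lambda>y. \<Sum>c\<in>Basis. (y \<bullet> c) * pd c H y)"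
    define G where "G = (\<lambda>y. (real DIM('a) + 1) * D y + (\<Sum>b\<in>Basis. \<Sum>c\<in>Basis. (y \<bullet> b) * (y \<bullet> c) * pd b (pd c H) y)
       - (\<Sum>b\<in>Basis. pd b (pd b H) y))"
    have cD: "continuous_on UNIV D" unfolding D_def by (intro continuous_intros cH)
    have cG: "continuous_on UNIV G" unfolding G_def by (intro continuous_intros cD cH2)
    define S where "S = (\<lambda>j y. 4 * (E j y + E' j y) * D y + E j y * G y)"
    have S0: "integral B (S j) = 0" for j
    proof -
      have "(S j has_integral 0) UNIV"
        using ball_weight_divergence[OF H \<epsilon>(1)[of j], of \<beta>]
        unfolding S_def E_def E'_def P_def D_def G_def by simp
      moreover have "S j y = 0" if "y \<notin> B" for y
      proof -
        have "norm y \<ge> 1" using inB[of y] that by (cases "norm y \<le> 1") auto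
        then show ?thesis using P0[of y] by (simp add: S_def E_def E'_def)
      qed
      then have "S j = (\<lambda>y. if y \<in> B then S j y else 0)" by auto
      ultimately have "(S j has_integral 0) B" by (metis has_integral_restrict_UNIV)
      then show ?thesis by (rule integral_unique)
    qed
    obtain K1 where K1: "K1 \<ge> 0" "\<forall>y\<in>B. \<bar>D y\<bar> \<le> K1" using bdd[OF cD] by blast
    obtain K2 where K2: "K2 \<ge> 0" "\<forall>y\<in>B. \<bar>G y\<bar> \<le> K2" using bdd[OF cG] by blast
    have "(\<lambda>j. integral B (S j)) \<longlonglongrightarrow> integral B (\<lambda>y. 4 * (P y powr \<kappa> + \<beta> * P y powr \<kappa>) * D y + P y powr \<kappa> * G y)"
    proof (rule dominated_convergence(2)[where h="\<lambda>y. 4 * (2 + 2 * \<bar>\<beta>\<bar>) * K1 + 2 * K2"])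
      show "S j integrable_on B" for j unfolding B_def S_def
        by (intro integrable_continuous continuous_on_subset[of UNIV _ "cbox (- One) One"] continuous_intros cE cD cG) auto
      show "(\<lambda>y. 4 * (2 + 2 * \<bar>\<beta>\<bar>) * K1 + 2 * K2) integrable_on B" unfolding B_def by (rule integrable_const)
      show "norm (S j y) \<le> 4 * (2 + 2 * \<bar>\<beta>\<bar>) * K1 + 2 * K2" if y: "y \<in> B" for j y
      proof -
        have "\<bar>E j y + E' j y\<bar> \<le> 2 + 2 * \<bar>\<beta>\<bar>" using Eb[of j y] E'b[of j y] by linarith
        then have "\<bar>4 * (E j y + E' j y) * D y\<bar> \<le> 4 * (2 + 2 * \<bar>\<beta>\<bar>) * K1"
          unfolding abs_mult using K1 y by (intro mult_mono) auto
        moreover have "\<bar>E j y * G y\<bar> \<le> 2 * K2" unfolding abs_mult using Eb K2 y by (intro mult_mono) auto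
        ultimately show ?thesis unfolding S_def by simp
      qed
      show "(\<lambda>j. S j y) \<longlonglongrightarrow> 4 * (P y powr \<kappa> + \<beta> * P y powr \<kappa>) * D y + P y powr \<kappa> * G y" for y
        unfolding S_def by (intro tendsto_intros Elim E'lim)
    qed
    then have z: "integral B (\<lambda>y. 4 * (P y powr \<kappa> + \<beta> * P y powr \<kappa>) * D y + P y powr \<kappa> * G y) = 0"
      unfolding S0 using LIMSEQ_unique tendsto_const by blast
    \<comment> \<open>\<kappa> = \<beta> + 1 merges the two weights; 4 \<kappa> + n + 1 = 2k + 2
      then yields the required coefficient.\<close>
    have pt: "4 * (P y powr \<kappa> + \<beta> * P y powr \<kappa>) * D y + P y powr \<kappa> * G y =
       P y powr \<kappa> * (4 * \<kappa> * D y + G y)" for y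
      by (simp add: \<beta>_def algebra_simps)
    have e: "4 * \<kappa> * D y + G y = real (2 * k + 2) * D y + (\<Sum>b\<in>Basis. \<Sum>c\<in>Basis. (y \<bullet> b) * (y \<bullet> c) * pd b (pd c H) y)
       - (\<Sum>b\<in>Basis. pd b (pd b H) y)" for y
      unfolding p[symmetric] G_def by (simp add: algebra_simps)
    show ?thesis using z unfolding pt e by (simp only: \<Phi>_def I_def D_def div_0)
  qed
  ultimately show ?thesis by blast
qed

section \<open>The Euler--Poisson--Darboux equation\<close>

lemma has_pd_affine:
  assumes "has_pd b h d (x + r *\<^sub>R y)"
  shows "has_pd b (\<lambda>y. h (x + r *\<^sub>R y)) (r * d) y"
proof -
  have 1: "((\<lambda>s. h (x + r *\<^sub>R y + s *\<^sub>R b)) has_real_derivative d) (at (r * 0))"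
    using assms by (simp add: has_pd_def)
  have 2: "((\<lambda>s. r * s) has_real_derivative r) (at 0)"
    by (auto intro!: derivative_eq_intros)
  from DERIV_chain2[where g="\<lambda>s. r * s", OF 1 2]
  show ?thesis by (simp add: has_pd_def algebra_simps)
qed

lemma Ck_on_affine:
  assumes "Ck_on k UNIV h"
  shows "Ck_on k UNIV (\<lambda>y. h (x + r *\<^sub>R y))"
  using assms
proof (induction k arbitrary: h)
  case 0
  then show ?case unfolding Ck_on_0 by (rule continuous_on_compose2) (auto intro!: continuous_intros)
next
  case (Suc k)
  show ?case
  proof (rule Ck_on_SucI[where g'="\<lambda>b y. r * pd b h (x + r *\<^sub>R y)"])
    show "continuous_on UNIV (\<lambda>y. h (x + r *\<^sub>R y))"
      by (rule continuous_on_compose2[OF Ck_on_continuous[OF Suc.prems]]) (auto intro!: continuous_intros)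
    show "Ck_on k UNIV (\<lambda>y. r * pd b h (x + r *\<^sub>R y))" if "b \<in> Basis" for b
      by (intro Ck_on_cmult Suc.IH Ck_on_pd[OF Suc.prems that]) simp
    fix b y :: 'a assume b: "b \<in> Basis"
    show "has_pd b (\<lambda>y. h (x + r *\<^sub>R y)) (r * pd b h (x + r *\<^sub>R y)) y"
      by (intro has_pd_affine Ck_on_Suc_has_pd[OF Suc.prems b UNIV_I])
  qed simp
qed

lemma pd_affine:
  assumes "Ck_on (Suc 0) UNIV h" "b \<in> Basis"
  shows "pd b (\<lambda>y. h (x + r *\<^sub>R y)) = (\<lambda>y. r * pd b h (x + r *\<^sub>R y))"
  by (rule ext, rule has_pd_imp_pd) (intro has_pd_affine Ck_on_Suc_has_pd[OF assms UNIV_I])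

text \<open>
  The Euler--Poisson--Darboux equation \<open>F\<^sub>r\<^sub>r + (p / r) F\<^sub>r = \<Delta>F\<close>, multiplied by \<open>r\<close> so as to include \<open>r = 0\<close>.
\<close>

definition EPD :: "real \<Rightarrow> ('a::euclidean_space \<times> real \<Rightarrow> real) \<Rightarrow> bool" where
  "EPD p F \<longleftrightarrow> (\<forall>q. snd q * pd (0, 1) (pd (0, 1) F) q + p * pd (0, 1) F q =
     snd q * (\<Sum>b\<in>Basis. pd (b, 0) (pd (b, 0) F) q))"

lemma Basis_prodI: "b \<in> Basis \<Longrightarrow> (b, 0::real) \<in> Basis" "(0, 1::real) \<in> Basis"
  by (auto simp: Basis_prod_def)

text \<open>Derivatives of the mean in r are the means of \<open>D\<close> and \<open>Q\<close>, and
  its Laplacian in x is the mean of \<open>L\<close>. For H(y) = h(x + r y) each y-derivative brings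
  a factor r, so the hypothesis on \<Phi> is r times the claim.\<close>

lemma mean_EPD:
  fixes \<Phi> :: "('a::euclidean_space \<Rightarrow> real) \<Rightarrow> real"
  assumes \<Phi>: "ball_functional \<Phi>"
    and EPD: "\<And>H. Ck_on 2 UNIV H \<Longrightarrow> \<Phi> (\<lambda>y. p * (\<Sum>c\<in>Basis. (y \<bullet> c) * pd c H y)
       + (\<Sum>b\<in>Basis. \<Sum>c\<in>Basis. (y \<bullet> b) * (y \<bullet> c) * pd b (pd c H) y)
       - (\<Sum>b\<in>Basis. pd b (pd b H) y)) = 0"
    and h: "Ck_on 2 UNIV h"
  shows "EPD p (\<lambda>q. \<Phi> (\<lambda>y. h (fst q + snd q *\<^sub>R y)))"
  unfolding EPD_def
proof
  fix q :: "'a \<times> real"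
  obtain x r where q: "q = (x, r)" by fastforce
  define M where "M = (\<lambda>q. \<Phi> (\<lambda>y. h (fst q + snd q *\<^sub>R y)))"
  have C2: "Ck_on (Suc (Suc 0)) UNIV h" using h by (simp add: numeral_2_eq_2)
  have C1: "Ck_on (Suc 0) UNIV h" using Ck_on_SucD[OF C2] .
  have c0: "continuous_on UNIV h" using Ck_on_continuous[OF h] .
  have c1: "continuous_on UNIV (pd b h)" if "b \<in> Basis" for b
    by (rule Ck_on_continuous[OF Ck_on_pd[OF C1 that]])
  have c2: "continuous_on UNIV (pd b (pd c h))" if "b \<in> Basis" "c \<in> Basis" for b c
    by (rule Ck_on_continuous[OF Ck_on_pd[OF Ck_on_pd[OF C2 that(2)] that(1)]])
  have lin: "continuous_on UNIV (\<lambda>y. g (z + t *\<^sub>R y))" if "continuous_on UNIV g" for g :: "'a \<Rightarrow> real" and z t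
    by (rule continuous_on_compose2[OF that]) (auto intro!: continuous_intros)
  have lin2: "continuous_on UNIV (\<lambda>w. g (z + fst w *\<^sub>R snd w))" if "continuous_on UNIV g" for g :: "'a \<Rightarrow> real" and z
    by (rule continuous_on_compose2[OF that]) (auto intro!: continuous_intros)
  define D where "D = (\<lambda>q y. \<Sum>c\<in>Basis. (y \<bullet> c) * pd c h (fst q + snd q *\<^sub>R y))"
  define Q where "Q = (\<lambda>q y. \<Sum>b\<in>Basis. \<Sum>c\<in>Basis. (y \<bullet> b) * (y \<bullet> c) * pd b (pd c h) (fst q + snd q *\<^sub>R y))"
  define L where "L = (\<lambda>q y. \<Sum>b\<in>Basis. pd b (pd b h) (fst q + snd q *\<^sub>R y))"
  have cD: "continuous_on UNIV (D q)" and cQ: "continuous_on UNIV (Q q)" and cL: "continuous_on UNIV (L q)" for q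
    unfolding D_def Q_def L_def by (intro continuous_intros lin c1 c2; assumption)+
  have M_r: "pd (0, 1) M = (\<lambda>q. \<Phi> (D q))"
  proof
    fix q :: "'a \<times> real"
    have "((\<lambda>s. \<Phi> (\<lambda>y. h (fst q + s *\<^sub>R y))) has_real_derivative
       \<Phi> (\<lambda>y. \<Sum>c\<in>Basis. (y \<bullet> c) * pd c h (fst q + snd q *\<^sub>R y))) (at (snd q))"
    proof (rule ball_functional_deriv[OF \<Phi>, of "\<lambda>s y. h (fst q + s *\<^sub>R y)" "\<lambda>s y. \<Sum>c\<in>Basis. (y \<bullet> c) * pd c h (fst q + s *\<^sub>R y)"])
      show "((\<lambda>s. h (fst q + s *\<^sub>R y)) has_real_derivative (\<Sum>c\<in>Basis. (y \<bullet> c) * pd c h (fst q + s *\<^sub>R y))) (at s)" for s y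
        using C1_line_derivative[of h] C1 by simp
      show "continuous_on UNIV (\<lambda>(s, y). \<Sum>c\<in>Basis. (y \<bullet> c) * pd c h (fst q + s *\<^sub>R y))"
        unfolding split_beta by (intro continuous_intros lin2 c1)
    qed (rule lin[OF c0])
    then have "has_pd (0, 1) M (\<Phi> (D q)) q"
      using DERIV_shift[of "\<lambda>s. \<Phi> (\<lambda>y. h (fst q + s *\<^sub>R y))" "\<Phi> (D q)" 0 "snd q"]
      by (simp add: has_pd_def M_def D_def add.commute)
    then show "pd (0, 1) M q = \<Phi> (D q)" by (rule has_pd_imp_pd)
  qed
  have M_rr: "pd (0, 1) (\<lambda>q. \<Phi> (D q)) q = \<Phi> (Q q)" for q
  proof -
    have "((\<lambda>s. \<Phi> (D (fst q, s))) has_real_derivative \<Phi> (Q (fst q, snd q))) (at (snd q))"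
    proof (rule ball_functional_deriv[OF \<Phi>, of "\<lambda>s. D (fst q, s)" "\<lambda>s. Q (fst q, s)"])
      fix s y
      have "((\<lambda>s. pd c h (fst q + s *\<^sub>R y)) has_real_derivative (\<Sum>b\<in>Basis. (y \<bullet> b) * pd b (pd c h) (fst q + s *\<^sub>R y))) (at s)"
        if "c \<in> Basis" for c
        using C1_line_derivative[of "pd c h"] Ck_on_pd[OF C2 that] by simp
      then have "((\<lambda>s. D (fst q, s) y) has_real_derivative (\<Sum>c\<in>Basis. (y \<bullet> c) * (\<Sum>b\<in>Basis. (y \<bullet> b) * pd b (pd c h) (fst q + s *\<^sub>R y)))) (at s)"
        unfolding D_def fst_conv snd_conv by (intro DERIV_sum DERIV_cmult)
      moreover have "(\<Sum>c\<in>Basis. (y \<bullet> c) * (\<Sum>b\<in>Basis. (y \<bullet> b) * pd b (pd c h) (fst q + s *\<^sub>R y))) = Q (fst q, s) y"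
        unfolding Q_def sum_distrib_left fst_conv snd_conv by (subst sum.swap) (simp add: mult_ac)
      ultimately show "((\<lambda>s. D (fst q, s) y) has_real_derivative Q (fst q, s) y) (at s)" by simp
    next
      show "continuous_on UNIV (\<lambda>(s, y). Q (fst q, s) y)"
        unfolding split_beta Q_def fst_conv snd_conv by (intro continuous_intros lin2 c2)
    qed (rule cD)
    then have "has_pd (0, 1) (\<lambda>q. \<Phi> (D q)) (\<Phi> (Q q)) q"
      using DERIV_shift[of "\<lambda>s. \<Phi> (D (fst q, s))" "\<Phi> (Q q)" 0 "snd q"]
      by (cases q) (simp add: has_pd_def add.commute)
    then show ?thesis by (rule has_pd_imp_pd)
  qed
  have mop: "mean_operator 0 (\<lambda>h q. \<Phi> (\<lambda>y. h (fst q + snd q *\<^sub>R y)))"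
    using mean_operator.base[OF \<Phi>, of "[]" 0 0] by simp
  have M_b: "pd (b, 0) M = (\<lambda>q. \<Phi> (\<lambda>y. pd b h (fst q + snd q *\<^sub>R y)))" if b: "b \<in> Basis" for b
    unfolding M_def
    by (rule ext, rule has_pd_imp_pd, rule mean_operator_has_pd_x[OF mop b C1])
  have M_bb: "pd (b, 0) (pd (b, 0) M) q = \<Phi> (\<lambda>y. pd b (pd b h) (fst q + snd q *\<^sub>R y))" if b: "b \<in> Basis" for b q
    unfolding M_b[OF b]
    by (rule has_pd_imp_pd, rule mean_operator_has_pd_x[OF mop b Ck_on_pd[OF C2 b]])
  have lap: "(\<Sum>b\<in>Basis. pd (b, 0) (pd (b, 0) M) q) = \<Phi> (L q)" for q
    unfolding L_def by (subst ball_functional_sum[OF \<Phi>]) (auto simp: M_bb intro!: lin c2)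
  have "r * \<Phi> (Q (x, r)) + p * \<Phi> (D (x, r)) = r * \<Phi> (L (x, r))"
  proof (cases "r = 0")
    case True
    \<comment> \<open>At r = 0 the claim is p \<Phi>(D) = 0, a statement about first moments of
      \<Phi>. It is the hypothesis for the linear part of h at x, whose second derivatives
      vanish.\<close>
    define H where "H = (\<lambda>y. \<Sum>c\<in>Basis. pd c h x * (y \<bullet> c))"
    have pH: "pd b H = (\<lambda>y. pd b h x)" if "b \<in> Basis" for b
    proof
      fix y
      have "has_pd b H (\<Sum>c\<in>Basis. pd c h x * (b \<bullet> c)) y"
        unfolding H_def by (intro has_pd_sum has_pd_cmult has_pd_inner that) auto
      moreover have "(\<Sum>c\<in>Basis. pd c h x * (b \<bullet> c)) = (\<Sum>c\<in>Basis. if c = b then pd b h x else 0)"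
        by (rule sum.cong) (use that in \<open>auto simp: inner_Basis\<close>)
      ultimately have "has_pd b H (pd b h x) y" using that by simp
      then show "pd b H y = pd b h x" by (rule has_pd_imp_pd)
    qed
    have CH: "Ck_on 2 UNIV H" unfolding numeral_2_eq_2
    proof (rule Ck_on_SucI[where g'="\<lambda>b y. pd b h x"])
      show "continuous_on UNIV H" unfolding H_def by (intro continuous_intros)
      fix b y :: 'a assume b: "b \<in> Basis"
      have "has_pd b H (\<Sum>c\<in>Basis. pd c h x * (b \<bullet> c)) y"
        unfolding H_def by (intro has_pd_sum has_pd_cmult has_pd_inner b) auto
      then show "has_pd b H (pd b h x) y" using has_pd_imp_pd pH[OF b] by metis
    qed (auto intro: Ck_on_const)
    have pH2: "pd c (pd b H) y = 0" if "b \<in> Basis" for b c y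
      unfolding pH[OF that] by (rule has_pd_imp_pd[OF has_pd_const])
    have "\<Phi> (\<lambda>y. p * (\<Sum>c\<in>Basis. (y \<bullet> c) * pd c h x)) = 0"
      using EPD[OF CH] by (simp add: pH has_pd_imp_pd[OF has_pd_const])
    moreover have "\<Phi> (\<lambda>y. p * (\<Sum>c\<in>Basis. (y \<bullet> c) * pd c h x)) = p * \<Phi> (D (x, r))"
      using ball_functional_cmult[OF \<Phi> cD, of p "(x, r)"] by (simp add: D_def True)
    ultimately show ?thesis using True by simp
  next
    case False
    define H where "H = (\<lambda>y. h (x + r *\<^sub>R y))"
    have CH: "Ck_on 2 UNIV H" unfolding H_def by (rule Ck_on_affine[OF h])
    have pH: "pd b H = (\<lambda>y. r * pd b h (x + r *\<^sub>R y))" if "b \<in> Basis" for b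
      unfolding H_def by (rule pd_affine[OF C1 that])
    have pH2: "pd c (\<lambda>y. r * pd b h (x + r *\<^sub>R y)) y = r\<^sup>2 * pd c (pd b h) (x + r *\<^sub>R y)" if "b \<in> Basis" "c \<in> Basis" for b c y
    proof -
      have "has_pd c (\<lambda>y. pd b h (x + r *\<^sub>R y)) (pd c (\<lambda>y. pd b h (x + r *\<^sub>R y)) y) y"
        by (rule Ck_on_Suc_has_pd[OF Ck_on_affine[OF Ck_on_pd[OF C2 that(1)]] that(2) UNIV_I])
      from has_pd_imp_pd[OF has_pd_cmult[OF this, of r]] pd_affine[OF Ck_on_pd[OF C2 that(1)] that(2), of x r]
      show ?thesis by (simp add: power2_eq_square)
    qed
    have "0 = \<Phi> (\<lambda>y. p * (\<Sum>c\<in>Basis. (y \<bullet> c) * pd c H y)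
       + (\<Sum>b\<in>Basis. \<Sum>c\<in>Basis. (y \<bullet> b) * (y \<bullet> c) * pd b (pd c H) y)
       - (\<Sum>b\<in>Basis. pd b (pd b H) y))" using EPD[OF CH] by simp
    also have "\<dots> = \<Phi> (\<lambda>y. (p * r) * D (x, r) y + r\<^sup>2 * Q (x, r) y - r\<^sup>2 * L (x, r) y)"
      by (simp add: pH pH2 D_def Q_def L_def sum_distrib_left mult_ac cong: sum.cong)
    also have "\<dots> = (p * r) * \<Phi> (D (x, r)) + r\<^sup>2 * \<Phi> (Q (x, r)) - r\<^sup>2 * \<Phi> (L (x, r))"
      by (simp add: ball_functional_diff[OF \<Phi>] ball_functional_add[OF \<Phi>] ball_functional_cmult[OF \<Phi>] continuous_intros cD cQ cL)
    also have "\<dots> = r * (p * \<Phi> (D (x, r)) + r * \<Phi> (Q (x, r)) - r * \<Phi> (L (x, r)))"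
      by (simp add: power2_eq_square algebra_simps)
    finally show ?thesis using False by simp
  qed
  then show "snd q * pd (0, 1) (pd (0, 1) (\<lambda>q. \<Phi> (\<lambda>y. h (fst q + snd q *\<^sub>R y)))) q +
       p * pd (0, 1) (\<lambda>q. \<Phi> (\<lambda>y. h (fst q + snd q *\<^sub>R y))) q =
       snd q * (\<Sum>b\<in>Basis. pd (b, 0) (pd (b, 0) (\<lambda>q. \<Phi> (\<lambda>y. h (fst q + snd q *\<^sub>R y)))) q)"
    unfolding M_def[symmetric] M_r M_rr lap q by simp
qed

text \<open>Symmetry of mixed derivatives is applied twice, hence C^3. The lemma serves to
  differentiate an equation in r: when p is lowered, and when the wave equation passes from
  \<open>Z\<close> to \<open>Zr\<close>.\<close>

lemma has_pd_lap:
  fixes F :: "'a::euclidean_space \<times> real \<Rightarrow> real"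
  assumes F: "Ck_on 3 UNIV F"
  shows "has_pd (0, 1) (\<lambda>q. \<Sum>b\<in>Basis. pd (b, 0) (pd (b, 0) F) q)
    (\<Sum>b\<in>Basis. pd (b, 0) (pd (b, 0) (pd (0, 1) F)) q) q"
proof -
  have C3: "Ck_on (Suc (Suc (Suc 0))) UNIV F" using F by (simp add: numeral_3_eq_3)
  note C2 = Ck_on_SucD[OF C3] and bas = Basis_prodI
  have CFb: "Ck_on (Suc (Suc 0)) UNIV (pd (b, 0) F)" if "b \<in> Basis" for b
    by (rule Ck_on_pd[OF C3 bas(1)[OF that]])
  have CFbb: "Ck_on (Suc 0) UNIV (pd (b, 0) (pd (b, 0) F))" if "b \<in> Basis" for b
    by (rule Ck_on_pd[OF CFb[OF that] bas(1)[OF that]])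
  have comm: "pd (b, 0) (pd (b, 0) (pd (0, 1) F)) q = pd (0, 1) (pd (b, 0) (pd (b, 0) F)) q" if b: "b \<in> Basis" for b q
  proof -
    have "pd (b, 0) (pd (0, 1) F) = pd (0, 1) (pd (b, 0) F)"
      using C2 by (intro ext pd_commute bas b) (simp add: numeral_2_eq_2)
    moreover have "pd (b, 0) (pd (0, 1) (pd (b, 0) F)) q = pd (0, 1) (pd (b, 0) (pd (b, 0) F)) q"
      using CFb[OF b] by (intro pd_commute bas b) (simp add: numeral_2_eq_2)
    ultimately show ?thesis by simp
  qed
  show ?thesis
    by (intro has_pd_sum) (auto simp: comm intro!: Ck_on_Suc_has_pd[OF CFbb] bas)
qed

text \<open>With c = 1 / (p - 1) the equation for F makes the r-derivative of the new function equal
  to c r \<Delta>F, which contains no r-derivative of F. Differentiating this once more gives the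
  equation with p - 2.\<close>

lemma EPD_step:
  fixes F :: "'a::euclidean_space \<times> real \<Rightarrow> real"
  assumes F: "Ck_on 3 UNIV F" and EPD: "EPD p F" and p: "p \<noteq> 1"
  shows "EPD (p - 2) (\<lambda>q. F q + 1 / (p - 1) * (snd q * pd (0, 1) F q))"
proof -
  define c where "c = 1 / (p - 1)"
  have C3: "Ck_on (Suc (Suc (Suc 0))) UNIV F" using F by (simp add: numeral_3_eq_3)
  note C2 = Ck_on_SucD[OF C3] and bas = Basis_prodI
  note C1 = Ck_on_SucD[OF C2]
  define Fr where "Fr = pd (0, 1) F"
  define Frr where "Frr = pd (0, 1) Fr"
  define L where "L = (\<lambda>q. \<Sum>b\<in>Basis. pd (b, 0) (pd (b, 0) F) q)"
  define L' where "L' = (\<lambda>q. \<Sum>b\<in>Basis. pd (b, 0) (pd (b, 0) Fr) q)"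
  define Ft where "Ft = (\<lambda>q. F q + c * (snd q * Fr q))"
  have CFr: "Ck_on (Suc (Suc 0)) UNIV Fr" unfolding Fr_def by (rule Ck_on_pd[OF C3 bas(2)])
  have hF: "has_pd (0, 1) F (Fr q) q" for q unfolding Fr_def by (rule Ck_on_Suc_has_pd[OF C1 bas(2) UNIV_I])
  have hFr: "has_pd (0, 1) Fr (Frr q) q" for q
    unfolding Frr_def by (rule Ck_on_Suc_has_pd[OF CFr bas(2) UNIV_I])
  have E: "snd q * Frr q + p * Fr q = snd q * L q" for q
    using EPD unfolding EPD_def Frr_def Fr_def L_def by blast
  have hsnd: "has_pd (0, 1) snd 1 q" for q :: "'a \<times> real"
    using has_pd_snd[of "\<lambda>x. x" 1 q] by simp
  have Ft_r: "pd (0, 1) Ft = (\<lambda>q. c * (snd q * L q))"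
  proof
    fix q
    have "has_pd (0, 1) Ft (Fr q + c * (snd q * Frr q + 1 * Fr q)) q"
      unfolding Ft_def by (intro has_pd_add has_pd_cmult has_pd_mult hF hFr hsnd)
    moreover have "Fr q + c * (snd q * Frr q + 1 * Fr q) = c * (snd q * L q)"
    proof -
      \<comment> \<open>Equivalently 1 + c = c p: the terms in \<open>Fr\<close> combine to c times
        the left side of the equation for F.\<close>
      have "Fr q = c * (p - 1) * Fr q" using p by (simp add: c_def)
      then show ?thesis unfolding E[symmetric] by (simp add: algebra_simps)
    qed
    ultimately show "pd (0, 1) Ft q = c * (snd q * L q)" by (simp add: has_pd_imp_pd)
  qed
  have CFb: "Ck_on (Suc (Suc 0)) UNIV (pd (b, 0) F)" if "b \<in> Basis" for b
    by (rule Ck_on_pd[OF C3 bas(1)[OF that]])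
  have hL: "has_pd (0, 1) L (L' q) q" for q
    unfolding L_def L'_def Fr_def by (rule has_pd_lap[OF F])
  have Ft_rr: "pd (0, 1) (pd (0, 1) Ft) q = c * (snd q * L' q + L q)" for q
    unfolding Ft_r
    using has_pd_imp_pd[OF has_pd_cmult[OF has_pd_mult[OF hsnd hL], of c q]] by simp
  have h0: "has_pd (b, 0) snd 0 q" for b and q :: "'a \<times> real"
    using has_pd_snd_0[of b "\<lambda>x. x" q] by simp
  have Ft_b: "pd (b, 0) Ft = (\<lambda>q. pd (b, 0) F q + c * (snd q * pd (b, 0) Fr q))" if b: "b \<in> Basis" for b
  proof
    fix q
    have "has_pd (b, 0) Ft (pd (b, 0) F q + c * (snd q * pd (b, 0) Fr q + 0 * Fr q)) q"
      unfolding Ft_def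
      by (intro has_pd_add has_pd_cmult has_pd_mult h0 Ck_on_Suc_has_pd[OF C1] Ck_on_Suc_has_pd[OF CFr] bas b) auto
    then show "pd (b, 0) Ft q = pd (b, 0) F q + c * (snd q * pd (b, 0) Fr q)" by (simp add: has_pd_imp_pd)
  qed
  have Ft_bb: "pd (b, 0) (pd (b, 0) Ft) q = pd (b, 0) (pd (b, 0) F) q + c * (snd q * pd (b, 0) (pd (b, 0) Fr) q)" if b: "b \<in> Basis" for b q
  proof -
    have "has_pd (b, 0) (\<lambda>q. pd (b, 0) F q + c * (snd q * pd (b, 0) Fr q))
      (pd (b, 0) (pd (b, 0) F) q + c * (snd q * pd (b, 0) (pd (b, 0) Fr) q + 0 * pd (b, 0) Fr q)) q"
      by (intro has_pd_add has_pd_cmult has_pd_mult h0 Ck_on_Suc_has_pd[OF CFb] Ck_on_Suc_has_pd[OF Ck_on_pd[OF CFr]] bas b) auto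
    then show ?thesis unfolding Ft_b[OF b] by (simp add: has_pd_imp_pd)
  qed
  have lap: "(\<Sum>b\<in>Basis. pd (b, 0) (pd (b, 0) Ft) q) = L q + c * (snd q * L' q)" for q
    by (simp add: Ft_bb L_def L'_def sum.distrib sum_distrib_left)
  have "snd q * pd (0, 1) (pd (0, 1) Ft) q + (p - 2) * pd (0, 1) Ft q = snd q * (L q + c * (snd q * L' q))" for q
  proof -
    have "c * (p - 1) = 1" using p by (simp add: c_def)
    have "snd q * pd (0, 1) (pd (0, 1) Ft) q + (p - 2) * pd (0, 1) Ft q =
      c * (p - 1) * (snd q * L q) + snd q * (c * (snd q * L' q))"
      unfolding Ft_rr unfolding Ft_r by (simp add: algebra_simps)
    then show ?thesis unfolding \<open>c * (p - 1) = 1\<close> by (simp add: algebra_simps)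
  qed
  then have "EPD (p - 2) Ft" unfolding EPD_def lap by blast
  then show ?thesis unfolding Ft_def c_def Fr_def .
qed

text \<open>The mean with p = 2k + 2 is lowered j times, each time at the price of one derivative of
  h. The value at r = 0 is preserved because every correction carries a factor r.\<close>

lemma mean_operator_EPD_chain:
  fixes k :: nat
  defines "k \<equiv> DIM('a::euclidean_space) div 2"
  assumes "j \<le> k"
  shows "\<exists>T :: ('a \<Rightarrow> real) \<Rightarrow> 'a \<times> real \<Rightarrow> real. mean_operator j T \<and>
    (\<forall>h. Ck_on (j + 2) UNIV h \<longrightarrow> EPD (2 * real k + 2 - 2 * real j) (T h)) \<and>
    (\<forall>h x. Ck_on j UNIV h \<longrightarrow> T h (x, 0) = h x)"
  using assms(2)
proof (induction j)
  case 0
  obtain \<Phi> :: "('a \<Rightarrow> real) \<Rightarrow> real" where \<Phi>: "ball_functional \<Phi>" "\<Phi> (\<lambda>y. 1) = 1"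
    "\<And>H. Ck_on 2 UNIV H \<Longrightarrow> \<Phi> (\<lambda>y. real (2 * k + 2) * (\<Sum>c\<in>Basis. (y \<bullet> c) * pd c H y)
       + (\<Sum>b\<in>Basis. \<Sum>c\<in>Basis. (y \<bullet> b) * (y \<bullet> c) * pd b (pd c H) y)
       - (\<Sum>b\<in>Basis. pd b (pd b H) y)) = 0"
    using ex_EPD_mean[where 'a='a] unfolding k_def by blast
  have p: "2 * real k + 2 - 2 * real 0 = real (2 * k + 2)" by simp
  show ?case
  proof (intro exI conjI allI impI)
    show "mean_operator 0 (\<lambda>h q. \<Phi> (\<lambda>y. h (fst q + snd q *\<^sub>R y)))"
      using mean_operator.base[OF \<Phi>(1), of "[]" 0 0] by simp
    show "EPD (2 * real k + 2 - 2 * real 0) (\<lambda>q. \<Phi> (\<lambda>y. h (fst q + snd q *\<^sub>R y)))" if "Ck_on (0 + 2) UNIV h" for h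
      unfolding p by (rule mean_EPD[OF \<Phi>(1,3)]) (use that in \<open>simp_all add: numeral_2_eq_2\<close>)
    show "\<Phi> (\<lambda>y. h (fst (x, 0) + snd (x, 0) *\<^sub>R y)) = h x" for h x
      using ball_functional_cmult[OF \<Phi>(1), of "\<lambda>y. 1" "h x"] \<Phi>(2) by simp
  qed
next
  case (Suc j)
  then obtain T :: "('a \<Rightarrow> real) \<Rightarrow> 'a \<times> real \<Rightarrow> real" where T: "mean_operator j T"
    "\<And>h. Ck_on (j + 2) UNIV h \<Longrightarrow> EPD (2 * real k + 2 - 2 * real j) (T h)"
    "\<And>h x. Ck_on j UNIV h \<Longrightarrow> T h (x, 0) = h x" by auto
  obtain T' where T': "mean_operator (Suc j) T'" "\<And>h p. Ck_on (Suc j) UNIV h \<Longrightarrow> has_pd (0, 1) (T h) (T' h p) p"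
    using mean_operator_has_pd_r[OF T(1)] by blast
  define p where "p = 2 * real k + 2 - 2 * real j"
  \<comment> \<open>p - 1 is odd at every stage, so the division in the step is legitimate.\<close>
  have p1: "p \<noteq> 1"
  proof -
    have "p - 1 = real (2 * (k - j) + 1)" using Suc.prems by (simp add: p_def of_nat_diff)
    then show ?thesis by linarith
  qed
  show ?case
  proof (intro exI conjI allI impI)
    show "mean_operator (Suc j) (\<lambda>h q. T h q + 1 / (p - 1) * (snd q * T' h q))"
      by (intro mean_operator.add mean_operator_cmult mean_operator_times_r T' mean_operator_mono[OF T(1)]) simp
    show "T h (x, 0) + 1 / (p - 1) * (snd (x, 0) * T' h (x, 0)) = h x" if "Ck_on (Suc j) UNIV h" for h x
      using T(3)[OF Ck_on_SucD[OF that]] by simp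
    fix h :: "'a \<Rightarrow> real" assume h: "Ck_on (Suc j + 2) UNIV h"
    have h1: "Ck_on (Suc j) UNIV h" "Ck_on (j + 2) UNIV h" "Ck_on (j + 3) UNIV h"
      using h by (auto elim!: Ck_on_mono simp: numeral_3_eq_3)
    have "T' h = pd (0, 1) (T h)"
      using has_pd_imp_pd[OF T'(2)[OF h1(1)]] by auto
    moreover have "EPD (p - 2) (\<lambda>q. T h q + 1 / (p - 1) * (snd q * pd (0, 1) (T h) q))"
      by (intro EPD_step mean_operator_Ck[OF T(1) h1(3)] p1) (unfold p_def, rule T(2)[OF h1(2)])
    ultimately show "EPD (2 * real k + 2 - 2 * real (Suc j)) (\<lambda>q. T h q + 1 / (p - 1) * (snd q * T' h q))"
      by (simp add: p_def algebra_simps)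
  qed
qed

text \<open>j = k leaves p = 2, and r F_rr + 2 F_r = (r F)_rr: multiplication by r turns the
  equation into the wave equation, in all dimensions alike.\<close>

lemma ex_wave_mean_operator:
  fixes k :: nat
  defines "k \<equiv> DIM('a::euclidean_space) div 2"
  shows "\<exists>U :: ('a \<Rightarrow> real) \<Rightarrow> 'a \<times> real \<Rightarrow> real. mean_operator k U \<and>
    (\<forall>h. Ck_on (k + 2) UNIV h \<longrightarrow> (\<forall>x. U h (x, 0) = h x) \<and>
      (\<forall>q. pd (0, 1) (pd (0, 1) (\<lambda>q. snd q * U h q)) q =
        (\<Sum>b\<in>Basis. pd (b, 0) (pd (b, 0) (\<lambda>q. snd q * U h q)) q)))"
proof -
  obtain U :: "('a \<Rightarrow> real) \<Rightarrow> 'a \<times> real \<Rightarrow> real" where U: "mean_operator k U"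
    "\<And>h. Ck_on (k + 2) UNIV h \<Longrightarrow> EPD (2 * real k + 2 - 2 * real k) (U h)"
    "\<And>h x. Ck_on k UNIV h \<Longrightarrow> U h (x, 0) = h x"
    using mean_operator_EPD_chain[where 'a='a, of k] unfolding k_def by blast
  show ?thesis
  proof (intro exI[of _ U] conjI allI impI U(1))
    fix h :: "'a \<Rightarrow> real" assume h: "Ck_on (k + 2) UNIV h"
    show "U h (x, 0) = h x" for x by (rule U(3)[OF Ck_on_mono[OF h]]) simp
    fix q
    have C2: "Ck_on (Suc (Suc 0)) UNIV (U h)" using mean_operator_Ck[OF U(1) h] by (simp add: numeral_2_eq_2)
    note C1 = Ck_on_SucD[OF C2] and bas = Basis_prodI
    have hsnd: "has_pd (0, 1) snd 1 q" for q :: "'a \<times> real"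
      using has_pd_snd[of "\<lambda>x. x" 1 q] by simp
    have h0: "has_pd (b, 0) snd 0 q" for b and q :: "'a \<times> real"
      using has_pd_snd_0[of b "\<lambda>x. x" q] by simp
    have r1: "pd (0, 1) (\<lambda>q. snd q * U h q) = (\<lambda>q. snd q * pd (0, 1) (U h) q + 1 * U h q)"
      by (rule ext, rule has_pd_imp_pd, intro has_pd_mult hsnd Ck_on_Suc_has_pd[OF C1] bas) simp
    have r2: "pd (0, 1) (\<lambda>q. snd q * pd (0, 1) (U h) q + 1 * U h q) q =
       snd q * pd (0, 1) (pd (0, 1) (U h)) q + 1 * pd (0, 1) (U h) q + 1 * pd (0, 1) (U h) q"
      by (rule has_pd_imp_pd, intro has_pd_add has_pd_cmult has_pd_mult hsnd Ck_on_Suc_has_pd[OF C1] Ck_on_Suc_has_pd[OF Ck_on_pd[OF C2]] bas) simp_all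
    have b1: "pd (b, 0) (\<lambda>q. snd q * g q) q = snd q * pd (b, 0) g q" if "b \<in> Basis" "Ck_on (Suc 0) UNIV g" for b :: 'a and g q
      using has_pd_imp_pd[OF has_pd_mult[OF h0 Ck_on_Suc_has_pd[OF that(2) bas(1)[OF that(1)] UNIV_I]], of q] by simp
    have b2: "pd (b, 0) (pd (b, 0) (\<lambda>q. snd q * U h q)) q = snd q * pd (b, 0) (pd (b, 0) (U h)) q" if b: "b \<in> Basis" for b
    proof -
      have "pd (b, 0) (\<lambda>q. snd q * U h q) = (\<lambda>q. snd q * pd (b, 0) (U h) q)" using b1[OF b C1] by auto
      then show ?thesis using b1[OF b Ck_on_pd[OF C2 bas(1)[OF b]]] by simp
    qed
    have "snd q * pd (0, 1) (pd (0, 1) (U h)) q + 2 * pd (0, 1) (U h) q = snd q * (\<Sum>b\<in>Basis. pd (b, 0) (pd (b, 0) (U h)) q)"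
      using U(2)[OF h, unfolded EPD_def, rule_format, of q] by simp
    then show "pd (0, 1) (pd (0, 1) (\<lambda>q. snd q * U h q)) q =
        (\<Sum>b\<in>Basis. pd (b, 0) (pd (b, 0) (\<lambda>q. snd q * U h q)) q)"
      unfolding r1 r2 by (simp add: b2 sum_distrib_left)
  qed
qed

section \<open>Uniqueness for the wave equation\<close>

lemma has_pd_snd_line: "has_pd (0, 1) g d (x, r) \<longleftrightarrow> ((\<lambda>s. g (x, s)) has_real_derivative d) (at r)"
  using has_pd_line[of "(0, 1)" g d "(x, 0)" r] by simp

text \<open>The weight W = m^2 is C^1 and, for times in [0, R], vanishes outside the backward cone
  with vertex (x0, R). Up to twice the divergence of W v_r \<nabla>v, the r-derivative of the
  weighted energy density is -4 m ((R - r) e - 2 v_r (x - x0) \<bullet> \<nabla>v), which is \<le> 0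
  inside the cone by the Cauchy-Schwarz inequality. So v_r vanishes on the axis of the cone.\<close>

lemma wave_zero_forward:
  fixes V :: "'a::euclidean_space \<times> real \<Rightarrow> real"
  assumes V: "Ck_on 2 UNIV V"
    and wave: "\<And>q. pd (0, 1) (pd (0, 1) V) q = (\<Sum>b\<in>Basis. pd (b, 0) (pd (b, 0) V) q)"
    and V0: "\<And>x. V (x, 0) = 0" and V1: "\<And>x. pd (0, 1) V (x, 0) = 0" and r: "0 \<le> r"
  shows "V (x0, r) = 0"
proof -
  \<comment> \<open>Any vertex time beyond r keeps the segment from (x0, 0) to (x0, r) inside the
    cone, where the weight is positive.\<close>
  define R where "R = r + 1"
  have R: "R > 0" "r < R" using r by (auto simp: R_def)
  have C2: "Ck_on (Suc (Suc 0)) UNIV V" using V by (simp add: numeral_2_eq_2)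
  note C1 = Ck_on_SucD[OF C2] and bas = Basis_prodI
  define vr where "vr = pd (0, 1) V"
  define v where "v = (\<lambda>b. pd (b, 0) V)"
  have Cv: "Ck_on (Suc 0) UNIV vr" "b \<in> Basis \<Longrightarrow> Ck_on (Suc 0) UNIV (v b)" for b
    unfolding vr_def v_def by (auto intro!: Ck_on_pd[OF C2] bas)
  have cv: "continuous_on UNIV vr" "b \<in> Basis \<Longrightarrow> continuous_on UNIV (v b)" for b
    using Cv Ck_on_continuous by blast+
  have cvv: "continuous_on UNIV (pd (0, 1) vr)" "b \<in> Basis \<Longrightarrow> continuous_on UNIV (pd (b, 0) vr)"
    "b \<in> Basis \<Longrightarrow> continuous_on UNIV (pd (0, 1) (v b))" "b \<in> Basis \<Longrightarrow> continuous_on UNIV (pd (b, 0) (v b))" for b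
    by (auto intro!: Ck_on_continuous[of 0] Ck_on_pd[OF Cv(1)] Ck_on_pd[OF Cv(2)] bas)
  have comm: "pd (0, 1) (v b) q = pd (b, 0) vr q" if "b \<in> Basis" for b q
    unfolding v_def vr_def using that by (intro pd_commute[OF V] bas)
  have vb0: "v b (x, 0) = 0" for b x
    using has_pd_imp_pd[of "(b, 0)" V 0 "(x, 0)"] V0 by (simp add: v_def has_pd_def)
  define m where "m = (\<lambda>q. max 0 ((R - snd q)\<^sup>2 - (fst q - x0) \<bullet> (fst q - x0)))"
  have m0: "m q \<ge> 0" for q by (simp add: m_def)
  have cm: "continuous_on UNIV m" unfolding m_def by (intro continuous_intros)
  define W where "W = (\<lambda>q. (m q)\<^sup>2)"
  have cW: "continuous_on UNIV W" unfolding W_def by (intro continuous_intros cm)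
  have W_r: "has_pd (0, 1) W (- 4 * m q * (R - snd q)) q" for q
  proof -
    have "has_pd (0, 1) (\<lambda>q. (R - snd q)\<^sup>2 - (fst q - x0) \<bullet> (fst q - x0)) (- 2 * (R - snd q)) q"
      unfolding has_pd_def by (auto intro!: derivative_eq_intros)
    from has_pd_chain[OF this DERIV_max_0_power2] show ?thesis by (simp add: W_def m_def algebra_simps)
  qed
  have W_b: "has_pd (b, 0) W (- 4 * m q * ((fst q - x0) \<bullet> b)) q" for b q
  proof -
    have "has_pd (b, 0) (\<lambda>q. (R - snd q)\<^sup>2 - (fst q - x0) \<bullet> (fst q - x0)) (- 2 * ((fst q - x0) \<bullet> b)) q"
      unfolding has_pd_def add_diff_eq[symmetric] fst_add fst_scaleR fst_conv add.commute[of "fst q"]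
      unfolding add_diff_eq[symmetric] inner_add_left inner_add_right inner_scaleR_left inner_scaleR_right
      by (auto intro!: derivative_eq_intros simp: inner_commute)
    from has_pd_chain[OF this DERIV_max_0_power2] show ?thesis by (simp add: W_def m_def algebra_simps)
  qed
  have supp: "m (x, s) = 0" if "R \<le> norm (x - x0)" "s \<in> {0..R}" for x s
  proof -
    have "(R - s)\<^sup>2 \<le> R\<^sup>2" using that R by (intro power_mono) auto
    also have "\<dots> \<le> (norm (x - x0))\<^sup>2" using that R by (intro power_mono) auto
    finally show ?thesis by (simp add: m_def power2_norm_eq_inner)
  qed
  define B where "B = cbox (x0 - R *\<^sub>R One) (x0 + R *\<^sub>R One)"
  have inB: "x \<in> B" if "norm (x - x0) \<le> R" for x
  proof -
    have "- R \<le> (x - x0) \<bullet> i" "(x - x0) \<bullet> i \<le> R" if "i \<in> Basis" for i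
      using Basis_le_norm[OF that, of "x - x0"] \<open>norm (x - x0) \<le> R\<close> by linarith+
    then show ?thesis unfolding B_def mem_box by (auto simp: inner_diff_left inner_add_left) (smt (verit))+
  qed
  have m0B: "m (x, s) = 0" if "x \<notin> B" "s \<in> {0..R}" for x s
    using supp[of x s] inB[of x] that by force
  define e where "e = (\<lambda>q. (vr q)\<^sup>2 + (\<Sum>b\<in>Basis. (v b q)\<^sup>2))"
  have e0: "e q \<ge> 0" for q unfolding e_def by (intro add_nonneg_nonneg sum_nonneg) auto
  have ce: "continuous_on UNIV e" unfolding e_def by (intro continuous_intros cv)
  define E where "E = (\<lambda>s. integral B (\<lambda>x. W (x, s) * e (x, s)))"
  define E' where "E' = (\<lambda>q. - 4 * m q * (R - snd q) * e q + W q * (2 * vr q * pd (0, 1) vr q + (\<Sum>b\<in>Basis. 2 * v b q * pd (b, 0) vr q)))"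
  have cE': "continuous_on UNIV E'" unfolding E'_def by (intro continuous_intros cm ce cW cv cvv)
  have slice: "continuous_on B (\<lambda>x. g (x, s))" if "continuous_on UNIV g" for g :: "'a \<times> real \<Rightarrow> real" and s
    by (rule continuous_on_compose2[OF that]) (auto intro!: continuous_intros)
  have We: "has_pd (0, 1) (\<lambda>q. W q * e q) (E' q) q" for q
  proof -
    have "has_pd (0, 1) (\<lambda>q. vr q * vr q + (\<Sum>b\<in>Basis. v b q * v b q))
      ((vr q * pd (0, 1) vr q + pd (0, 1) vr q * vr q) + (\<Sum>b\<in>Basis. v b q * pd (0, 1) (v b) q + pd (0, 1) (v b) q * v b q)) q"
      by (intro has_pd_add has_pd_mult has_pd_sum Ck_on_Suc_has_pd[OF Cv(1)] Ck_on_Suc_has_pd[OF Cv(2)] bas) auto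
    moreover have "(\<Sum>b\<in>Basis. v b q * pd (0, 1) (v b) q + pd (0, 1) (v b) q * v b q) = (\<Sum>b\<in>Basis. 2 * v b q * pd (b, 0) vr q)"
      by (rule sum.cong) (auto simp: comm)
    ultimately have "has_pd (0, 1) e (2 * vr q * pd (0, 1) vr q + (\<Sum>b\<in>Basis. 2 * v b q * pd (b, 0) vr q)) q"
      by (simp add: e_def power2_eq_square mult.assoc)
    from has_pd_mult[OF W_r this] show ?thesis by (simp add: E'_def algebra_simps)
  qed
  have DE: "(E has_real_derivative integral B (\<lambda>x. E' (x, s))) (at s within {0..R})" if s: "s \<in> {0..R}" for s
    unfolding E_def B_def
  proof (rule leibniz_rule_field_derivative, fold B_def)
    fix s x
    show "((\<lambda>s. W (x, s) * e (x, s)) has_real_derivative E' (x, s)) (at s within {0..R})"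
      using We[of "(x, s)"] unfolding has_pd_snd_line by (rule has_field_derivative_at_within)
    show "(\<lambda>x. W (x, s) * e (x, s)) integrable_on B"
      using slice[OF continuous_on_mult[OF cW ce]] unfolding B_def by (intro integrable_continuous)
  next
    show "continuous_on ({0..R} \<times> B) (\<lambda>(s, x). E' (x, s))"
      unfolding split_beta by (rule continuous_on_compose2[OF cE']) (auto intro!: continuous_intros)
  qed (use s in auto)
  have neg: "integral B (\<lambda>x. E' (x, s)) \<le> 0" if s: "s \<in> {0..R}" for s
  proof -
    \<comment> \<open>The component along b of the flux W v_r \<nabla>v. Its divergence integrates
      to zero and accounts for all second derivatives of V.\<close>
    define F where "F = (\<lambda>b x. W (x, s) * (vr (x, s) * v b (x, s)))"
    define F' where "F' = (\<lambda>b x. W (x, s) * (vr (x, s) * pd (b, 0) (v b) (x, s) + pd (b, 0) vr (x, s) * v b (x, s))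
       + - 4 * m (x, s) * ((x - x0) \<bullet> b) * (vr (x, s) * v b (x, s)))"
    have slice': "continuous_on UNIV (\<lambda>x. g (x, s))" if "continuous_on UNIV g" for g :: "'a \<times> real \<Rightarrow> real"
      by (rule continuous_on_compose2[OF that]) (auto intro!: continuous_intros)
    have cF': "continuous_on UNIV (F' b)" if "b \<in> Basis" for b
      unfolding F'_def using that by (intro continuous_intros slice' cm cW cv cvv)
    have "(F' b has_integral 0) UNIV" if b: "b \<in> Basis" for b
    proof (rule has_integral_pd_compact_support[OF b, of "F b" _ "norm x0 + R"])
      fix y :: 'a
      have "has_pd (b, 0) (\<lambda>q. W q * (vr q * v b q))
        (W (y, s) * (vr (y, s) * pd (b, 0) (v b) (y, s) + pd (b, 0) vr (y, s) * v b (y, s)) +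
         (- 4 * m (y, s) * ((fst (y, s) - x0) \<bullet> b)) * (vr (y, s) * v b (y, s))) (y, s)"
        by (intro has_pd_mult W_b Ck_on_Suc_has_pd[OF Cv(1)] Ck_on_Suc_has_pd[OF Cv(2)] bas b) auto
      then show "has_pd b (F b) (F' b y) y" by (simp add: has_pd_def F_def F'_def)
    next
      fix y :: 'a assume "norm x0 + R \<le> norm y"
      then have "R \<le> norm (y - x0)" using norm_triangle_ineq2[of y x0] by simp
      from supp[OF this s] show "F b y = 0" by (simp add: F_def W_def)
    next
      show "continuous_on UNIV (F b)" unfolding F_def using b by (intro continuous_intros slice' cW cv)
    qed (rule cF'[OF b])
    then have "((\<lambda>x. \<Sum>b\<in>Basis. F' b x) has_integral (\<Sum>b\<in>(Basis::'a set). 0)) UNIV"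
      by (intro has_integral_sum) auto
    then have I0: "((\<lambda>x. \<Sum>b\<in>Basis. F' b x) has_integral 0) UNIV" by simp
    have eqB: "(\<lambda>x. \<Sum>b\<in>Basis. F' b x) = (\<lambda>x. if x \<in> B then \<Sum>b\<in>Basis. F' b x else 0)"
    proof
      fix x
      have "(\<Sum>b\<in>Basis. F' b x) = 0" if "x \<notin> B" using m0B[OF that s] by (simp add: F'_def W_def)
      then show "(\<Sum>b\<in>Basis. F' b x) = (if x \<in> B then \<Sum>b\<in>Basis. F' b x else 0)" by simp
    qed
    have F'0: "((\<lambda>x. \<Sum>b\<in>Basis. F' b x) has_integral 0) B"
      by (rule iffD1[OF has_integral_restrict_UNIV]) (subst eqB[symmetric], rule I0)
    have "((\<lambda>x. E' (x, s)) has_integral integral B (\<lambda>x. E' (x, s))) B"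
      unfolding B_def by (intro integrable_integral integrable_continuous) (use slice[OF cE'] in \<open>simp add: B_def\<close>)
    from has_integral_diff[OF this has_integral_mult_right[OF F'0, of 2]]
    have I: "((\<lambda>x. E' (x, s) - 2 * (\<Sum>b\<in>Basis. F' b x)) has_integral integral B (\<lambda>x. E' (x, s))) B" by simp
    have "E' (x, s) - 2 * (\<Sum>b\<in>Basis. F' b x) \<le> 0" for x
    proof -
      define q where "q = (x, s)"
      define g where "g = (\<Sum>b\<in>Basis. v b q *\<^sub>R b)"
      have gb: "g \<bullet> b = v b q" if "b \<in> Basis" for b using that by (simp add: g_def)
      have gg: "(norm g)\<^sup>2 = (\<Sum>b\<in>Basis. (v b q)\<^sup>2)"
        unfolding power2_norm_eq_inner euclidean_inner[of g g] by (rule sum.cong) (auto simp: gb power2_eq_square)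
      have zg: "(\<Sum>b\<in>Basis. ((x - x0) \<bullet> b) * v b q) = (x - x0) \<bullet> g"
        unfolding euclidean_inner[of "x - x0" g] by (rule sum.cong) (auto simp: gb)
      have "(\<Sum>b\<in>Basis. F' b x) = W q * (vr q * pd (0, 1) vr q + (\<Sum>b\<in>Basis. pd (b, 0) vr q * v b q)) - 4 * m q * vr q * ((x - x0) \<bullet> g)"
      proof -
        have "pd (0, 1) vr q = (\<Sum>b\<in>Basis. pd (b, 0) (v b) q)" unfolding vr_def v_def by (rule wave)
        then show ?thesis
          unfolding F'_def q_def[symmetric] zg[symmetric]
          by (simp add: sum.distrib sum_subtractf sum_distrib_left sum_negf distrib_left mult_ac)
      qed
      moreover have alg: "- 4 * c * d * e + w * (2 * u * p + 2 * S) - 2 * (w * (u * p + S) - 4 * c * u * A) =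
          - 4 * c * (d * e - 2 * u * A)" for c d e w u p S A :: real
        by (simp add: algebra_simps)
      moreover define S where "S = (\<Sum>b\<in>Basis. pd (b, 0) vr q * v b q)"
      moreover have "E' q = - 4 * m q * (R - s) * e q + W q * (2 * vr q * pd (0, 1) vr q + 2 * S)"
        unfolding E'_def S_def by (simp add: q_def sum_distrib_left mult_ac)
      moreover define A where "A = (x - x0) \<bullet> g"
      ultimately have "E' (x, s) - 2 * (\<Sum>b\<in>Basis. F' b x) = - 4 * m q * ((R - s) * e q - 2 * vr q * ((x - x0) \<bullet> g))"
        unfolding q_def[symmetric] A_def[symmetric] by (simp only:)
      moreover have "0 \<le> m q * ((R - s) * e q - 2 * vr q * ((x - x0) \<bullet> g))"
      \<comment> \<open>If m does not vanish at (x, s), this point lies inside the cone, so |x - x0|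
        \<le> R - s.\<close>
      proof (cases "m q = 0")
        case False
        then have "max 0 ((R - s)\<^sup>2 - (norm (x - x0))\<^sup>2) \<noteq> 0"
          by (simp only: m_def q_def fst_conv snd_conv power2_norm_eq_inner not_False_eq_True)
        then have "(norm (x - x0))\<^sup>2 \<le> (R - s)\<^sup>2" by linarith
        moreover have "0 \<le> R - s" using s by simp
        ultimately have n: "norm (x - x0) \<le> R - s" by (rule power2_le_imp_le)
        have "2 * vr q * ((x - x0) \<bullet> g) \<le> 2 * \<bar>vr q\<bar> * (norm (x - x0) * norm g)"
        proof -
          have "2 * vr q * ((x - x0) \<bullet> g) \<le> \<bar>2 * vr q * ((x - x0) \<bullet> g)\<bar>" by simp
          also have "\<dots> \<le> 2 * \<bar>vr q\<bar> * (norm (x - x0) * norm g)"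
            using Cauchy_Schwarz_ineq2[of "x - x0" g] by (simp add: abs_mult mult_left_mono)
          finally show ?thesis .
        qed
        also have "\<dots> = norm (x - x0) * (2 * \<bar>vr q\<bar> * norm g)" by simp
        also have "\<dots> \<le> norm (x - x0) * e q"
          using sum_squares_bound[of "\<bar>vr q\<bar>" "norm g"] by (intro mult_left_mono) (auto simp: e_def gg[symmetric])
        also have "\<dots> \<le> (R - s) * e q" using n e0 by (intro mult_right_mono) auto
        finally show ?thesis using m0[of q] by simp
      qed simp
      ultimately show ?thesis by simp
    qed
    then show ?thesis using has_integral_le[OF I has_integral_0, of] by simp
  qed
  have "E 0 = 0"
  proof -
    have "e (x, 0) = 0" for x using V1 vb0 by (simp add: e_def vr_def)
    then show ?thesis by (simp add: E_def)
  qed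
  have vr0: "vr (x0, s) = 0" if s: "0 \<le> s" "s \<le> r" for s
  proof -
    have "E s \<le> 0"
    proof -
      have "E s \<le> E 0" using s(1)
      proof (rule DERIV_nonpos_imp_decreasing_open)
        fix u assume u: "0 < u" "u < s"
        then have "(E has_real_derivative integral B (\<lambda>x. E' (x, u))) (at u)"
          using DE[of u] R s at_within_Icc_at[of 0 u R] by simp
        then show "\<exists>y. (E has_real_derivative y) (at u) \<and> y \<le> 0" using neg[of u] u R s by auto
      next
        have "continuous_on {0..R} E" using DE by (rule DERIV_continuous_on)
        then show "continuous_on {0..s} E" by (rule continuous_on_subset) (use R s in auto)
      qed
      then show ?thesis using \<open>E 0 = 0\<close> by simp
    qed
    moreover have We0: "0 \<le> W (x, s) * e (x, s)" for x using e0 by (simp add: W_def)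
    moreover have "E s \<ge> 0" unfolding E_def
      using slice[OF continuous_on_mult[OF cW ce], of s] We0 by (intro integral_nonneg) (auto simp: B_def intro: integrable_continuous)
    ultimately have "integral B (\<lambda>x. W (x, s) * e (x, s)) = 0" by (simp add: E_def)
    moreover have "box (x0 - R *\<^sub>R One) (x0 + R *\<^sub>R One) \<noteq> {}"
      using R by (simp add: box_ne_empty inner_diff_left inner_add_left)
    ultimately have "\<forall>x\<in>B. W (x, s) * e (x, s) = 0"
      using integral_cbox_eq_0_iff[of "x0 - R *\<^sub>R One" "x0 + R *\<^sub>R One" "\<lambda>x. W (x, s) * e (x, s)"]
        slice[OF continuous_on_mult[OF cW ce], of s] We0 unfolding B_def by blast
    then have "W (x0, s) * e (x0, s) = 0" using inB[of x0] R by simp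
    moreover have "W (x0, s) > 0" using s R by (simp add: W_def m_def max_def)
    ultimately have "e (x0, s) = 0" by simp
    moreover have "(\<Sum>b\<in>Basis. (v b (x0, s))\<^sup>2) \<ge> 0" by (intro sum_nonneg) auto
    ultimately have "(vr (x0, s))\<^sup>2 \<le> 0" unfolding e_def by linarith
    then show ?thesis by simp
  qed
  have DV: "((\<lambda>s. V (x0, s)) has_real_derivative vr (x0, s)) (at s)" for s
    using Ck_on_Suc_has_pd[OF C1 bas(2) UNIV_I, of "(x0, s)"] by (simp add: has_pd_snd_line vr_def)
  show ?thesis
  proof (cases "r = 0")
    case False
    have "V (x0, r) = V (x0, 0)"
    proof (rule DERIV_isconst_end[of 0 r "\<lambda>s. V (x0, s)"])
      show "continuous_on {0..r} (\<lambda>s. V (x0, s))"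
        using DV by (meson DERIV_continuous_on has_field_derivative_at_within)
      show "((\<lambda>s. V (x0, s)) has_real_derivative 0) (at s)" if "0 < s" "s < r" for s
        using DV[of s] vr0[of s] that by simp
    qed (use False r in auto)
    then show ?thesis using V0 by simp
  qed (use V0 in auto)
qed

lemma has_pd_reflect:
  assumes "has_pd (b, 0) g d (fst q, - snd q)" shows "has_pd (b, 0) (\<lambda>q. g (fst q, - snd q)) d q"
  using assms by (simp add: has_pd_def)

lemma has_pd_reflect_r:
  fixes g :: "'a::real_normed_vector \<times> real \<Rightarrow> real"
  assumes "has_pd (0, 1) g d (fst q, - snd q)" shows "has_pd (0, 1) (\<lambda>q. g (fst q, - snd q)) (- d) q"
proof (cases q)
  case (Pair x r)
  have 1: "((\<lambda>s. g (x, s)) has_real_derivative d) (at (- r))"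
    using assms Pair by (simp add: has_pd_snd_line)
  have 2: "((\<lambda>s. - s) has_real_derivative - 1) (at r)" by (auto intro!: derivative_eq_intros)
  from DERIV_chain2[where g="\<lambda>s. - s", OF 1 2] show ?thesis using Pair by (simp add: has_pd_snd_line)
qed

lemma Ck_on_reflect:
  fixes g :: "'a::euclidean_space \<times> real \<Rightarrow> real"
  assumes "Ck_on k UNIV g"
  shows "Ck_on k UNIV (\<lambda>q. g (fst q, - snd q))"
  using assms
proof (induction k arbitrary: g)
  case 0
  then show ?case unfolding Ck_on_0 by (rule continuous_on_compose2) (auto intro!: continuous_intros)
next
  case (Suc k)
  show ?case
  proof (rule Ck_on_pair_SucI)
    show "continuous_on UNIV (\<lambda>q. g (fst q, - snd q))"
      by (rule continuous_on_compose2[OF Ck_on_continuous[OF Suc.prems]]) (auto intro!: continuous_intros)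
    show "has_pd (b, 0) (\<lambda>q. g (fst q, - snd q)) (pd (b, 0) g (fst q, - snd q)) q" if "b \<in> Basis" for b q
      by (intro has_pd_reflect Ck_on_Suc_has_pd[OF Suc.prems] Basis_prodI that UNIV_I)
    show "has_pd (0, 1) (\<lambda>q. g (fst q, - snd q)) (- pd (0, 1) g (fst q, - snd q)) q" for q
      by (intro has_pd_reflect_r Ck_on_Suc_has_pd[OF Suc.prems] Basis_prodI UNIV_I)
    show "Ck_on k UNIV (\<lambda>q. pd (b, 0) g (fst q, - snd q))" if "b \<in> Basis" for b
      by (intro Suc.IH Ck_on_pd[OF Suc.prems] Basis_prodI that)
    have "Ck_on k UNIV (\<lambda>q. - 1 * pd (0, 1) g (fst q, - snd q))"
      by (intro Ck_on_cmult Suc.IH Ck_on_pd[OF Suc.prems] Basis_prodI open_UNIV)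
    then show "Ck_on k UNIV (\<lambda>q. - pd (0, 1) g (fst q, - snd q))" by simp
  qed simp
qed

text \<open>The wave equation is invariant under r \<mapsto> -r. \<open>wave_cauchy\<close>
  constrains v for all real r, so uniqueness has to reach negative r as well.\<close>

lemma wave_zero:
  fixes V :: "'a::euclidean_space \<times> real \<Rightarrow> real"
  assumes V: "Ck_on 2 UNIV V"
    and wave: "\<And>q. pd (0, 1) (pd (0, 1) V) q = (\<Sum>b\<in>Basis. pd (b, 0) (pd (b, 0) V) q)"
    and V0: "\<And>x. V (x, 0) = 0" and V1: "\<And>x. pd (0, 1) V (x, 0) = 0"
  shows "V q = 0"
proof (cases "snd q \<ge> 0")
  case True
  then show ?thesis using wave_zero_forward[OF assms, of "snd q" "fst q"] by simp
next
  case False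
  have C2: "Ck_on (Suc (Suc 0)) UNIV V" using V by (simp add: numeral_2_eq_2)
  note C1 = Ck_on_SucD[OF C2] and bas = Basis_prodI
  define S where "S = (\<lambda>q. V (fst q, - snd q))"
  have S_b: "pd (b, 0) S = (\<lambda>q. pd (b, 0) V (fst q, - snd q))" if "b \<in> Basis" for b
    unfolding S_def by (rule ext, rule has_pd_imp_pd, intro has_pd_reflect Ck_on_Suc_has_pd[OF C1] bas that UNIV_I)
  have S_r: "pd (0, 1) S = (\<lambda>q. - pd (0, 1) V (fst q, - snd q))"
    unfolding S_def by (rule ext, rule has_pd_imp_pd, intro has_pd_reflect_r Ck_on_Suc_has_pd[OF C1] bas UNIV_I)
  have S_bb: "pd (b, 0) (pd (b, 0) S) q = pd (b, 0) (pd (b, 0) V) (fst q, - snd q)" if "b \<in> Basis" for b q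
    unfolding S_b[OF that]
    by (rule has_pd_imp_pd, intro has_pd_reflect Ck_on_Suc_has_pd[OF Ck_on_pd[OF C2]] bas that UNIV_I)
  have "pd (0, 1) (\<lambda>q. - 1 * pd (0, 1) V (fst q, - snd q)) q = - 1 * (- pd (0, 1) (pd (0, 1) V) (fst q, - snd q))" for q
    by (rule has_pd_imp_pd, intro has_pd_cmult has_pd_reflect_r Ck_on_Suc_has_pd[OF Ck_on_pd[OF C2]] bas UNIV_I)
  then have S_rr: "pd (0, 1) (pd (0, 1) S) q = pd (0, 1) (pd (0, 1) V) (fst q, - snd q)" for q
    unfolding S_r by simp
  have "S (fst q, - snd q) = 0"
  proof (rule wave_zero_forward)
    show "Ck_on 2 UNIV S" unfolding S_def by (rule Ck_on_reflect[OF V])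
    show "pd (0, 1) (pd (0, 1) S) q = (\<Sum>b\<in>Basis. pd (b, 0) (pd (b, 0) S) q)" for q
      unfolding S_rr wave by (simp add: S_bb)
    show "S (x, 0) = 0" for x by (simp add: S_def V0)
    show "pd (0, 1) S (x, 0) = 0" for x by (simp add: S_r V1)
  qed (use False in simp)
  then show ?thesis by (simp add: S_def)
qed

lemma pd_diff:
  fixes g g' :: "'a::euclidean_space \<Rightarrow> real"
  assumes "Ck_on (Suc 0) UNIV g" "Ck_on (Suc 0) UNIV g'" "b \<in> Basis"
  shows "pd b (\<lambda>x. g x - g' x) = (\<lambda>x. pd b g x - pd b g' x)"
  by (rule ext, rule has_pd_imp_pd)
    (intro has_pd_diff Ck_on_Suc_has_pd[OF assms(1,3)] Ck_on_Suc_has_pd[OF assms(2,3)] UNIV_I)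

lemma wave_unique:
  fixes V V' :: "'a::euclidean_space \<times> real \<Rightarrow> real"
  assumes V: "Ck_on 2 UNIV V" and V': "Ck_on 2 UNIV V'"
    and wave: "\<And>q. pd (0, 1) (pd (0, 1) V) q = (\<Sum>b\<in>Basis. pd (b, 0) (pd (b, 0) V) q)"
    and wave': "\<And>q. pd (0, 1) (pd (0, 1) V') q = (\<Sum>b\<in>Basis. pd (b, 0) (pd (b, 0) V') q)"
    and eq0: "\<And>x. V (x, 0) = V' (x, 0)" and eq1: "\<And>x. pd (0, 1) V (x, 0) = pd (0, 1) V' (x, 0)"
  shows "V = V'"
proof
  fix q
  have C2: "Ck_on (Suc (Suc 0)) UNIV V" "Ck_on (Suc (Suc 0)) UNIV V'" using V V' by (simp_all add: numeral_2_eq_2)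
  note C1 = Ck_on_SucD[OF C2(1)] Ck_on_SucD[OF C2(2)]
  have 1: "pd b (\<lambda>q. V q - V' q) = (\<lambda>q. pd b V q - pd b V' q)" if "b \<in> Basis" for b
    by (rule pd_diff[OF C1 that])
  have 2: "pd b (pd b (\<lambda>q. V q - V' q)) = (\<lambda>q. pd b (pd b V) q - pd b (pd b V') q)" if "b \<in> Basis" for b
    unfolding 1[OF that] by (intro pd_diff Ck_on_pd[OF C2(1)] Ck_on_pd[OF C2(2)] that)
  have "V q - V' q = 0"
  proof (rule wave_zero[of "\<lambda>q. V q - V' q"])
    show "Ck_on 2 UNIV (\<lambda>q. V q - V' q)" by (intro Ck_on_diff V V' open_UNIV)
    show "pd (0, 1) (pd (0, 1) (\<lambda>q. V q - V' q)) q = (\<Sum>b\<in>Basis. pd (b, 0) (pd (b, 0) (\<lambda>q. V q - V' q)) q)" for q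
      unfolding 2[OF Basis_prodI(2)] wave wave' sum_subtractf[symmetric]
      by (rule sum.cong) (simp_all only: 2[OF Basis_prodI(1)])
  qed (simp_all add: 1 Basis_prodI eq0 eq1)
  then show "V q = V' q" by simp
qed

section \<open>Identification of \<open>wave_sol\<close> with an explicit solution\<close>

lemma sum_Basis_axis: "(\<Sum>b\<in>(Basis :: (real^'n::finite) set). g b) = (\<Sum>i\<in>UNIV. g (axis i 1))"
proof -
  have 1: "(Basis :: (real^'n) set) = (\<lambda>i. axis i 1) ` UNIV" by (auto simp: Basis_vec_def)
  have 2: "inj (\<lambda>i::'n. axis i (1::real))" by (auto simp: inj_def axis_eq_axis)
  show ?thesis unfolding 1 sum.reindex[OF 2] by simp
qed

lemma wave_sol_eqI:
  assumes "wave_cauchy h v" shows "wave_sol h = v"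
  unfolding wave_sol_def
proof (rule the_equality)
  show "wave_cauchy h v" by (rule assms)
  fix w assume w: "wave_cauchy h w"
  have "case_prod w = case_prod v"
    using assms w unfolding wave_cauchy_def tdir_def xdir_def
    by (intro wave_unique) (auto simp: sum_Basis_axis)
  then show "w = v" by (metis curry_case_prod)
qed

lemma lap_eq_sum_Basis: "lap g x = (\<Sum>b\<in>Basis. pd b (pd b g) x)"
  by (simp add: lap_def sum_Basis_axis)

section \<open>Wave propagators\<close>

text \<open>
  \<open>Z h\<close> and \<open>Zr h\<close> solve the wave equation with data \<open>(0, h)\<close> and \<open>(h, 0)\<close>, and \<open>N h\<close> is the primitive
  of \<open>r Z h\<close>; all of them are defined for negative \<open>r\<close> as well.
\<close>

locale wave_operators =
  fixes k :: nat and U Z Zr Zrr N :: "('a::euclidean_space \<Rightarrow> real) \<Rightarrow> 'a \<times> real \<Rightarrow> real"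
  assumes U: "mean_operator k U" and Z: "mean_operator k Z" and Zr: "mean_operator (k + 1) Zr" and Zrr: "mean_operator (k + 2) Zrr" and N: "mean_operator k N"
    and Z_U: "\<And>h q. Z h q = snd q * U h q"
    and Z_r: "\<And>h q. Ck_on (k + 1) UNIV h \<Longrightarrow> has_pd (0, 1) (Z h) (Zr h q) q"
    and Zr_r: "\<And>h q. Ck_on (k + 2) UNIV h \<Longrightarrow> has_pd (0, 1) (Zr h) (Zrr h q) q"
    and N_r: "\<And>h q. Ck_on k UNIV h \<Longrightarrow> has_pd (0, 1) (N h) (snd q * Z h q) q"
    and N_0: "\<And>h x. Ck_on k UNIV h \<Longrightarrow> N h (x, 0) = 0"
    and Zr_0: "\<And>h x. Ck_on (k + 2) UNIV h \<Longrightarrow> Zr h (x, 0) = h x"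
    and lap_Z: "\<And>h q. Ck_on (k + 2) UNIV h \<Longrightarrow> (\<Sum>b\<in>Basis. Z (pd b (pd b h)) q) = Zrr h q"
    and lap_N: "\<And>h q. Ck_on (k + 2) UNIV h \<Longrightarrow> (\<Sum>b\<in>Basis. N (pd b (pd b h)) q) = snd q * Zr h q - Z h q"
    and Zr_wave: "\<And>h q. Ck_on (k + 3) UNIV h \<Longrightarrow>
      pd (0, 1) (pd (0, 1) (Zr h)) q = (\<Sum>b\<in>Basis. pd (b, 0) (pd (b, 0) (Zr h)) q)"
    and Zr_r_0: "\<And>h x. Ck_on (k + 3) UNIV h \<Longrightarrow> pd (0, 1) (Zr h) (x, 0) = 0"

text \<open>Differentiating the wave equation of Z = r U in r gives that of \<open>Zr\<close>, and
  Z_rr = \<Delta>Z at r = 0 gives its zero initial velocity. \<open>lap_Z\<close> and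
  \<open>lap_N\<close> express Laplacians by r-derivatives, the form in which they meet the time
  derivatives of the Duhamel integrals. \<open>U\<close> stays visible because the factor r in
  \<open>Z\<close> is used again for the limit at t = 0.\<close>

lemma ex_wave_operators:
  fixes k :: nat
  defines "k \<equiv> DIM('a::euclidean_space) div 2"
  shows "\<exists>U Z Zr Zrr N :: ('a \<Rightarrow> real) \<Rightarrow> 'a \<times> real \<Rightarrow> real. wave_operators k U Z Zr Zrr N"
proof -
  obtain U :: "('a \<Rightarrow> real) \<Rightarrow> 'a \<times> real \<Rightarrow> real" where U: "mean_operator k U"
    and U0: "\<And>h x. Ck_on (k + 2) UNIV h \<Longrightarrow> U h (x, 0) = h x"
    and wave: "\<And>h q. Ck_on (k + 2) UNIV h \<Longrightarrow> pd (0, 1) (pd (0, 1) (\<lambda>q. snd q * U h q)) q =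
        (\<Sum>b\<in>Basis. pd (b, 0) (pd (b, 0) (\<lambda>q. snd q * U h q)) q)"
    using ex_wave_mean_operator[where 'a='a] unfolding k_def by blast
  define Z where "Z = (\<lambda>h q. snd q * U h q)"
  have waveZ: "pd (0, 1) (pd (0, 1) (Z h)) q = (\<Sum>b\<in>Basis. pd (b, 0) (pd (b, 0) (Z h)) q)"
    if "Ck_on (k + 2) UNIV h" for h q
    unfolding Z_def by (rule wave[OF that])
  have Z: "mean_operator k Z" unfolding Z_def by (rule mean_operator_times_r[OF U])
  obtain Zr where Zr: "mean_operator (Suc k) Zr" "\<And>h p. Ck_on (Suc k) UNIV h \<Longrightarrow> has_pd (0, 1) (Z h) (Zr h p) p"
    using mean_operator_has_pd_r[OF Z] by blast
  obtain Zrr where Zrr: "mean_operator (Suc (Suc k)) Zrr" "\<And>h p. Ck_on (Suc (Suc k)) UNIV h \<Longrightarrow> has_pd (0, 1) (Zr h) (Zrr h p) p"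
    using mean_operator_has_pd_r[OF Zr(1)] by blast
  obtain N where N: "mean_operator k N" "\<And>h x. Ck_on k UNIV h \<Longrightarrow> N h (x, 0) = 0"
     "\<And>h p. Ck_on k UNIV h \<Longrightarrow> has_pd (0, 1) (N h) (snd p * Z h p) p"
    using mean_operator_antiderivative[OF Z] by blast
  obtain Ur where Ur: "\<And>h p. Ck_on (Suc k) UNIV h \<Longrightarrow> has_pd (0, 1) (U h) (Ur h p) p"
    using mean_operator_has_pd_r[OF U] by blast
  have pdZ: "pd (0, 1) (Z h) = Zr h" if "Ck_on (Suc k) UNIV h" for h
    using has_pd_imp_pd[OF Zr(2)[OF that]] by auto
  have pdZr: "pd (0, 1) (Zr h) = Zrr h" if "Ck_on (Suc (Suc k)) UNIV h" for h
    using has_pd_imp_pd[OF Zrr(2)[OF that]] by auto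
  have bb: "pd (b, 0) (pd (b, 0) (T h)) q = T (pd b (pd b h)) q"
    if "mean_operator m T" "b \<in> Basis" "Ck_on (Suc (Suc m)) UNIV h" for m T b h q
  proof -
    have "pd (b, 0) (T h) = T (pd b h)"
      using has_pd_imp_pd[OF mean_operator_has_pd_x[OF that(1,2) Ck_on_SucD[OF that(3)]]] by auto
    then show ?thesis
      using has_pd_imp_pd[OF mean_operator_has_pd_x[OF that(1,2) Ck_on_pd[OF that(3,2)]]] by simp
  qed
  have lapZ: "(\<Sum>b\<in>Basis. Z (pd b (pd b h)) q) = Zrr h q" if h: "Ck_on (k + 2) UNIV h" for h q
  proof -
    have h': "Ck_on (Suc (Suc k)) UNIV h" using h by simp
    have "(\<Sum>b\<in>Basis. Z (pd b (pd b h)) q) = (\<Sum>b\<in>Basis. pd (b, 0) (pd (b, 0) (Z h)) q)"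
      by (intro sum.cong refl bb[OF Z _ h', symmetric])
    also have "\<dots> = pd (0, 1) (pd (0, 1) (Z h)) q"
      by (rule waveZ[OF h, symmetric])
    finally show ?thesis using pdZ[OF Ck_on_SucD[OF h']] pdZr[OF h'] by simp
  qed
  have Zr0: "Zr h (x, 0) = h x" if h: "Ck_on (k + 2) UNIV h" for h x
  proof -
    have h': "Ck_on (Suc k) UNIV h" using h by (auto elim: Ck_on_mono)
    have "has_pd (0, 1) snd 1 (x, 0)" using has_pd_snd[of "\<lambda>x. x" 1 "(x, 0)"] by simp
    from has_pd_imp_pd[OF has_pd_mult[OF this Ur[OF h']]] pdZ[OF h'] U0[OF h]
    show ?thesis by (simp add: Z_def)
  qed
  have lapN: "(\<Sum>b\<in>Basis. N (pd b (pd b h)) q) = snd q * Zr h q - Z h q" if h: "Ck_on (k + 2) UNIV h" for h q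
  proof -
    obtain x r where q: "q = (x, r)" by fastforce
    have h': "Ck_on (Suc (Suc k)) UNIV h" using h by simp
    have hb: "Ck_on k UNIV (pd b (pd b h))" if "b \<in> Basis" for b
      by (intro Ck_on_pd[OF Ck_on_pd[OF h']] that)
    \<comment> \<open>Both sides of the claim vanish at r = 0, and their r-derivatives are r times
      the sum of the \<open>Z (pd b (pd b h))\<close> and r \<open>Zrr h\<close>, equal by
      \<open>lapZ\<close>.\<close>
    define D where "D = (\<lambda>q. (\<Sum>b\<in>Basis. N (pd b (pd b h)) q) - (snd q * Zr h q - Z h q))"
    have "has_pd (0, 1) D 0 q" for q
    proof -
      have hsnd: "has_pd (0, 1) snd 1 q" using has_pd_snd[of "\<lambda>x. x" 1 q] by simp
      have "has_pd (0, 1) D ((\<Sum>b\<in>Basis. snd q * Z (pd b (pd b h)) q) - ((snd q * Zrr h q + 1 * Zr h q) - Zr h q)) q"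
        unfolding D_def
        by (intro has_pd_diff has_pd_sum has_pd_mult hsnd Zr(2) Zrr(2) h' Ck_on_SucD[OF h'] N(3)[OF hb]) auto
      then show ?thesis using lapZ[OF h, of q] by (simp add: sum_distrib_left[symmetric])
    qed
    then have "D (x, r) = D (x, 0)"
      using DERIV_const_ratio_const[of r 0 "\<lambda>s. D (x, s)" 0] by (cases "r = 0") (auto simp: has_pd_snd_line)
    moreover have "D (x, 0) = 0" using N(2)[OF hb] by (simp add: D_def Z_def)
    ultimately show ?thesis by (simp add: q D_def)
  qed
  have w: "pd (0, 1) (pd (0, 1) (Zr h)) q = (\<Sum>b\<in>Basis. pd (b, 0) (pd (b, 0) (Zr h)) q)"
    if h: "Ck_on (k + 3) UNIV h" for h q
  proof -
    have h': "Ck_on (k + 2) UNIV h" "Ck_on (Suc (Suc k)) UNIV h" "Ck_on (Suc k) UNIV h"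
      using h by (auto elim: Ck_on_mono)
    have "pd (0, 1) (Zr h) = (\<lambda>q. \<Sum>b\<in>Basis. pd (b, 0) (pd (b, 0) (Z h)) q)"
      using waveZ[OF h'(1)] unfolding pdZ[OF h'(3)] by (rule ext)
    then have "pd (0, 1) (pd (0, 1) (Zr h)) q = (\<Sum>b\<in>Basis. pd (b, 0) (pd (b, 0) (pd (0, 1) (Z h))) q)"
      using has_pd_imp_pd[OF has_pd_lap[OF mean_operator_Ck[OF Z h]]] by simp
    then show ?thesis unfolding pdZ[OF h'(3)] .
  qed
  have w0: "pd (0, 1) (Zr h) (x, 0) = 0" if h: "Ck_on (k + 3) UNIV h" for h x
  proof -
    have h': "Ck_on (k + 2) UNIV h" "Ck_on (Suc (Suc k)) UNIV h"
      using h by (auto elim: Ck_on_mono)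
    show ?thesis using pdZr[OF h'(2)] lapZ[OF h'(1), of "(x, 0)"] by (simp add: Z_def)
  qed
  have "wave_operators k U Z Zr Zrr N"
  proof
    show "mean_operator (k + 1) Zr" "mean_operator (k + 2) Zrr" using Zr Zrr by simp_all
    show "has_pd (0, 1) (Z h) (Zr h q) q" if "Ck_on (k + 1) UNIV h" for h q using Zr(2) that by simp
    show "has_pd (0, 1) (Zr h) (Zrr h q) q" if "Ck_on (k + 2) UNIV h" for h q using Zrr(2) that by simp
    show "has_pd (0, 1) (N h) (snd q * Z h q) q" if "Ck_on k UNIV h" for h q using N(3)[OF that] .
    show "N h (x, 0) = 0" if "Ck_on k UNIV h" for h x using N(2)[OF that] .
  qed (use U Z N lapZ lapN Zr0 w w0 in \<open>auto simp: Z_def\<close>)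
  then show ?thesis by blast
qed

section \<open>Parameter integrals with a power singularity at 0\<close>

lemma integrable_powr_dominated:
  fixes f :: "real \<Rightarrow> real"
  assumes \<delta>: "\<delta> > 0" and c: "c \<ge> 0" and f: "continuous_on {0<..c} f"
    and b: "\<And>l. 0 < l \<Longrightarrow> l \<le> c \<Longrightarrow> \<bar>f l\<bar> \<le> C * l powr (\<delta> - 1)"
  shows "f integrable_on {0..c}" "\<bar>integral {0..c} f\<bar> \<le> C * (c powr \<delta> / \<delta>)"
proof -
  have p: "(\<lambda>l. l powr (\<delta> - 1)) integrable_on {0<..c}"
    using integrable_on_powr_from_0'[of "\<delta> - 1" c] \<delta> c by simp
  have pI: "((\<lambda>l. l powr (\<delta> - 1)) has_integral (c powr \<delta> / \<delta>)) {0..c}"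
    using has_integral_powr_from_0[of "\<delta> - 1" c] \<delta> c by simp
  have 1: "f integrable_on {0<..c}"
  proof (rule measurable_bounded_by_integrable_imp_integrable)
    show "f \<in> borel_measurable (lebesgue_on {0<..c})"
      by (rule continuous_imp_measurable_on_sets_lebesgue[OF f]) simp
    show "(\<lambda>l. C * l powr (\<delta> - 1)) integrable_on {0<..c}" using p by (rule integrable_on_mult_right)
    show "norm (f l) \<le> C * l powr (\<delta> - 1)" if "l \<in> {0<..c}" for l using b that by simp
  qed simp
  \<comment> \<open>Continuity is given on {0<..c}; the arbitrary value at 0 sits on a null
    set.\<close>
  have neg: "negligible {x \<in> {0<..c} - {0..c}. f x \<noteq> 0}" "negligible {x \<in> {0..c} - {0<..c}. f x \<noteq> 0}"
    by (rule negligible_subset[of "{0}"], simp, force)+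
  show i: "f integrable_on {0..c}" by (rule integrable_spike_set[OF 1 neg])
  \<comment> \<open>\<open>0 powr (\<delta> - 1)\<close> is 0, so at l = 0 the majorant need not
    dominate f; f is replaced by 0 there.\<close>
  have "norm (integral {0..c} (\<lambda>l. if l = 0 then 0 else f l)) \<le> integral {0..c} (\<lambda>l. C * l powr (\<delta> - 1))"
  proof (rule integral_norm_bound_integral)
    show "(\<lambda>l. if l = 0 then 0 else f l) integrable_on {0..c}"
      by (rule integrable_spike[OF i, of "{0}"]) auto
    show "(\<lambda>l. C * l powr (\<delta> - 1)) integrable_on {0..c}" using pI by (intro integrable_on_mult_right) (auto simp: integrable_on_def)
    show "norm (if l = 0 then 0 else f l) \<le> C * l powr (\<delta> - 1)" if "l \<in> {0..c}" for l using b[of l] that by auto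
  qed
  moreover have "integral {0..c} (\<lambda>l. if l = 0 then 0 else f l) = integral {0..c} f"
    by (rule integral_spike[of "{0}"]) auto
  ultimately show "\<bar>integral {0..c} f\<bar> \<le> C * (c powr \<delta> / \<delta>)" using integral_unique[OF pI] by simp
qed

text \<open>By the mean value theorem the bound on \<kappa>' also bounds the difference quotients in
  s, so dominated convergence applies along every sequence of increments tending to 0.\<close>

lemma DERIV_integral_dominated:
  fixes \<kappa> \<kappa>' :: "real \<Rightarrow> real \<Rightarrow> real"
  assumes \<delta>: "\<delta> > 0" and c: "c \<ge> 0" and d: "d > 0"
    and \<kappa>: "\<And>s. \<bar>s - s0\<bar> < d \<Longrightarrow> (\<kappa> s) integrable_on {0..c}"
    and D: "\<And>s l. \<bar>s - s0\<bar> < d \<Longrightarrow> 0 < l \<Longrightarrow> l \<le> c \<Longrightarrow> ((\<lambda>s. \<kappa> s l) has_real_derivative \<kappa>' s l) (at s)"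
    and b: "\<And>s l. \<bar>s - s0\<bar> < d \<Longrightarrow> 0 < l \<Longrightarrow> l \<le> c \<Longrightarrow> \<bar>\<kappa>' s l\<bar> \<le> C * l powr (\<delta> - 1)"
  shows "((\<lambda>s. integral {0..c} (\<kappa> s)) has_real_derivative integral {0..c} (\<kappa>' s0)) (at s0)"
proof -
  have spike: "integral {0..c} f = integral {0..c} (\<lambda>l. if l = 0 then 0 else f l)" for f :: "real \<Rightarrow> real"
    by (rule integral_spike[of "{0}"]) auto
  have "((\<lambda>h. (integral {0..c} (\<kappa> (s0 + h)) - integral {0..c} (\<kappa> s0)) / h) \<longlongrightarrow> integral {0..c} (\<kappa>' s0)) (at 0 within {-d<..<d})"
    unfolding tendsto_at_iff_sequentially
  proof (intro allI impI)
    fix h :: "nat \<Rightarrow> real" assume h: "\<forall>i. h i \<in> {- d<..<d} - {0}" and h0: "h \<longlonglongrightarrow> 0"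
    have hi: "\<bar>h i\<bar> < d" "h i \<noteq> 0" for i using h by (auto simp: abs_less_iff dest: spec[of _ i])
    have "(\<lambda>i. integral {0..c} (\<lambda>l. if l = 0 then 0 else (\<kappa> (s0 + h i) l - \<kappa> s0 l) / h i)) \<longlonglongrightarrow>
      integral {0..c} (\<lambda>l. if l = 0 then 0 else \<kappa>' s0 l)"
    proof (rule dominated_convergence(2)[where h="\<lambda>l. C * l powr (\<delta> - 1)"])
      fix i
      have "(\<lambda>l. (\<kappa> (s0 + h i) l - \<kappa> s0 l) / h i) integrable_on {0..c}"
        using hi d by (intro integrable_on_divide integrable_diff \<kappa>) auto
      then show "(\<lambda>l. if l = 0 then 0 else (\<kappa> (s0 + h i) l - \<kappa> s0 l) / h i) integrable_on {0..c}"
        by (rule integrable_spike[of _ _ "{0}"]) auto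
    next
      show "(\<lambda>l. C * l powr (\<delta> - 1)) integrable_on {0..c}"
        using has_integral_powr_from_0[of "\<delta> - 1" c] \<delta> c by (intro integrable_on_mult_right) (auto simp: integrable_on_def)
    next
      fix i l assume l: "l \<in> {0..c}"
      show "norm (if l = 0 then 0 else (\<kappa> (s0 + h i) l - \<kappa> s0 l) / h i) \<le> C * l powr (\<delta> - 1)"
      proof (cases "l = 0")
        case False
        have "norm (\<kappa> (s0 + h i) l - \<kappa> s0 l) \<le> C * l powr (\<delta> - 1) * norm (s0 + h i - s0)"
        proof (rule field_differentiable_bound[of "closed_segment s0 (s0 + h i)" "\<lambda>s. \<kappa> s l" "\<lambda>s. \<kappa>' s l"])
          fix s assume "s \<in> closed_segment s0 (s0 + h i)"
          then have "\<bar>s - s0\<bar> < d" using hi[of i] by (auto simp: closed_segment_eq_real_ivl split: if_splits)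
          then show "((\<lambda>s. \<kappa> s l) has_field_derivative \<kappa>' s l) (at s within closed_segment s0 (s0 + h i))"
            and "norm (\<kappa>' s l) \<le> C * l powr (\<delta> - 1)"
            using D[of s l] b[of s l] l False by (auto intro: has_field_derivative_at_within)
        qed auto
        then show ?thesis using False hi[of i] by (simp add: divide_le_eq abs_mult)
      qed simp
    next
      fix l assume l: "l \<in> {0..c}"
      show "(\<lambda>i. if l = 0 then 0 else (\<kappa> (s0 + h i) l - \<kappa> s0 l) / h i) \<longlonglongrightarrow> (if l = 0 then 0 else \<kappa>' s0 l)"
      proof (cases "l = 0")
        case False
        have "((\<lambda>h. (\<kappa> (s0 + h) l - \<kappa> s0 l) / h) \<longlongrightarrow> \<kappa>' s0 l) (at 0)"
          using D[of s0 l] l False d by (simp add: DERIV_def)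
        from filterlim_compose[OF this, of h sequentially]
        show ?thesis using False h0 hi by (auto simp: filterlim_at)
      qed simp
    qed
    moreover have "integral {0..c} (\<lambda>l. if l = 0 then 0 else (\<kappa> (s0 + h i) l - \<kappa> s0 l) / h i) =
       (integral {0..c} (\<kappa> (s0 + h i)) - integral {0..c} (\<kappa> s0)) / h i" for i
    proof -
      have "integral {0..c} (\<lambda>l. (\<kappa> (s0 + h i) l - \<kappa> s0 l) / h i) = (integral {0..c} (\<kappa> (s0 + h i)) - integral {0..c} (\<kappa> s0)) / h i"
        using hi d by (subst integral_divide, subst integral_diff) (auto intro!: \<kappa>)
      then show ?thesis unfolding spike[of "\<lambda>l. (\<kappa> (s0 + h i) l - \<kappa> s0 l) / h i"] .
    qed
    ultimately show "((\<lambda>h. (integral {0..c} (\<kappa> (s0 + h)) - integral {0..c} (\<kappa> s0)) / h) \<circ> h) \<longlonglongrightarrow> integral {0..c} (\<kappa>' s0)"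
      unfolding spike[of "\<kappa>' s0"] by (simp add: o_def)
  qed
  moreover have "at 0 within {-d<..<d} = at (0::real)"
    by (rule at_within_open) (use d in auto)
  ultimately show ?thesis unfolding DERIV_def by (simp only:)
qed

text \<open>The integral over [0, s] is the one over the fixed interval [0, t], handled by
  domination, plus the oriented one from t to s, whose derivative at s = t is \<kappa> t t by
  continuity. For s < t this evaluates the kernel at l > s.\<close>

lemma DERIV_integral_diagonal:
  fixes \<kappa> \<kappa>' :: "real \<Rightarrow> real \<Rightarrow> real"
  assumes \<delta>: "\<delta> > 0" and a: "0 \<le> a" and t: "a < t" "t < c"
    and \<kappa>c: "continuous_on ({a<..<c} \<times> {0<..<c}) (\<lambda>(s, l). \<kappa> s l)"
    and \<kappa>b: "\<And>s l. a < s \<Longrightarrow> s < c \<Longrightarrow> 0 < l \<Longrightarrow> l < c \<Longrightarrow> \<bar>\<kappa> s l\<bar> \<le> C * l powr (\<delta> - 1)"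
    and D: "\<And>s l. a < s \<Longrightarrow> s < c \<Longrightarrow> 0 < l \<Longrightarrow> l < c \<Longrightarrow> ((\<lambda>s. \<kappa> s l) has_real_derivative \<kappa>' s l) (at s)"
    and b: "\<And>s l. a < s \<Longrightarrow> s < c \<Longrightarrow> 0 < l \<Longrightarrow> l < c \<Longrightarrow> \<bar>\<kappa>' s l\<bar> \<le> C * l powr (\<delta> - 1)"
  shows "((\<lambda>s. integral {0..s} (\<kappa> s)) has_real_derivative \<kappa> t t + integral {0..t} (\<kappa>' t)) (at t)"
proof -
  define d where "d = min (t - a) (c - t)"
  have d: "d > 0" using t by (simp add: d_def)
  have t0: "0 < t" using a t by simp
  have dr: "a < s" "s < c" if "\<bar>s - t\<bar> < d" for s using that by (auto simp: d_def abs_less_iff)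
  have \<kappa>s: "continuous_on {0<..<c} (\<kappa> s)" if "a < s" "s < c" for s
    by (rule continuous_on_compose2[OF \<kappa>c, of "{0<..<c}" "\<lambda>l. (s, l)", simplified])
      (use that in \<open>auto intro!: continuous_intros\<close>)
  have int: "\<kappa> s integrable_on {0..u}" if "a < s" "s < c" "0 \<le> u" "u < c" for s u
    by (rule integrable_powr_dominated(1)[OF \<delta> that(3) continuous_on_subset[OF \<kappa>s], where C=C]) (use that \<kappa>b[of s] in auto)
  have A: "((\<lambda>s. integral {0..t} (\<kappa> s)) has_real_derivative integral {0..t} (\<kappa>' t)) (at t)"
  proof (rule DERIV_integral_dominated[OF \<delta> _ d, where C=C])
    fix s assume "\<bar>s - t\<bar> < d"
    note s = dr[OF this]
    show "\<kappa> s integrable_on {0..t}" using int[OF s, of t] t t0 by simp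
    fix l :: real assume l: "0 < l" "l \<le> t"
    then have "l < c" using t by simp
    then show "((\<lambda>s. \<kappa> s l) has_real_derivative \<kappa>' s l) (at s)" "\<bar>\<kappa>' s l\<bar> \<le> C * l powr (\<delta> - 1)"
      using D[OF s l(1)] b[OF s l(1)] by simp_all
  qed (use t0 in simp)
  \<comment> \<open>The moving end: on the short interval between t and s the kernel differs from
    \<kappa> t t by at most e.\<close>
  have B: "((\<lambda>s. integral {0..s} (\<kappa> s) - integral {0..t} (\<kappa> s)) has_real_derivative \<kappa> t t) (at t)"
    unfolding has_field_derivative_def has_derivative_at_alt
  proof (intro conjI allI impI)
    show "bounded_linear ((*) (\<kappa> t t))" by (rule bounded_linear_mult_right)
    fix e :: real assume e: "0 < e"
    have "open ({a<..<c} \<times> {0<..<c})" by (intro open_Times) auto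
    then have "isCont (\<lambda>(s, l). \<kappa> s l) (t, t)"
      using \<kappa>c t t0 continuous_on_eq_continuous_at[of "{a<..<c} \<times> {0<..<c}" "\<lambda>(s, l). \<kappa> s l"] by auto
    then obtain d' where d': "d' > 0" "\<And>q. dist q (t, t) < d' \<Longrightarrow> dist (case q of (s, l) \<Rightarrow> \<kappa> s l) (\<kappa> t t) < e"
      using e unfolding continuous_at_eps_delta by fastforce
    have close: "\<bar>\<kappa> s l - \<kappa> t t\<bar> \<le> e" if "\<bar>s - t\<bar> < d' / 2" "\<bar>l - t\<bar> < d' / 2" for s l
    proof -
      have "dist (s, l) (t, t) \<le> dist s t + dist l t"
        unfolding dist_Pair_Pair by (rule sqrt_sum_squares_le_sum) auto
      then have "dist (s, l) (t, t) < d'" using that by (simp add: dist_real_def)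
      from d'(2)[OF this] show ?thesis by (simp add: dist_real_def)
    qed
    show "\<exists>d>0. \<forall>s. norm (s - t) < d \<longrightarrow> norm (integral {0..s} (\<kappa> s) - integral {0..t} (\<kappa> s) -
       (integral {0..t} (\<kappa> t) - integral {0..t} (\<kappa> t)) - \<kappa> t t * (s - t)) \<le> e * norm (s - t)"
    proof (intro exI[of _ "min d (d' / 2)"] conjI allI impI)
      show "0 < min d (d' / 2)" using d d' by simp
      fix s assume s: "norm (s - t) < min d (d' / 2)"
      then have s0: "a < s" "s < c" "0 < s" using dr[of s] a by auto
      have bd: "\<bar>integral {u..v} (\<kappa> s) - (v - u) * \<kappa> t t\<bar> \<le> e * (v - u)"
        if uv: "u \<le> v" "0 < u" "v < c" and near: "\<And>l. l \<in> {u..v} \<Longrightarrow> \<bar>l - t\<bar> < d' / 2" for u v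
      proof -
        have i: "\<kappa> s integrable_on {u..v}"
          by (intro integrable_continuous_real continuous_on_subset[OF \<kappa>s[OF s0(1,2)]]) (use uv in auto)
        have "norm (integral {u..v} (\<lambda>l. \<kappa> s l - \<kappa> t t)) \<le> integral {u..v} (\<lambda>l. e)"
          by (rule integral_norm_bound_integral) (use i s near close in \<open>auto intro!: integrable_diff\<close>)
        moreover have "integral {u..v} (\<lambda>l. \<kappa> s l - \<kappa> t t) = integral {u..v} (\<kappa> s) - (v - u) * \<kappa> t t"
          using i uv by (subst integral_diff) auto
        ultimately show ?thesis using uv by (simp add: mult.commute)
      qed
      show "norm (integral {0..s} (\<kappa> s) - integral {0..t} (\<kappa> s) -
       (integral {0..t} (\<kappa> t) - integral {0..t} (\<kappa> t)) - \<kappa> t t * (s - t)) \<le> e * norm (s - t)"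
      proof (cases "t \<le> s")
        case True
        have "integral {0..t} (\<kappa> s) + integral {t..s} (\<kappa> s) = integral {0..s} (\<kappa> s)"
          by (rule Henstock_Kurzweil_Integration.integral_combine) (use True t t0 s0 int in auto)
        moreover have "\<bar>integral {t..s} (\<kappa> s) - (s - t) * \<kappa> t t\<bar> \<le> e * (s - t)"
          by (rule bd) (use True t t0 s s0 in auto)
        ultimately show ?thesis using True by (simp add: mult.commute)
      next
        case False
        have "integral {0..s} (\<kappa> s) + integral {s..t} (\<kappa> s) = integral {0..t} (\<kappa> s)"
          by (rule Henstock_Kurzweil_Integration.integral_combine) (use False t t0 s0 int in auto)
        then have "integral {0..s} (\<kappa> s) - integral {0..t} (\<kappa> s) - (integral {0..t} (\<kappa> t) - integral {0..t} (\<kappa> t)) - \<kappa> t t * (s - t)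
           = - (integral {s..t} (\<kappa> s) - (t - s) * \<kappa> t t)" by (simp add: algebra_simps)
        moreover have "\<bar>integral {s..t} (\<kappa> s) - (t - s) * \<kappa> t t\<bar> \<le> e * (t - s)"
          by (rule bd) (use False t t0 s s0 in auto)
        ultimately show ?thesis using False by (simp only: real_norm_def abs_minus_cancel) simp
      qed
    qed
  qed
  from DERIV_add[OF B A] show ?thesis by simp
qed

section \<open>Duhamel integrals with an integrable singularity\<close>

lemma DERIV_phi: "t > 0 \<Longrightarrow> (phi has_real_derivative t powr (- 2/3)) (at t)"
  unfolding phi_def by (auto intro!: derivative_eq_intros)

lemma phi_mono: "0 \<le> s \<Longrightarrow> s \<le> t \<Longrightarrow> phi s \<le> phi t"
  unfolding phi_def by (simp add: powr_mono2)

lemma phi_nonneg: "phi t \<ge> 0" and phi_pos: "t > 0 \<Longrightarrow> phi t > 0"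
  by (simp_all add: phi_def)

lemma continuous_on_phi: "continuous_on {0<..} phi"
  unfolding phi_def by (intro continuous_intros) auto

text \<open>This makes the powers of t in the equation rational in \<phi>, so that the final
  identities are pure field arithmetic. The 9 is cancelled by the 1/9 in \<open>w\<close>.\<close>

lemma phi_deriv_eq: "t > 0 \<Longrightarrow> t powr (- 2/3) = 9 / (phi t)\<^sup>2"
  by (simp add: phi_def power_mult_distrib powr_minus divide_simps power2_eq_square flip: powr_add)

text \<open>The singularity l^(\<delta>-1) is integrable at l = 0. The bounds are local in z and
  hold up to any finite time c: by finite propagation this suffices, and it allows the part with
  \<Delta>f0 to be controlled by continuity on balls.\<close>

locale source_family =
  fixes g :: "real \<Rightarrow> 'a::euclidean_space \<Rightarrow> real" and K :: nat and \<delta> :: real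
  assumes \<delta>: "\<delta> > 0"
    and Ck: "\<And>l. l > 0 \<Longrightarrow> Ck_on K UNIV (g l)"
    and cont: "\<And>\<gamma>. set \<gamma> \<subseteq> Basis \<Longrightarrow> length \<gamma> \<le> K \<Longrightarrow>
      continuous_on ({0<..} \<times> UNIV) (\<lambda>(l, z). iter_pd \<gamma> (g l) z)"
    and bound1: "\<And>\<gamma> \<rho> c. set \<gamma> \<subseteq> Basis \<Longrightarrow> length \<gamma> \<le> K \<Longrightarrow>
      \<exists>C. \<forall>l z. 0 < l \<longrightarrow> l \<le> c \<longrightarrow> norm z \<le> \<rho> \<longrightarrow> \<bar>iter_pd \<gamma> (g l) z\<bar> \<le> C * l powr (\<delta> - 1)"
begin

text \<open>There are finitely many \<gamma> of length at most K, so their constants can be summed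
  into one; \<open>mean_operator_bound\<close> asks for a bound common to all of them.\<close>

lemma bound: "\<exists>C\<ge>0. \<forall>\<gamma> l z. set \<gamma> \<subseteq> Basis \<longrightarrow> length \<gamma> \<le> K \<longrightarrow> 0 < l \<longrightarrow> l \<le> c \<longrightarrow> norm z \<le> \<rho> \<longrightarrow>
      \<bar>iter_pd \<gamma> (g l) z\<bar> \<le> C * l powr (\<delta> - 1)"
proof -
  define A where "A = {\<gamma> :: 'a list. set \<gamma> \<subseteq> Basis \<and> length \<gamma> \<le> K}"
  have A: "finite A" unfolding A_def by (rule finite_lists_length_le) simp
  have "\<forall>\<gamma>\<in>A. \<exists>C. \<forall>l z. 0 < l \<longrightarrow> l \<le> c \<longrightarrow> norm z \<le> \<rho> \<longrightarrow> \<bar>iter_pd \<gamma> (g l) z\<bar> \<le> C * l powr (\<delta> - 1)"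
    using bound1 by (auto simp: A_def)
  from bchoice[OF this] obtain C where
    C: "\<forall>\<gamma>\<in>A. \<forall>l z. 0 < l \<longrightarrow> l \<le> c \<longrightarrow> norm z \<le> \<rho> \<longrightarrow> \<bar>iter_pd \<gamma> (g l) z\<bar> \<le> C \<gamma> * l powr (\<delta> - 1)" by blast
  show ?thesis
  proof (intro exI[of _ "\<Sum>\<gamma>\<in>A. \<bar>C \<gamma>\<bar>"] conjI allI impI)
    fix \<gamma> :: "'a list" and l :: real and z :: 'a assume a: "set \<gamma> \<subseteq> Basis" "length \<gamma> \<le> K" "0 < l" "l \<le> c" "norm z \<le> \<rho>"
    then have "\<gamma> \<in> A" by (simp add: A_def)
    then have "C \<gamma> \<le> (\<Sum>\<gamma>\<in>A. \<bar>C \<gamma>\<bar>)"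
      using member_le_sum[OF _ _ A, of \<gamma> "\<lambda>\<gamma>. \<bar>C \<gamma>\<bar>"] by auto
    then have "C \<gamma> * l powr (\<delta> - 1) \<le> (\<Sum>\<gamma>\<in>A. \<bar>C \<gamma>\<bar>) * l powr (\<delta> - 1)" by (rule mult_right_mono) simp
    then show "\<bar>iter_pd \<gamma> (g l) z\<bar> \<le> (\<Sum>\<gamma>\<in>A. \<bar>C \<gamma>\<bar>) * l powr (\<delta> - 1)"
      by (rule order_trans[OF C[rule_format, OF \<open>\<gamma> \<in> A\<close> a(3,4,5)]])
  qed (simp add: sum_nonneg)
qed

text \<open>
  The kernel makes sense also for \<open>l > t\<close>, where the radius \<open>\<phi>(t) - \<phi>(l)\<close> is negative, so \<open>J\<close> can be
  differentiated at its upper limit as an ordinary parameter integral.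
\<close>

definition ker :: "nat \<Rightarrow> (('a \<Rightarrow> real) \<Rightarrow> 'a \<times> real \<Rightarrow> real) \<Rightarrow> 'a \<times> real \<Rightarrow> real \<Rightarrow> real" where
  "ker j T q l = phi l ^ j * T (g l) (fst q, phi (snd q) - phi l)"

definition J :: "nat \<Rightarrow> (('a \<Rightarrow> real) \<Rightarrow> 'a \<times> real \<Rightarrow> real) \<Rightarrow> 'a \<times> real \<Rightarrow> real" where
  "J j T q = integral {0..snd q} (ker j T q)"

lemma ker_continuous:
  assumes "mean_operator m T" "m \<le> K"
  shows "continuous_on ((UNIV \<times> {0<..}) \<times> {0<..}) (\<lambda>(q, l). ker j T q l)"
proof -
  have T: "continuous_on ({0<..} \<times> UNIV) (\<lambda>(l, p). T (g l) p)"
    by (rule mean_operator_continuous_param[OF assms(1)]) (use cont assms(2) in auto)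
  define \<theta> where "\<theta> = (\<lambda>w :: ('a \<times> real) \<times> real. (snd w, (fst (fst w), phi (snd (fst w)) - phi (snd w))))"
  have ph: "continuous_on S (\<lambda>w. phi (u w))" if "continuous_on S u" "\<And>w. w \<in> S \<Longrightarrow> u w > 0"
    for u and S :: "(('a \<times> real) \<times> real) set"
    by (rule continuous_on_compose2[OF continuous_on_phi that(1)]) (use that(2) in auto)
  have "continuous_on ((UNIV \<times> {0<..}) \<times> {0<..}) \<theta>"
    unfolding \<theta>_def by (intro continuous_intros ph) auto
  moreover have "\<theta> ` ((UNIV \<times> {0<..}) \<times> {0<..}) \<subseteq> {0<..} \<times> UNIV" by (auto simp: \<theta>_def)
  ultimately have "continuous_on ((UNIV \<times> {0<..}) \<times> {0<..}) (\<lambda>w. case \<theta> w of (l, p) \<Rightarrow> T (g l) p)"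
    by (rule continuous_on_compose2[OF T])
  then show ?thesis unfolding split_beta ker_def \<theta>_def fst_conv snd_conv
    by (intro continuous_intros ph) auto
qed

text \<open>The radius |\<phi>(t) - \<phi>(l)| is at most \<phi>(c), in either order of t and l. The
  factor \<phi>(l)^j is kept apart because \<open>wt\<close> divides by \<phi>(t).\<close>

lemma ker_bound:
  assumes "mean_operator m T" "m \<le> K"
  shows "\<exists>C\<ge>0. \<forall>x t l. norm x \<le> \<rho> \<longrightarrow> 0 < t \<longrightarrow> t \<le> c \<longrightarrow> 0 < l \<longrightarrow> l \<le> c \<longrightarrow>
    \<bar>ker j T (x, t) l\<bar> \<le> phi l ^ j * (C * l powr (\<delta> - 1))"
proof -
  define \<rho>' where "\<rho>' = max \<rho> (phi c)"
  obtain C1 where C1: "C1 \<ge> 0" "\<forall>h B x r. Ck_on m UNIV h \<longrightarrow> norm x \<le> \<rho>' \<longrightarrow> \<bar>r\<bar> \<le> \<rho>' \<longrightarrow>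
     (\<forall>\<gamma> z. set \<gamma> \<subseteq> Basis \<longrightarrow> length \<gamma> \<le> m \<longrightarrow> norm z \<le> 2 * \<rho>' \<longrightarrow> \<bar>iter_pd \<gamma> h z\<bar> \<le> B) \<longrightarrow>
     \<bar>T h (x, r)\<bar> \<le> C1 * B" using mean_operator_bound[OF assms(1), of \<rho>'] by blast
  obtain C2 where C2: "C2 \<ge> 0" "\<forall>\<gamma> l z. set \<gamma> \<subseteq> Basis \<longrightarrow> length \<gamma> \<le> K \<longrightarrow> 0 < l \<longrightarrow> l \<le> c \<longrightarrow> norm z \<le> 2 * \<rho>' \<longrightarrow>
      \<bar>iter_pd \<gamma> (g l) z\<bar> \<le> C2 * l powr (\<delta> - 1)" using bound[of c "2 * \<rho>'"] by blast
  show ?thesis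
  proof (intro exI[of _ "C1 * C2"] conjI allI impI)
    show "0 \<le> C1 * C2" using C1 C2 by simp
    fix x :: 'a and t l :: real assume x: "norm x \<le> \<rho>" and t: "0 < t" "t \<le> c" and l: "0 < l" "l \<le> c"
    have "\<bar>phi t - phi l\<bar> \<le> \<rho>'"
      using phi_mono[of t c] phi_mono[of l c] phi_nonneg[of t] phi_nonneg[of l] t l by (auto simp: \<rho>'_def)
    moreover have "norm x \<le> \<rho>'" using x by (simp add: \<rho>'_def)
    ultimately have "\<bar>T (g l) (x, phi t - phi l)\<bar> \<le> C1 * (C2 * l powr (\<delta> - 1))"
      using C1(2) C2(2) l assms(2) Ck_on_mono[OF Ck[OF l(1)] assms(2)] by auto
    then show "\<bar>ker j T (x, t) l\<bar> \<le> phi l ^ j * (C1 * C2 * l powr (\<delta> - 1))"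
      using phi_nonneg[of l] unfolding ker_def
      by (simp add: abs_mult mult_left_mono mult.assoc)
  qed
qed

lemma ker_bound':
  assumes "mean_operator m T" "m \<le> K"
  shows "\<exists>C\<ge>0. \<forall>x t l. norm x \<le> \<rho> \<longrightarrow> 0 < t \<longrightarrow> t \<le> c \<longrightarrow> 0 < l \<longrightarrow> l \<le> c \<longrightarrow>
    \<bar>ker j T (x, t) l\<bar> \<le> C * l powr (\<delta> - 1)"
proof -
  obtain C where C: "C \<ge> 0" "\<forall>x t l. norm x \<le> \<rho> \<longrightarrow> 0 < t \<longrightarrow> t \<le> c \<longrightarrow> 0 < l \<longrightarrow> l \<le> c \<longrightarrow>
    \<bar>ker j T (x, t) l\<bar> \<le> phi l ^ j * (C * l powr (\<delta> - 1))" using ker_bound[OF assms, of \<rho> c j] by blast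
  show ?thesis
  proof (intro exI[of _ "phi c ^ j * C"] conjI allI impI)
    show "0 \<le> phi c ^ j * C" using C phi_nonneg by simp
    fix x :: 'a and t l :: real assume a: "norm x \<le> \<rho>" "0 < t" "t \<le> c" "0 < l" "l \<le> c"
    have "\<bar>ker j T (x, t) l\<bar> \<le> phi l ^ j * (C * l powr (\<delta> - 1))" using C(2) a by simp
    also have "\<dots> \<le> phi c ^ j * (C * l powr (\<delta> - 1))"
      using C(1) a by (intro mult_right_mono power_mono phi_mono phi_nonneg) auto
    finally show "\<bar>ker j T (x, t) l\<bar> \<le> phi c ^ j * C * l powr (\<delta> - 1)" by (simp add: mult.assoc)
  qed
qed

lemma ker_slice_continuous:
  assumes "mean_operator m T" "m \<le> K" "t > 0"
  shows "continuous_on {0<..} (ker j T (x, t))"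
  by (rule continuous_on_compose2[OF ker_continuous[OF assms(1,2)], of "{0<..}" "\<lambda>l. ((x, t), l)", simplified])
    (use assms(3) in \<open>auto intro!: continuous_intros\<close>)

lemma ker_integrable:
  assumes "mean_operator m T" "m \<le> K" "t > 0" "c \<ge> 0"
  shows "ker j T (x, t) integrable_on {0..c}"
proof -
  obtain C where C: "\<forall>y s l. norm y \<le> norm x \<longrightarrow> 0 < s \<longrightarrow> s \<le> max c t \<longrightarrow> 0 < l \<longrightarrow> l \<le> max c t \<longrightarrow>
    \<bar>ker j T (y, s) l\<bar> \<le> C * l powr (\<delta> - 1)" using ker_bound'[OF assms(1,2), of "norm x" "max c t" j] by blast
  show ?thesis
    by (rule integrable_powr_dominated(1)[OF \<delta> assms(4), where C=C])
      (use C assms in \<open>auto intro: continuous_on_subset[OF ker_slice_continuous[OF assms(1-3)]]\<close>)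
qed

text \<open>For j = 1 the factor \<phi>(t)^j compensates the division by \<phi>(t) in
  \<open>wt\<close>; the factor t^\<delta> is what drives the limits at t = 0.\<close>

lemma J_bound:
  assumes "mean_operator m T" "m \<le> K"
  shows "\<exists>C\<ge>0. \<forall>t. 0 < t \<longrightarrow> t \<le> 1 \<longrightarrow> \<bar>J j T (x, t)\<bar> \<le> C * phi t ^ j * t powr \<delta>"
proof -
  obtain C where C: "C \<ge> 0" "\<forall>y s l. norm y \<le> norm x \<longrightarrow> 0 < s \<longrightarrow> s \<le> 1 \<longrightarrow> 0 < l \<longrightarrow> l \<le> 1 \<longrightarrow>
    \<bar>ker j T (y, s) l\<bar> \<le> phi l ^ j * (C * l powr (\<delta> - 1))" using ker_bound[OF assms(1,2), of "norm x" 1 j] by blast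
  show ?thesis
  proof (intro exI[of _ "C / \<delta>"] conjI allI impI)
    show "0 \<le> C / \<delta>" using C \<delta> by simp
    fix t :: real assume t: "0 < t" "t \<le> 1"
    have "\<bar>integral {0..t} (ker j T (x, t))\<bar> \<le> (phi t ^ j * C) * (t powr \<delta> / \<delta>)"
    proof (rule integrable_powr_dominated(2)[OF \<delta>])
      show "continuous_on {0<..t} (ker j T (x, t))"
        by (rule continuous_on_subset[OF ker_slice_continuous[OF assms t(1)]]) auto
      fix l :: real assume l: "0 < l" "l \<le> t"
      have "\<bar>ker j T (x, t) l\<bar> \<le> phi l ^ j * (C * l powr (\<delta> - 1))" using C(2) t l by simp
      also have "\<dots> \<le> phi t ^ j * (C * l powr (\<delta> - 1))"
        using C(1) l by (intro mult_right_mono power_mono phi_mono phi_nonneg) auto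
      finally show "\<bar>ker j T (x, t) l\<bar> \<le> phi t ^ j * C * l powr (\<delta> - 1)" by (simp add: mult.assoc)
    qed (use t in simp)
    then show "\<bar>J j T (x, t)\<bar> \<le> C / \<delta> * phi t ^ j * t powr \<delta>" by (simp add: J_def mult_ac)
  qed
qed

text \<open>Dominated convergence along sequences, after the variable upper limit has been turned
  into a cut-off \<open>F\<close> on a fixed interval.\<close>

lemma J_continuous:
  assumes "mean_operator m T" "m \<le> K"
  shows "continuous_on (UNIV \<times> {0<..}) (J j T)"
  unfolding continuous_on_sequentially
proof (intro allI impI ballI)
  fix q :: "nat \<Rightarrow> 'a \<times> real" and p assume p: "p \<in> UNIV \<times> {0<..}" and "(\<forall>n. q n \<in> UNIV \<times> {0<..}) \<and> q \<longlonglongrightarrow> p"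
  then have q: "\<And>n. snd (q n) > 0" and lim: "q \<longlonglongrightarrow> p" and p0: "snd p > 0" by (auto simp: mem_Times_iff)
  obtain M where M: "\<And>n. norm (q n) \<le> M" "M > 0"
    using Bseq_def convergent_imp_Bseq[OF convergentI[OF lim]] by blast
  have pM: "norm p \<le> M" by (rule LIMSEQ_le_const2[OF tendsto_norm[OF lim]]) (use M in auto)
  have nf: "norm (fst v) \<le> M" "snd v \<le> M" if "norm v \<le> M" for v :: "'a \<times> real"
    using norm_fst_le[of "fst v" "snd v"] norm_snd_le[of "snd v" "fst v"] that by auto
  obtain C where C: "C \<ge> 0" "\<forall>y s l. norm y \<le> M \<longrightarrow> 0 < s \<longrightarrow> s \<le> M \<longrightarrow> 0 < l \<longrightarrow> l \<le> M \<longrightarrow>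
    \<bar>ker j T (y, s) l\<bar> \<le> C * l powr (\<delta> - 1)" using ker_bound'[OF assms, of M M j] by blast
  define F where "F = (\<lambda>v l. if 0 < l \<and> l \<le> snd v then ker j T v l else 0)"
  \<comment> \<open>At l = \<open>snd p\<close> the cut-off values may fail to converge; this one
    point is removed.\<close>
  define S where "S = {0..M} - {snd p}"
  have J: "(F v has_integral J j T v) S" if v: "snd v > 0" "norm v \<le> M" for v
  proof -
    have "(ker j T v has_integral J j T v) {0..snd v}"
      unfolding J_def using ker_integrable[OF assms v(1), of "snd v" j "fst v"] v by (simp add: integrable_integral)
    then have "((\<lambda>l. if l \<in> {0..snd v} then ker j T v l else 0) has_integral J j T v) {0..M}"
      using nf[OF v(2)] by (subst has_integral_restrict) auto
    then have "(F v has_integral J j T v) {0..M}"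
      by (rule has_integral_spike[of "{0}", rotated 2]) (auto simp: F_def)
    then show ?thesis unfolding S_def
      by (subst has_integral_spike_set_eq[of _ "{0..M}"]) (rule negligible_subset[of "{snd p}"]; auto)+
  qed
  have "(\<lambda>n. integral S (F (q n))) \<longlonglongrightarrow> integral S (F p)"
  proof (rule dominated_convergence(2)[where h="\<lambda>l. C * l powr (\<delta> - 1)"])
    show "F (q n) integrable_on S" for n using J[OF q M(1)] by (auto simp: integrable_on_def)
    have "(\<lambda>l. l powr (\<delta> - 1)) integrable_on {0..M}" using \<delta> M by (intro integrable_on_powr_from_0) auto
    then have "(\<lambda>l. l powr (\<delta> - 1)) integrable_on S" unfolding S_def
      by (rule integrable_spike_set) (rule negligible_subset[of "{snd p}"]; auto)+
    then show "(\<lambda>l. C * l powr (\<delta> - 1)) integrable_on S" by (rule integrable_on_mult_right)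
    show "norm (F (q n) l) \<le> C * l powr (\<delta> - 1)" if "l \<in> S" for n l
    proof (cases "0 < l \<and> l \<le> snd (q n)")
      case True
      then have "\<bar>ker j T (fst (q n), snd (q n)) l\<bar> \<le> C * l powr (\<delta> - 1)"
        using C(2)[rule_format, of "fst (q n)" "snd (q n)" l] nf[OF M(1)[of n]] q[of n] by simp
      then show ?thesis using True by (simp add: F_def)
    next
      case False then show ?thesis using C(1) by (auto simp: F_def)
    qed
    show "(\<lambda>n. F (q n) l) \<longlonglongrightarrow> F p l" if l: "l \<in> S" for l
    proof (cases "0 < l \<and> l < snd p")
      case True
      have "\<forall>\<^sub>F n in sequentially. l < snd (q n)"
        using order_tendstoD(1)[OF tendsto_snd[OF lim]] True by blast
      then have ev: "\<forall>\<^sub>F n in sequentially. ker j T (q n) l = F (q n) l"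
        by (rule eventually_mono) (use True in \<open>auto simp: F_def\<close>)
      have "continuous_on (UNIV \<times> {0<..}) (\<lambda>q. ker j T q l)"
        by (rule continuous_on_compose2[OF ker_continuous[OF assms], of "UNIV \<times> {0<..}" "\<lambda>q. (q, l)", simplified])
          (use True in \<open>auto intro!: continuous_intros\<close>)
      then have "(\<lambda>n. ker j T (q n) l) \<longlonglongrightarrow> ker j T p l"
        using continuous_on_sequentially[THEN iffD1, rule_format, of "UNIV \<times> {0<..}" "\<lambda>q. ker j T q l" p q] q lim p
        by (simp add: o_def mem_Times_iff)
      then show ?thesis using True ev by (simp add: F_def tendsto_cong)
    next
      case False
      show ?thesis
      proof (cases "l > 0")
        case True
        then have "snd p < l" using False l by (auto simp: S_def)
        then have "\<forall>\<^sub>F n in sequentially. snd (q n) < l"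
          using order_tendstoD(2)[OF tendsto_snd[OF lim]] by blast
        then have "\<forall>\<^sub>F n in sequentially. F (q n) l = 0"
          by (rule eventually_mono) (auto simp: F_def)
        then show ?thesis using \<open>snd p < l\<close> by (simp add: F_def tendsto_eventually)
      qed (simp add: F_def)
    qed
  qed
  then show "(J j T \<circ> q) \<longlonglongrightarrow> J j T p"
    using J[OF q M(1), THEN integral_unique] J[OF p0 pM, THEN integral_unique] by (simp add: o_def)
qed

lemma J_has_pd_x:
  assumes T: "mean_operator m T" and m: "Suc m \<le> K" and b: "b \<in> Basis" and t: "t > 0"
  shows "has_pd (b, 0) (J j T) (J j (\<lambda>h. T (pd b h)) (x, t)) (x, t)"
proof -
  have mK: "m \<le> K" using m by simp
  note Tb = mean_operator_pd[OF T b]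
  obtain C where C: "C \<ge> 0" "\<forall>y s l. norm y \<le> norm x + 1 \<longrightarrow> 0 < s \<longrightarrow> s \<le> t \<longrightarrow> 0 < l \<longrightarrow> l \<le> t \<longrightarrow>
    \<bar>ker j (\<lambda>h. T (pd b h)) (y, s) l\<bar> \<le> C * l powr (\<delta> - 1)" using ker_bound'[OF Tb m, of "norm x + 1" t j] by blast
  have "((\<lambda>s. integral {0..t} (ker j T (x + s *\<^sub>R b, t))) has_real_derivative
     integral {0..t} (ker j (\<lambda>h. T (pd b h)) (x + 0 *\<^sub>R b, t))) (at 0)"
  proof (rule DERIV_integral_dominated[OF \<delta> _ zero_less_one, where C=C])
    show "0 \<le> t" using t by simp
    show "ker j T (x + s *\<^sub>R b, t) integrable_on {0..t}" for s
      using t by (intro ker_integrable[OF T mK]) auto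
    fix s l :: real assume s: "\<bar>s - 0\<bar> < 1" and l: "0 < l" "l \<le> t"
    have "has_pd (b, 0) (T (g l)) (T (pd b (g l)) (x + s *\<^sub>R b, phi t - phi l)) (x + s *\<^sub>R b, phi t - phi l)"
      by (rule mean_operator_has_pd_x[OF T b Ck_on_mono[OF Ck[OF l(1)] m]])
    then have "((\<lambda>s. T (g l) (x + s *\<^sub>R b, phi t - phi l)) has_real_derivative T (pd b (g l)) (x + s *\<^sub>R b, phi t - phi l)) (at s)"
      using has_pd_line[of "(b, 0)" "T (g l)" _ "(x, phi t - phi l)" s] by simp
    then show "((\<lambda>s. ker j T (x + s *\<^sub>R b, t) l) has_real_derivative ker j (\<lambda>h. T (pd b h)) (x + s *\<^sub>R b, t) l) (at s)"
      unfolding ker_def fst_conv snd_conv by (rule DERIV_cmult)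
    have "norm (x + s *\<^sub>R b) \<le> norm x + 1" using norm_triangle_ineq[of x "s *\<^sub>R b"] s b by simp
    then show "\<bar>ker j (\<lambda>h. T (pd b h)) (x + s *\<^sub>R b, t) l\<bar> \<le> C * l powr (\<delta> - 1)"
      using C(2) t l by simp
  qed
  then show ?thesis by (simp add: has_pd_def J_def)
qed

text \<open>The upper limit contributes the kernel at l = t, where the radius is 0; under the
  integral the chain rule brings out \<phi>'(t) = t^(-2/3).\<close>

lemma J_has_pd_t:
  assumes T: "mean_operator m T" and T': "mean_operator (Suc m) T'" and m: "Suc m \<le> K" and t: "t > 0"
    and D: "\<And>h p. Ck_on (Suc m) UNIV h \<Longrightarrow> has_pd (0, 1) (T h) (T' h p) p"
  shows "has_pd (0, 1) (J j T) (phi t ^ j * T (g t) (x, 0) + t powr (- 2/3) * J j T' (x, t)) (x, t)"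
proof -
  have mK: "m \<le> K" using m by simp
  \<comment> \<open>The window is t/2 < s < 2t: there the decreasing factor s^(-2/3) is at most
    (t/2)^(-2/3).\<close>
  define c where "c = 2 * t"
  obtain C0 where C0: "C0 \<ge> 0" "\<forall>y s l. norm y \<le> norm x \<longrightarrow> 0 < s \<longrightarrow> s \<le> c \<longrightarrow> 0 < l \<longrightarrow> l \<le> c \<longrightarrow>
    \<bar>ker j T (y, s) l\<bar> \<le> C0 * l powr (\<delta> - 1)" using ker_bound'[OF T mK, of "norm x" c j] by blast
  obtain C1 where C1: "C1 \<ge> 0" "\<forall>y s l. norm y \<le> norm x \<longrightarrow> 0 < s \<longrightarrow> s \<le> c \<longrightarrow> 0 < l \<longrightarrow> l \<le> c \<longrightarrow>
    \<bar>ker j T' (y, s) l\<bar> \<le> C1 * l powr (\<delta> - 1)" using ker_bound'[OF T' m, of "norm x" c j] by blast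
  define \<kappa>' where "\<kappa>' = (\<lambda>s l. s powr (- 2/3) * ker j T' (x, s) l)"
  have D': "((\<lambda>s. ker j T (x, s) l) has_real_derivative \<kappa>' s l) (at s)" if s: "s > 0" and l: "l > 0" for s l
  proof -
    have 1: "((\<lambda>r. T (g l) (x, r)) has_real_derivative T' (g l) (x, phi s - phi l)) (at (phi s - phi l))"
      using D[OF Ck_on_mono[OF Ck[OF l] m]] by (simp add: has_pd_snd_line[symmetric])
    have 2: "((\<lambda>s. phi s - phi l) has_real_derivative s powr (- 2/3)) (at s)"
      using DERIV_phi[OF s] by (auto intro!: derivative_eq_intros)
    from DERIV_cmult[OF DERIV_chain2[where g="\<lambda>s. phi s - phi l", OF 1 2], of "phi l ^ j"]
    show ?thesis by (simp add: ker_def \<kappa>'_def mult_ac)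
  qed
  define C where "C = max C0 ((t / 2) powr (- 2/3) * C1)"
  have "((\<lambda>s. integral {0..s} (ker j T (x, s))) has_real_derivative
     ker j T (x, t) t + integral {0..t} (\<kappa>' t)) (at t)"
  proof (rule DERIV_integral_diagonal[OF \<delta>, where a="t / 2" and c=c and C=C])
    show "0 \<le> t / 2" "t / 2 < t" "t < c" using t by (auto simp: c_def)
    define \<theta> where "\<theta> = (\<lambda>w :: real \<times> real. ((x, fst w), snd w))"
    have "continuous_on ({t / 2<..<c} \<times> {0<..<c}) \<theta>" unfolding \<theta>_def by (intro continuous_intros)
    moreover have "\<theta> ` ({t / 2<..<c} \<times> {0<..<c}) \<subseteq> (UNIV \<times> {0<..}) \<times> {0<..}" using t by (auto simp: \<theta>_def)
    ultimately have "continuous_on ({t / 2<..<c} \<times> {0<..<c}) (\<lambda>w. case \<theta> w of (q, l) \<Rightarrow> ker j T q l)"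
      by (rule continuous_on_compose2[OF ker_continuous[OF T mK]])
    then show "continuous_on ({t / 2<..<c} \<times> {0<..<c}) (\<lambda>(s, l). ker j T (x, s) l)"
      by (simp add: \<theta>_def split_beta)
    fix s l assume s: "t / 2 < s" "s < c" and l: "0 < l" "l < c"
    have s0: "s > 0" using s t by simp
    have p: "0 \<le> l powr (\<delta> - 1)" by simp
    show "((\<lambda>s. ker j T (x, s) l) has_real_derivative \<kappa>' s l) (at s)" by (rule D'[OF s0 l(1)])
    have "\<bar>ker j T (x, s) l\<bar> \<le> C0 * l powr (\<delta> - 1)" using C0(2) s s0 l by simp
    also have "\<dots> \<le> C * l powr (\<delta> - 1)" by (intro mult_right_mono) (auto simp: C_def)
    finally show "\<bar>ker j T (x, s) l\<bar> \<le> C * l powr (\<delta> - 1)" .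
    have "\<bar>\<kappa>' s l\<bar> = s powr (- 2/3) * \<bar>ker j T' (x, s) l\<bar>" by (simp add: \<kappa>'_def abs_mult)
    also have "\<dots> \<le> (t / 2) powr (- 2/3) * (C1 * l powr (\<delta> - 1))"
      using C1(2) s s0 l t by (intro mult_mono powr_mono2') auto
    also have "\<dots> = ((t / 2) powr (- 2/3) * C1) * l powr (\<delta> - 1)" by simp
    also have "\<dots> \<le> C * l powr (\<delta> - 1)" by (intro mult_right_mono) (auto simp: C_def)
    finally show "\<bar>\<kappa>' s l\<bar> \<le> C * l powr (\<delta> - 1)" .
  qed
  moreover have "integral {0..t} (\<kappa>' t) = t powr (- 2/3) * J j T' (x, t)"
    unfolding \<kappa>'_def J_def by simp
  moreover have "ker j T (x, t) t = phi t ^ j * T (g t) (x, 0)" by (simp add: ker_def)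
  ultimately show ?thesis by (simp add: has_pd_snd_line J_def)
qed

end

section \<open>The inhomogeneous equation\<close>

context source_family
begin

lemma J_eq:
  assumes "\<And>l. 0 < l \<Longrightarrow> l \<le> snd q \<Longrightarrow> ker j T q l = F l"
  shows "J j T q = integral {0..snd q} F"
  unfolding J_def by (rule integral_spike[of "{0}"]) (use assms in auto)

text \<open>Agreement on the sources is all that can be asked: identities such as
  \<open>lap_Z\<close> hold for sufficiently regular data only.\<close>

lemma J_cong:
  assumes "\<And>l p. 0 < l \<Longrightarrow> T (g l) p = T' (g l) p"
  shows "J j T q = J j T' q"
proof -
  have "J j T q = integral {0..snd q} (ker j T' q)" by (rule J_eq) (simp add: ker_def assms)
  then show ?thesis by (simp only: J_def[of j T'])
qed

lemma J_sum:
  assumes "\<And>b. b \<in> A \<Longrightarrow> mean_operator m (T b)" "finite A" "m \<le> K" "snd q > 0"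
  shows "(\<Sum>b\<in>A. J j (T b) q) = J j (\<lambda>h p. \<Sum>b\<in>A. T b h p) q"
proof -
  have "ker j (T b) q integrable_on {0..snd q}" if "b \<in> A" for b
    using ker_integrable[OF assms(1)[OF that] assms(3,4), of "snd q" j "fst q"] assms(4) by simp
  then have "(\<Sum>b\<in>A. J j (T b) q) = integral {0..snd q} (\<lambda>l. \<Sum>b\<in>A. ker j (T b) q l)"
    unfolding J_def using assms(2) by (simp add: integral_sum)
  then show ?thesis by (simp add: J_def ker_def[abs_def] sum_distrib_left)
qed

lemma J_diff:
  assumes "mean_operator m T" "mean_operator m T'" "m \<le> K" "snd q > 0"
  shows "J j (\<lambda>h p. T h p - T' h p) q = J j T q - J j T' q"
proof -
  have "ker j T q integrable_on {0..snd q}" "ker j T' q integrable_on {0..snd q}"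
    using ker_integrable[OF assms(1,3,4), of "snd q" j "fst q"] ker_integrable[OF assms(2,3,4), of "snd q" j "fst q"] assms(4)
    by simp_all
  from integral_diff[OF this] show ?thesis
    by (simp add: J_def ker_def[abs_def] right_diff_distrib)
qed

text \<open>On the kernel r = \<phi>(t) - \<phi>(l): the first term leaves the integral, the second
  raises j. Factors r are thereby traded for factors \<phi>.\<close>

lemma J_times_r:
  assumes "mean_operator m T" "m \<le> K" "snd q > 0"
  shows "J 0 (\<lambda>h p. snd p * T h p) q = phi (snd q) * J 0 T q - J 1 T q"
proof -
  have i: "ker 0 T q integrable_on {0..snd q}" "ker 1 T q integrable_on {0..snd q}"
    using ker_integrable[OF assms, of "snd q" _ "fst q"] assms(3) by simp_all
  have "J 0 (\<lambda>h p. snd p * T h p) q = integral {0..snd q} (\<lambda>l. phi (snd q) * ker 0 T q l - ker 1 T q l)"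
    by (simp add: J_def ker_def[abs_def] left_diff_distrib)
  also have "\<dots> = phi (snd q) * J 0 T q - J 1 T q"
    unfolding J_def using i by (subst integral_diff) (auto intro: integrable_on_mult_right)
  finally show ?thesis .
qed

end

section \<open>Regularity of functions of x alone or of t alone\<close>

lemma Ck_on_fst:
  assumes "open S" "Ck_on k UNIV h"
  shows "Ck_on k S (\<lambda>q :: 'a::euclidean_space \<times> real. h (fst q))"
  using assms(2)
proof (induction k arbitrary: h)
  case 0
  then show ?case unfolding Ck_on_0 by (rule continuous_on_compose2) (auto intro!: continuous_intros)
next
  case (Suc k)
  show ?case
  proof (rule Ck_on_pair_SucI[OF assms(1)])
    show "continuous_on S (\<lambda>q. h (fst q))"
      by (rule continuous_on_compose2[OF Ck_on_continuous[OF Suc.prems]]) (auto intro!: continuous_intros)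
    show "has_pd (b, 0) (\<lambda>q. h (fst q)) (pd b h (fst q)) q" if "b \<in> Basis" for b and q :: "'a \<times> real"
      by (intro has_pd_fst Ck_on_Suc_has_pd[OF Suc.prems that UNIV_I])
    show "Ck_on k S (\<lambda>q. pd b h (fst q))" if "b \<in> Basis" for b
      by (intro Suc.IH Ck_on_pd[OF Suc.prems that])
  qed (auto intro: has_pd_fst_0 Ck_on_const assms(1))
qed

lemma Ck_on_2_snd:
  fixes c c1 c2 :: "real \<Rightarrow> real"
  assumes "\<And>t. t > 0 \<Longrightarrow> (c has_real_derivative c1 t) (at t)"
    and "\<And>t. t > 0 \<Longrightarrow> (c1 has_real_derivative c2 t) (at t)" and "continuous_on {0<..} c2"
  shows "Ck_on 2 (UNIV \<times> {0<..}) (\<lambda>q :: 'a::euclidean_space \<times> real. c (snd q))"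
proof -
  have S: "open (UNIV \<times> {0<..} :: ('a \<times> real) set)" by (intro open_Times) auto
  have cs: "continuous_on (UNIV \<times> {0<..}) (\<lambda>q :: 'a \<times> real. u (snd q))" if "continuous_on {0<..} u" for u :: "real \<Rightarrow> real"
    by (rule continuous_on_compose2[OF that]) (auto intro!: continuous_intros)
  have cd: "continuous_on {0<..} u" if "\<And>t. t > 0 \<Longrightarrow> (u has_real_derivative u' t) (at t)" for u u' :: "real \<Rightarrow> real"
    by (rule DERIV_continuous_on[where D=u']) (rule has_field_derivative_at_within, rule that, simp)
  show ?thesis unfolding numeral_2_eq_2
    by (rule Ck_on_pair_SucI[where g'="\<lambda>_ _. 0" and g''="\<lambda>q. c1 (snd q)"],
        rule S, rule cs[OF cd[OF assms(1)]], assumption, rule has_pd_snd_0, rule Ck_on_const[OF S], rule has_pd_snd,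
        rule assms(1), simp add: mem_Times_iff,
        rule Ck_on_pair_SucI[where g'="\<lambda>_ _. 0" and g''="\<lambda>q. c2 (snd q)"],
        rule S, rule cs[OF cd[OF assms(2)]], assumption, rule has_pd_snd_0, rule Ck_on_const[OF S], rule has_pd_snd,
        rule assms(2), simp add: mem_Times_iff, simp add: Ck_on_0 cs[OF assms(3)])
qed

text \<open>K = k + 2 because \<open>Z\<close> and \<open>N\<close> take k derivatives and two more
  go into the second x-derivatives of \<open>w\<close>; \<open>Zrr\<close>, which occurs in the
  second t-derivative, takes exactly k + 2.\<close>

locale wave_source = source_family g "k + 2" \<delta> + wave_operators k U Z Zr Zrr N
  for g :: "real \<Rightarrow> 'a::euclidean_space \<Rightarrow> real" and \<delta> :: real and k :: nat
    and U Z Zr Zrr N :: "('a \<Rightarrow> real) \<Rightarrow> 'a \<times> real \<Rightarrow> real"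
begin

text \<open>The Duhamel integral, up to the factor 18, after integration by parts in r: at r =
  \<phi>(t) - \<phi>(l) the polynomial \<phi>(t)^2 + \<phi>(l)^2 - r^2 equals 2 \<phi>(t) \<phi>(l),
  whence \<open>J 1 Z\<close>, and the remaining integral of r Z is \<open>N\<close>. Both operators
  take one derivative less than \<open>Zr\<close>.\<close>

definition w :: "'a \<times> real \<Rightarrow> real" where
  "w q = (phi (snd q) * J 1 Z q + J 0 N q) / 9"

definition wt :: "'a \<times> real \<Rightarrow> real" where
  "wt q = (J 1 Zr q + J 0 Z q) / phi (snd q)"

definition wtt :: "'a \<times> real \<Rightarrow> real" where
  "wtt q = g (snd q) (fst q) + snd q powr (- 2/3) / phi (snd q) * (J 1 Zrr q + J 0 Zr q)
     - snd q powr (- 2/3) / (phi (snd q))\<^sup>2 * (J 1 Zr q + J 0 Z q)"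

definition wx :: "'a \<Rightarrow> 'a \<times> real \<Rightarrow> real" where
  "wx b q = (phi (snd q) * J 1 (\<lambda>h. Z (pd b h)) q + J 0 (\<lambda>h. N (pd b h)) q) / 9"

definition wxt :: "'a \<Rightarrow> 'a \<times> real \<Rightarrow> real" where
  "wxt b q = (J 1 (\<lambda>h. Zr (pd b h)) q + J 0 (\<lambda>h. Z (pd b h)) q) / phi (snd q)"

definition wxx :: "'a \<Rightarrow> 'a \<Rightarrow> 'a \<times> real \<Rightarrow> real" where
  "wxx c b q = (phi (snd q) * J 1 (\<lambda>h. Z (pd b (pd c h))) q + J 0 (\<lambda>h. N (pd b (pd c h))) q) / 9"

lemma has_pd_phi: "t > 0 \<Longrightarrow> has_pd (0, 1) (\<lambda>q. phi (snd q)) (t powr (- 2/3)) (x, t)"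
  by (rule has_pd_snd, unfold snd_conv, rule DERIV_phi)

lemma has_pd_phi_x: "has_pd (b, 0) (\<lambda>q. phi (snd q)) 0 q"
  by (rule has_pd_snd_0)

text \<open>(T, M) is (Z, N) or that pair applied to \<open>pd b h\<close>. Differentiating the
  outer \<phi>(t) produces P times \<open>J 1 T\<close>, and r T under the second integral splits
  into \<phi>(t) \<open>J 0 T\<close> minus \<open>J 1 T\<close>; the two terms \<open>J 1 T\<close>
  cancel, and P = 9 / \<phi>^2 leaves the quotient by \<phi>.\<close>

lemma time_derivative_aux:
  assumes T: "mean_operator m T" and T': "mean_operator (Suc m) T'" and M: "mean_operator m M" and m: "Suc m \<le> k + 2" and t: "t > 0"
    and TD: "\<And>h p. Ck_on (Suc m) UNIV h \<Longrightarrow> has_pd (0, 1) (T h) (T' h p) p"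
    and MD: "\<And>h p. Ck_on (Suc m) UNIV h \<Longrightarrow> has_pd (0, 1) (M h) (snd p * T h p) p"
    and T0: "T (g t) (x, 0) = 0" and M0: "M (g t) (x, 0) = 0"
  shows "has_pd (0, 1) (\<lambda>q. (phi (snd q) * J 1 T q + J 0 M q) / 9) ((J 1 T' (x, t) + J 0 T (x, t)) / phi t) (x, t)"
proof -
  have m': "m \<le> k + 2" using m by simp
  have rT: "mean_operator (Suc m) (\<lambda>h p. snd p * T h p)" by (intro mean_operator_times_r mean_operator_mono[OF T]) simp
  define P where "P = t powr (- 2/3)"
  have P: "P = 9 / (phi t)\<^sup>2" unfolding P_def by (rule phi_deriv_eq[OF t])
  have "has_pd (0, 1) (J 1 T) (phi t ^ 1 * T (g t) (x, 0) + P * J 1 T' (x, t)) (x, t)"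
    unfolding P_def by (rule J_has_pd_t[OF T T' m t TD])
  moreover have "has_pd (0, 1) (J 0 M) (phi t ^ 0 * M (g t) (x, 0) + P * J 0 (\<lambda>h p. snd p * T h p) (x, t)) (x, t)"
    unfolding P_def by (rule J_has_pd_t[OF M rT m t MD])
  ultimately have "has_pd (0, 1) (\<lambda>q. 1 / 9 * (phi (snd q) * J 1 T q + J 0 M q))
    (1 / 9 * ((phi (snd (x, t)) * (P * J 1 T' (x, t)) + P * J 1 T (x, t)) + P * (phi t * J 0 T (x, t) - J 1 T (x, t)))) (x, t)"
    using J_times_r[OF T m', of "(x, t)"] t T0 M0
    by (intro has_pd_cmult has_pd_add has_pd_mult has_pd_phi[OF t, folded P_def]) simp_all
  moreover have "1 / 9 * ((phi (snd (x, t)) * (P * J 1 T' (x, t)) + P * J 1 T (x, t)) + P * (phi t * J 0 T (x, t) - J 1 T (x, t)))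
     = (J 1 T' (x, t) + J 0 T (x, t)) / phi t"
    using phi_pos[OF t] unfolding P by (simp add: field_simps power2_eq_square)
  moreover have "(\<lambda>q. (phi (snd q) * J 1 T q + J 0 M q) / 9) = (\<lambda>q. 1 / 9 * (phi (snd q) * J 1 T q + J 0 M q))"
    by (simp add: fun_eq_iff)
  ultimately show ?thesis by (simp only:)
qed

lemma Z_0: "Z h (x, 0) = 0" by (simp add: Z_U)

lemma w_t: "t > 0 \<Longrightarrow> has_pd (0, 1) w (wt (x, t)) (x, t)"
  using time_derivative_aux[OF Z, of Zr N t x] Zr N Z_r N_r Z_0 N_0 Ck[of t]
  by (simp add: w_def[abs_def] wt_def Ck_on_mono)

lemma wx_t:
  assumes b: "b \<in> Basis" and t: "t > 0"
  shows "has_pd (0, 1) (wx b) (wxt b (x, t)) (x, t)"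
proof -
  have c: "Ck_on k UNIV (pd b h)" "Ck_on (k + 1) UNIV (pd b h)" if "Ck_on (Suc (Suc k)) UNIV h" for h
    using Ck_on_pd[OF that b] by (auto intro: Ck_on_SucD)
  have "has_pd (0, 1) (\<lambda>q. (phi (snd q) * J 1 (\<lambda>h. Z (pd b h)) q + J 0 (\<lambda>h. N (pd b h)) q) / 9)
     ((J 1 (\<lambda>h. Zr (pd b h)) (x, t) + J 0 (\<lambda>h. Z (pd b h)) (x, t)) / phi t) (x, t)"
    using mean_operator_pd[OF Zr b] c Ck[OF t]
    by (intro time_derivative_aux[where m="Suc k"] mean_operator_pd[OF Z b] mean_operator_pd[OF N b] t Z_r N_r Z_0 N_0) auto
  then show ?thesis by (simp add: wx_def[abs_def] wxt_def)
qed

text \<open>The source enters here: \<open>Zr\<close> returns its data at r = 0, so the boundary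
  term of \<open>J 1 Zr\<close> at l = t is \<phi>(t) g(t, x), and division by \<phi>(t) leaves g.
  The boundary term of \<open>J 0 Z\<close> is zero.\<close>

lemma wt_t:
  assumes t: "t > 0"
  shows "has_pd (0, 1) wt (wtt (x, t)) (x, t)"
proof -
  define P where "P = t powr (- 2/3)"
  have p0: "phi t > 0" by (rule phi_pos[OF t])
  have "has_pd (0, 1) (J 1 Zr) (phi t ^ 1 * Zr (g t) (x, 0) + P * J 1 Zrr (x, t)) (x, t)"
    unfolding P_def by (rule J_has_pd_t[OF Zr _ _ t]) (use Zrr Zr_r in auto)
  moreover have "has_pd (0, 1) (J 0 Z) (phi t ^ 0 * Z (g t) (x, 0) + P * J 0 Zr (x, t)) (x, t)"
    unfolding P_def by (rule J_has_pd_t[OF Z _ _ t]) (use Zr Z_r in auto)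
  moreover have "has_pd (0, 1) (\<lambda>q. inverse (phi (snd q))) (- (inverse (phi t) ^ Suc (Suc 0)) * P) (x, t)"
    using has_pd_chain[OF has_pd_phi[OF t, folded P_def], of inverse "- (inverse (phi t) ^ Suc (Suc 0))" x] DERIV_inverse[of "phi t"] p0 by simp
  ultimately have "has_pd (0, 1) (\<lambda>q. (J 1 Zr q + J 0 Z q) * inverse (phi (snd q)))
     ((J 1 Zr (x, t) + J 0 Z (x, t)) * (- (inverse (phi t) ^ Suc (Suc 0)) * P) +
      ((phi t ^ 1 * Zr (g t) (x, 0) + P * J 1 Zrr (x, t)) + (phi t ^ 0 * Z (g t) (x, 0) + P * J 0 Zr (x, t))) * inverse (phi (snd (x, t)))) (x, t)"
    by (intro has_pd_mult has_pd_add)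
  moreover have "((J 1 Zr (x, t) + J 0 Z (x, t)) * (- (inverse (phi t) ^ Suc (Suc 0)) * P) +
      ((phi t ^ 1 * Zr (g t) (x, 0) + P * J 1 Zrr (x, t)) + (phi t ^ 0 * Z (g t) (x, 0) + P * J 0 Zr (x, t))) * inverse (phi (snd (x, t)))) = wtt (x, t)"
    unfolding wtt_def Z_0 Zr_0[OF Ck[OF t]] P_def[symmetric] fst_conv snd_conv
    using p0 by (simp add: field_simps power2_eq_square P_def[symmetric])
  ultimately show ?thesis by (simp add: wt_def[abs_def] divide_inverse)
qed

lemma w_x:
  assumes b: "b \<in> Basis" and t: "t > 0"
  shows "has_pd (b, 0) w (wx b (x, t)) (x, t)"
proof -
  have "has_pd (b, 0) (\<lambda>q. 1 / 9 * (phi (snd q) * J 1 Z q + J 0 N q))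
    (1 / 9 * ((phi (snd (x, t)) * J 1 (\<lambda>h. Z (pd b h)) (x, t) + 0 * J 1 Z (x, t)) + J 0 (\<lambda>h. N (pd b h)) (x, t))) (x, t)"
    by (intro has_pd_cmult has_pd_add has_pd_mult has_pd_phi_x J_has_pd_x[OF Z _ b t] J_has_pd_x[OF N _ b t]) auto
  then show ?thesis by (simp add: w_def[abs_def] wx_def)
qed

lemma wx_x:
  assumes b: "b \<in> Basis" and c: "c \<in> Basis" and t: "t > 0"
  shows "has_pd (c, 0) (wx b) (wxx c b (x, t)) (x, t)"
proof -
  have "has_pd (c, 0) (\<lambda>q. 1 / 9 * (phi (snd q) * J 1 (\<lambda>h. Z (pd b h)) q + J 0 (\<lambda>h. N (pd b h)) q))
    (1 / 9 * ((phi (snd (x, t)) * J 1 (\<lambda>h. Z (pd b (pd c h))) (x, t) + 0 * J 1 (\<lambda>h. Z (pd b h)) (x, t)) + J 0 (\<lambda>h. N (pd b (pd c h))) (x, t))) (x, t)"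
    by (intro has_pd_cmult has_pd_add has_pd_mult has_pd_phi_x J_has_pd_x[OF mean_operator_pd[OF Z b] _ c t] J_has_pd_x[OF mean_operator_pd[OF N b] _ c t]) auto
  then show ?thesis by (simp add: wx_def[abs_def] wxx_def)
qed

lemma wt_x:
  assumes b: "b \<in> Basis" and t: "t > 0"
  shows "has_pd (b, 0) wt (wxt b (x, t)) (x, t)"
proof -
  have "has_pd (b, 0) (\<lambda>q. inverse (phi (snd q))) 0 (x, t)"
    by (rule has_pd_snd_0)
  then have "has_pd (b, 0) (\<lambda>q. inverse (phi (snd q)) * (J 1 Zr q + J 0 Z q))
    (inverse (phi (snd (x, t))) * (J 1 (\<lambda>h. Zr (pd b h)) (x, t) + J 0 (\<lambda>h. Z (pd b h)) (x, t)) + 0 * (J 1 Zr (x, t) + J 0 Z (x, t))) (x, t)"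
    by (intro has_pd_add has_pd_mult J_has_pd_x[OF Zr _ b t] J_has_pd_x[OF Z _ b t]) auto
  then show ?thesis by (simp add: wt_def[abs_def] wxt_def divide_inverse mult.commute)
qed

lemma continuous_phi_snd: "continuous_on (UNIV \<times> {0<..}) (\<lambda>q :: 'a \<times> real. phi (snd q))"
  by (rule continuous_on_compose2[OF continuous_on_phi]) (auto intro!: continuous_intros)

text \<open>The operators in \<open>wxx\<close>, \<open>wxt\<close> and \<open>wtt\<close> have
  index at most k + 2, so \<open>J_continuous\<close> covers every second derivative. The mixed one
  is the same function \<open>wxt\<close> in both orders.\<close>

lemma w_Ck2: "Ck_on 2 (UNIV \<times> {0<..}) w"
proof -
  have S: "open (UNIV \<times> {0<..} :: ('a \<times> real) set)" by (intro open_Times) auto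
  have J: "continuous_on (UNIV \<times> {0<..}) (J j T)" if "mean_operator m T" "m \<le> k + 2" for j m T
    by (rule J_continuous[OF that])
  have p: "continuous_on (UNIV \<times> {0<..}) (\<lambda>q :: 'a \<times> real. phi (snd q))" by (rule continuous_phi_snd)
  have p0: "\<forall>q \<in> UNIV \<times> {0<..}. phi (snd (q :: 'a \<times> real)) \<noteq> 0" using phi_pos by force
  have p2: "\<forall>q \<in> UNIV \<times> {0<..}. (phi (snd (q :: 'a \<times> real)))\<^sup>2 \<noteq> 0" using phi_pos by force
  have b1: "mean_operator (Suc k) (\<lambda>h. Z (pd b h))" "mean_operator (Suc k) (\<lambda>h. N (pd b h))" "mean_operator (Suc (k + 1)) (\<lambda>h. Zr (pd b h))"
    if "b \<in> Basis" for b using mean_operator_pd[OF _ that] Z N Zr by blast+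
  have b2: "mean_operator (Suc (Suc k)) (\<lambda>h. Z (pd b (pd c h)))" "mean_operator (Suc (Suc k)) (\<lambda>h. N (pd b (pd c h)))"
    if "b \<in> Basis" "c \<in> Basis" for b c using mean_operator_pd[OF b1(1)[OF that(1)] that(2)] mean_operator_pd[OF b1(2)[OF that(1)] that(2)] by blast+
  have "continuous_on ({0<..} \<times> UNIV) (\<lambda>(l, z). g l z)" using cont[of "[]"] by simp
  then have "continuous_on (UNIV \<times> {0<..}) (\<lambda>q. case (snd q, fst q) of (l, z) \<Rightarrow> g l z)"
    by (rule continuous_on_compose2) (auto intro!: continuous_intros)
  then have cg: "continuous_on (UNIV \<times> {0<..}) (\<lambda>q. g (snd q) (fst q))" by simp
  have cpw: "continuous_on (UNIV \<times> {0<..}) (\<lambda>q :: 'a \<times> real. snd q powr (- 2/3))"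
    by (intro continuous_intros) auto
  have c0: "continuous_on (UNIV \<times> {0<..}) w" unfolding w_def[abs_def]
    by (intro continuous_intros p J[OF Z] J[OF N]) auto
  have ct: "continuous_on (UNIV \<times> {0<..}) wt" unfolding wt_def[abs_def]
    by (intro continuous_intros p p0 J[OF Z] J[OF Zr]) auto
  have ctt: "continuous_on (UNIV \<times> {0<..}) wtt" unfolding wtt_def[abs_def]
    by (intro continuous_intros p p0 p2 cg cpw J[OF Z] J[OF Zr] J[OF Zrr]) auto
  have cx: "continuous_on (UNIV \<times> {0<..}) (wx b)" if "b \<in> Basis" for b unfolding wx_def[abs_def]
    by (intro continuous_intros p J[OF b1(1)[OF that]] J[OF b1(2)[OF that]]) auto
  have cxt: "continuous_on (UNIV \<times> {0<..}) (wxt b)" if "b \<in> Basis" for b unfolding wxt_def[abs_def]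
    by (intro continuous_intros p p0 J[OF b1(1)[OF that]] J[OF b1(3)[OF that]]) auto
  have cxx: "continuous_on (UNIV \<times> {0<..}) (wxx c b)" if "b \<in> Basis" "c \<in> Basis" for b c unfolding wxx_def[abs_def]
    by (intro continuous_intros p J[OF b2(1)[OF that]] J[OF b2(2)[OF that]]) auto
  have wxC: "Ck_on (Suc 0) (UNIV \<times> {0<..}) (wx b)" if b: "b \<in> Basis" for b
  proof (rule Ck_on_pair_SucI[OF S cx[OF b], where g'="\<lambda>c. wxx c b" and g''="wxt b"])
    show "has_pd (c, 0) (wx b) (wxx c b q) q" if "c \<in> Basis" "q \<in> UNIV \<times> {0<..}" for c q
      using that by (cases q) (auto intro: wx_x b)
    show "has_pd (0, 1) (wx b) (wxt b q) q" if "q \<in> UNIV \<times> {0<..}" for q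
      using that by (cases q) (auto intro: wx_t b)
  qed (use cxx cxt b in \<open>auto simp: Ck_on_0\<close>)
  have wtC: "Ck_on (Suc 0) (UNIV \<times> {0<..}) wt"
  proof (rule Ck_on_pair_SucI[OF S ct, where g'=wxt and g''=wtt])
    show "has_pd (c, 0) wt (wxt c q) q" if "c \<in> Basis" "q \<in> UNIV \<times> {0<..}" for c q
      using that by (cases q) (auto intro: wt_x)
    show "has_pd (0, 1) wt (wtt q) q" if "q \<in> UNIV \<times> {0<..}" for q
      using that by (cases q) (auto intro: wt_t)
  qed (use cxt ctt in \<open>auto simp: Ck_on_0\<close>)
  show ?thesis unfolding numeral_2_eq_2
  proof (rule Ck_on_pair_SucI[OF S c0, where g'=wx and g''=wt])
    show "has_pd (c, 0) w (wx c q) q" if "c \<in> Basis" "q \<in> UNIV \<times> {0<..}" for c q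
      using that by (cases q) (auto intro: w_x)
    show "has_pd (0, 1) w (wt q) q" if "q \<in> UNIV \<times> {0<..}" for q
      using that by (cases q) (auto intro: w_t)
  qed (use wxC wtC in auto)
qed

text \<open>\<open>lap_Z\<close> and \<open>lap_N\<close> write the Laplacian of \<open>w\<close>
  through \<open>Zrr\<close>, \<open>Zr\<close> and \<open>Z\<close>. Multiplied by t^(-4/3) = 81 /
  \<phi>^4 it becomes \<open>wtt\<close> without the term g.\<close>

lemma wave_equation:
  assumes t: "t > 0"
  shows "wtt (x, t) - t powr (- 4/3) * (\<Sum>b\<in>Basis. wxx b b (x, t)) = g t x"
proof -
  define p where "p = phi t"
  have p0: "p > 0" unfolding p_def by (rule phi_pos[OF t])
  have P: "t powr (- 2/3) = 9 / p\<^sup>2" unfolding p_def by (rule phi_deriv_eq[OF t])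
  have P2: "t powr (- 4/3) = (9 / p\<^sup>2)\<^sup>2" unfolding P[symmetric] by (simp add: power2_eq_square flip: powr_add)
  have b2: "mean_operator (k + 2) (\<lambda>h. Z (pd b (pd b h)))" "mean_operator (k + 2) (\<lambda>h. N (pd b (pd b h)))" if "b \<in> Basis" for b
    using mean_operator_pd[OF mean_operator_pd[OF Z that] that] mean_operator_pd[OF mean_operator_pd[OF N that] that] by simp_all
  have "(\<Sum>b\<in>Basis. J 1 (\<lambda>h. Z (pd b (pd b h))) (x, t)) = J 1 (\<lambda>h p. \<Sum>b\<in>Basis. Z (pd b (pd b h)) p) (x, t)"
    by (rule J_sum[OF b2(1)]) (use t in auto)
  also have "\<dots> = J 1 Zrr (x, t)" by (intro J_cong lap_Z Ck)
  finally have 1: "(\<Sum>b\<in>Basis. J 1 (\<lambda>h. Z (pd b (pd b h))) (x, t)) = J 1 Zrr (x, t)" .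
  have "(\<Sum>b\<in>Basis. J 0 (\<lambda>h. N (pd b (pd b h))) (x, t)) = J 0 (\<lambda>h p. \<Sum>b\<in>Basis. N (pd b (pd b h)) p) (x, t)"
    by (rule J_sum[OF b2(2)]) (use t in auto)
  also have "\<dots> = J 0 (\<lambda>h p. snd p * Zr h p - Z h p) (x, t)" by (intro J_cong lap_N Ck)
  also have "\<dots> = J 0 (\<lambda>h p. snd p * Zr h p) (x, t) - J 0 Z (x, t)"
    by (rule J_diff[of "k + 1"]) (use t Z Zr in \<open>auto intro: mean_operator_times_r mean_operator_mono\<close>)
  also have "J 0 (\<lambda>h p. snd p * Zr h p) (x, t) = p * J 0 Zr (x, t) - J 1 Zr (x, t)"
    using J_times_r[OF Zr, of "(x, t)"] t by (simp add: p_def)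
  finally have 2: "(\<Sum>b\<in>Basis. J 0 (\<lambda>h. N (pd b (pd b h))) (x, t)) = p * J 0 Zr (x, t) - J 1 Zr (x, t) - J 0 Z (x, t)" .
  have 3: "(\<Sum>b\<in>Basis. wxx b b (x, t)) = (p * J 1 Zrr (x, t) + (p * J 0 Zr (x, t) - J 1 Zr (x, t) - J 0 Z (x, t))) / 9"
    unfolding wxx_def sum_divide_distrib[symmetric] sum.distrib snd_conv sum_distrib_left[symmetric] 1 2 p_def[symmetric] ..
  show ?thesis
    unfolding wtt_def snd_conv fst_conv p_def[symmetric] P P2 3
    using p0 by (simp add: field_simps power2_eq_square)
qed

lemma tendsto_powr_at_right_0: "((\<lambda>t. C * t powr \<delta>) \<longlongrightarrow> 0) (at_right 0)"
proof -
  have "((\<lambda>t. t powr \<delta>) \<longlongrightarrow> 0) (at_right 0)"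
    by (rule tendsto_zero_powrI[where b=\<delta>]) (use \<delta> in \<open>auto simp: eventually_at_filter\<close>)
  then show ?thesis by (rule tendsto_mult_right_zero)
qed

lemma phi_le_3: "0 < t \<Longrightarrow> t \<le> 1 \<Longrightarrow> phi t \<le> 3"
  using phi_mono[of t 1] by (simp add: phi_def)

lemma tendsto_at_right_0I:
  assumes "\<And>t. 0 < t \<Longrightarrow> t \<le> 1 \<Longrightarrow> \<bar>u t\<bar> \<le> C * t powr \<delta>"
  shows "(u \<longlongrightarrow> 0) (at_right 0)"
proof (rule Lim_null_comparison[OF _ tendsto_powr_at_right_0[of C]])
  have "\<forall>\<^sub>F t in at_right 0. t \<in> {0<..<1::real}" by (rule eventually_at_right_real) simp
  then show "\<forall>\<^sub>F t in at_right 0. norm (u t) \<le> C * t powr \<delta>"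
    by (rule eventually_mono) (use assms in auto)
qed

lemma w_tendsto_0: "((\<lambda>t. w (x, t)) \<longlongrightarrow> 0) (at_right 0)"
proof -
  obtain C1 where C1: "C1 \<ge> 0" "\<forall>t. 0 < t \<longrightarrow> t \<le> 1 \<longrightarrow> \<bar>J 1 Z (x, t)\<bar> \<le> C1 * phi t ^ 1 * t powr \<delta>"
    using J_bound[OF Z, of 1 x] by auto
  obtain C2 where C2: "C2 \<ge> 0" "\<forall>t. 0 < t \<longrightarrow> t \<le> 1 \<longrightarrow> \<bar>J 0 N (x, t)\<bar> \<le> C2 * phi t ^ 0 * t powr \<delta>"
    using J_bound[OF N, of 0 x] by auto
  show ?thesis
  proof (rule tendsto_at_right_0I[of _ "(9 * C1 + C2) / 9"])
    fix t :: real assume t: "0 < t" "t \<le> 1"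
    have ph: "0 \<le> phi t" "phi t \<le> 3" using phi_nonneg phi_le_3[OF t] by auto
    have "\<bar>phi t * J 1 Z (x, t)\<bar> \<le> 3 * (C1 * 3 * t powr \<delta>)"
      unfolding abs_mult using ph C1 t by (intro mult_mono order_trans[OF C1(2)[rule_format, OF t]]) (auto intro!: mult_mono)
    moreover have "\<bar>J 0 N (x, t)\<bar> \<le> C2 * t powr \<delta>" using C2 t by simp
    ultimately show "\<bar>w (x, t)\<bar> \<le> (9 * C1 + C2) / 9 * t powr \<delta>"
      unfolding w_def snd_conv by (simp add: algebra_simps abs_le_iff)
  qed
qed

text \<open>\<open>J 0 Z\<close> has j = 0 and yet is divided by \<phi>(t). The missing factor comes
  from Z = r U: both \<phi> \<open>J 0 U\<close> and \<open>J 1 U\<close> are of size \<phi>(t)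
  t^\<delta>.\<close>

lemma wt_tendsto_0: "((\<lambda>t. wt (x, t)) \<longlongrightarrow> 0) (at_right 0)"
proof -
  obtain C1 where C1: "C1 \<ge> 0" "\<forall>t. 0 < t \<longrightarrow> t \<le> 1 \<longrightarrow> \<bar>J 1 Zr (x, t)\<bar> \<le> C1 * phi t ^ 1 * t powr \<delta>"
    using J_bound[OF Zr, of 1 x] by auto
  obtain C2 where C2: "C2 \<ge> 0" "\<forall>t. 0 < t \<longrightarrow> t \<le> 1 \<longrightarrow> \<bar>J 0 U (x, t)\<bar> \<le> C2 * phi t ^ 0 * t powr \<delta>"
    using J_bound[OF U, of 0 x] by auto
  obtain C3 where C3: "C3 \<ge> 0" "\<forall>t. 0 < t \<longrightarrow> t \<le> 1 \<longrightarrow> \<bar>J 1 U (x, t)\<bar> \<le> C3 * phi t ^ 1 * t powr \<delta>"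
    using J_bound[OF U, of 1 x] by auto
  show ?thesis
  proof (rule tendsto_at_right_0I[of _ "C1 + C2 + C3"])
    fix t :: real assume t: "0 < t" "t \<le> 1"
    have ph: "phi t > 0" using phi_pos t by auto
    have "J 0 Z (x, t) = phi t * J 0 U (x, t) - J 1 U (x, t)"
      using J_times_r[OF U, of "(x, t)"] t J_cong[of Z "\<lambda>h p. snd p * U h p"] by (simp add: Z_U)
    moreover have "\<bar>phi t * J 0 U (x, t)\<bar> \<le> phi t * (C2 * t powr \<delta>)"
      unfolding abs_mult using ph C2(2)[rule_format, OF t] by (intro mult_mono) auto
    ultimately have "\<bar>J 0 Z (x, t)\<bar> \<le> phi t * (C2 * t powr \<delta>) + C3 * phi t * t powr \<delta>"
      using C3(2)[rule_format, OF t] by simp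
    then have "\<bar>J 1 Zr (x, t) + J 0 Z (x, t)\<bar> \<le> phi t * ((C1 + C2 + C3) * t powr \<delta>)"
      using C1(2)[rule_format, OF t] by (simp add: algebra_simps)
    then show "\<bar>wt (x, t)\<bar> \<le> (C1 + C2 + C3) * t powr \<delta>"
      unfolding wt_def snd_conv abs_divide using ph by (simp add: divide_le_eq mult.commute)
  qed
qed

end

section \<open>The renormalized solution\<close>

text \<open>Integration by parts in r for each fixed l. \<open>G\<close> stands for the combination
  of \<open>wave_sol\<close> terms in \<open>psi\<close>, which is identified with
  \<open>Zr (g l)\<close> for l > 0 only.\<close>

lemma (in wave_source) w_eq_integral:
  assumes t: "t > 0" and G: "\<And>l r. 0 < l \<Longrightarrow> l \<le> t \<Longrightarrow> G l r = Zr (g l) (x, r)"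
  shows "integral {0..t} (\<lambda>l. integral {0..phi t - phi l} (\<lambda>r. ((phi t)\<^sup>2 + (phi l)\<^sup>2 - r\<^sup>2) * G l r)) = 18 * w (x, t)"
proof -
  have inner: "integral {0..phi t - phi l} (\<lambda>r. ((phi t)\<^sup>2 + (phi l)\<^sup>2 - r\<^sup>2) * G l r) =
      2 * (phi t * ker 1 Z (x, t) l + ker 0 N (x, t) l)" if l: "0 < l" "l \<le> t" for l
  proof -
    define R where "R = phi t - phi l"
    have R: "0 \<le> R" using phi_mono[of l t] l by (simp add: R_def)
    have C: "Ck_on (k + 1) UNIV (g l)" "Ck_on k UNIV (g l)" using Ck[OF l(1)] by (auto elim: Ck_on_mono)
    \<comment> \<open>A primitive of the inner integrand: the term -2 r Z from differentiating the
      polynomial is cancelled by the derivative 2 r Z of 2 N.\<close>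
    define A where "A = (\<lambda>r. ((phi t)\<^sup>2 + (phi l)\<^sup>2 - r\<^sup>2) * Z (g l) (x, r) + 2 * N (g l) (x, r))"
    have "(A has_real_derivative ((phi t)\<^sup>2 + (phi l)\<^sup>2 - r\<^sup>2) * G l r) (at r)" for r
    proof -
      have 1: "((\<lambda>r. Z (g l) (x, r)) has_real_derivative Zr (g l) (x, r)) (at r)"
        and 2: "((\<lambda>r. N (g l) (x, r)) has_real_derivative r * Z (g l) (x, r)) (at r)"
        using Z_r[OF C(1), of "(x, r)"] N_r[OF C(2), of "(x, r)"] by (simp_all add: has_pd_snd_line)
      show ?thesis unfolding A_def G[OF l]
        by (rule derivative_eq_intros 1 2 refl)+ (simp add: algebra_simps)
    qed
    then have "((\<lambda>r. ((phi t)\<^sup>2 + (phi l)\<^sup>2 - r\<^sup>2) * G l r) has_integral A R - A 0) {0..R}"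
      by (intro fundamental_theorem_of_calculus R)
        (auto simp: has_real_derivative_iff_has_vector_derivative[symmetric] intro: has_field_derivative_at_within)
    moreover have "A 0 = 0" using N_0[OF C(2)] by (simp add: A_def Z_0)
    moreover have "A R = 2 * (phi t * ker 1 Z (x, t) l + ker 0 N (x, t) l)"
      by (simp add: A_def ker_def R_def[symmetric]) (simp add: R_def power2_eq_square algebra_simps)
    ultimately show ?thesis by (simp add: integral_unique R_def)
  qed
  have "integral {0..t} (\<lambda>l. integral {0..phi t - phi l} (\<lambda>r. ((phi t)\<^sup>2 + (phi l)\<^sup>2 - r\<^sup>2) * G l r)) =
    integral {0..t} (\<lambda>l. 2 * (phi t * ker 1 Z (x, t) l + ker 0 N (x, t) l))"
    by (rule integral_spike[of "{0}"]) (use inner in auto)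
  also have "\<dots> = 2 * (phi t * J 1 Z (x, t) + J 0 N (x, t))"
  proof -
    have "ker 1 Z (x, t) integrable_on {0..t}" "ker 0 N (x, t) integrable_on {0..t}"
      using ker_integrable[OF Z _ t] ker_integrable[OF N _ t] t by auto
    then show ?thesis
      unfolding J_def snd_conv integral_mult_right
      by (subst integral_add) (auto intro: integrable_on_mult_right)
  qed
  also have "\<dots> = 18 * w (x, t)" by (simp add: w_def)
  finally show ?thesis .
qed

section \<open>Slices at fixed time and the renormalized source\<close>

lemma iter_pd_slice:
  "iter_pd \<gamma> (\<lambda>z. F (z, l)) z = iter_pd (map (\<lambda>b. (b, 0)) \<gamma>) F (z, l :: real)"
proof (induction \<gamma> arbitrary: z)
  case (Cons b \<gamma>)
  have "iter_pd \<gamma> (\<lambda>z. F (z, l)) = (\<lambda>z. iter_pd (map (\<lambda>b. (b, 0)) \<gamma>) F (z, l))"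
    using Cons.IH by (rule ext)
  then show ?case by (simp add: pd_def)
qed simp

lemma set_map_slice: "set \<gamma> \<subseteq> Basis \<Longrightarrow> set (map (\<lambda>b. (b, 0 :: real)) \<gamma>) \<subseteq> Basis"
  by (auto intro: Basis_prodI)

lemma Ck_on_slice:
  fixes F :: "'a::euclidean_space \<times> real \<Rightarrow> real"
  assumes F: "Ck_on m (UNIV \<times> {0<..}) F" and l: "l > 0"
  shows "Ck_on m UNIV (\<lambda>z. F (z, l))"
  unfolding Ck_on_def
proof (intro conjI allI impI ballI)
  fix vs :: "'a list" assume vs: "set vs \<subseteq> Basis \<and> length vs \<le> m"
  have "continuous_on (UNIV \<times> {0<..}) (iter_pd (map (\<lambda>b. (b, 0)) vs) F)"
    using F vs set_map_slice[of vs] unfolding Ck_on_def by simp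
  then have "continuous_on UNIV (\<lambda>z. iter_pd (map (\<lambda>b. (b, 0)) vs) F (z, l))"
    by (rule continuous_on_compose2) (use l in \<open>auto intro!: continuous_intros\<close>)
  then show "continuous_on UNIV (iter_pd vs (\<lambda>z. F (z, l)))"
    unfolding iter_pd_slice[abs_def] .
next
  fix vs :: "'a list" and v x :: 'a assume vs: "set vs \<subseteq> Basis \<and> length vs < m \<and> v \<in> Basis"
  have "(\<lambda>s. iter_pd (map (\<lambda>b. (b, 0)) vs) F ((x, l) + s *\<^sub>R (v, 0))) differentiable at 0"
    using F[unfolded Ck_on_def, THEN conjunct2, rule_format, of "map (\<lambda>b. (b, 0)) vs" "(v, 0)" "(x, l)"]
      vs l set_map_slice[of vs] Basis_prodI(1)[of v] by simp
  then show "(\<lambda>s. iter_pd vs (\<lambda>z. F (z, l)) (x + s *\<^sub>R v)) differentiable at 0"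
    by (simp add: iter_pd_slice)
qed

lemma Ck_on_lap:
  assumes "Ck_on (k + 2) UNIV h"
  shows "Ck_on k UNIV (\<lambda>z. \<Sum>b\<in>Basis. pd b (pd b h) z)"
  using assms by (intro Ck_on_sum Ck_on_pd[of k] Ck_on_pd[of "Suc k"]) auto

text \<open>Near l = 0 the difference of l f and its leading part is covered by the assumed bound
  with \<epsilon>, while the part with \<Delta>f0 carries l^(5/3-a), at most l^(\<delta>-1) for l
  \<le> 1 as \<delta> \<le> 8/3 - a. Away from l = 0 the bound comes from compactness.\<close>

lemma source_family_renormalized:
  fixes f :: "'a::euclidean_space \<Rightarrow> real \<Rightarrow> real" and f0 :: "'a \<Rightarrow> real" and a \<epsilon> T :: real
  assumes a: "2 < a" "a < 8/3"
    and f: "Ck_on (k + 4) (UNIV \<times> {0<..}) (case_prod f)" and f0: "Ck_on (k + 4) UNIV f0"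
    and \<epsilon>: "\<epsilon> > 0" and T: "T > 0"
    and bnd: "\<And>\<gamma>. set \<gamma> \<subseteq> Basis \<Longrightarrow> length \<gamma> \<le> k + 2 \<Longrightarrow>
      \<exists>C. \<forall>x. \<forall>t\<in>{0<..<T}. \<bar>iter_pd \<gamma> (\<lambda>y. t * f y t - t powr (1 - a) * f0 y) x\<bar> \<le> C * t powr (\<epsilon> - 1)"
  shows "source_family (\<lambda>l z. l * f z l - l powr (1 - a) * f0 z
      + l powr (-4/3) * tau a l * (\<Sum>b\<in>Basis. pd b (pd b f0) z)) (k + 2) (min \<epsilon> (8/3 - a))"
proof -
  define \<delta> where "\<delta> = min \<epsilon> (8/3 - a)"
  define D where "D = (\<lambda>z. \<Sum>b\<in>Basis. pd b (pd b f0) z)"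
  define h where "h = (\<lambda>l z. l * f z l - l powr (1 - a) * f0 z)"
  define c where "c = (\<lambda>l. l powr (-4/3) * tau a l)"
  define g where "g = (\<lambda>l z. h l z + c l * D z)"
  have \<delta>: "\<delta> > 0" "\<delta> \<le> \<epsilon>" "\<delta> \<le> 8/3 - a" using \<epsilon> a by (auto simp: \<delta>_def)
  have Cf: "Ck_on (k + 2) UNIV (\<lambda>z. f z l)" if "l > 0" for l
    using Ck_on_mono[OF Ck_on_slice[OF f that]] by simp
  have Cf0: "Ck_on (k + 2) UNIV f0" by (rule Ck_on_mono[OF f0]) simp
  have CD: "Ck_on (k + 2) UNIV D" unfolding D_def by (intro Ck_on_lap Ck_on_mono[OF f0]) simp
  have Ch: "Ck_on (k + 2) UNIV (h l)" if "l > 0" for l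
    unfolding h_def by (intro Ck_on_diff Ck_on_cmult Cf Cf0 that open_UNIV)
  have Cg: "Ck_on (k + 2) UNIV (g l)" if "l > 0" for l
    unfolding g_def by (intro Ck_on_add Ck_on_cmult Ch CD that open_UNIV)
  have ig: "iter_pd \<gamma> (g l) z = iter_pd \<gamma> (h l) z + c l * iter_pd \<gamma> D z"
    and ih: "iter_pd \<gamma> (h l) z = l * iter_pd \<gamma> (\<lambda>z. f z l) z + (- (l powr (1 - a))) * iter_pd \<gamma> f0 z"
    if \<gamma>: "set \<gamma> \<subseteq> Basis" "length \<gamma> \<le> k + 2" and l: "l > 0" for \<gamma> l z
  proof -
    note m = Ck_on_mono[OF _ \<gamma>(2)]
    show "iter_pd \<gamma> (g l) z = iter_pd \<gamma> (h l) z + c l * iter_pd \<gamma> D z"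
      using iter_pd_add[OF open_UNIV m[OF Ch[OF l]] Ck_on_cmult[OF open_UNIV m[OF CD]] \<gamma>(1) UNIV_I, of "c l" z]
        iter_pd_cmult[OF open_UNIV m[OF CD] \<gamma>(1) UNIV_I, of "c l" z]
      by (simp add: g_def)
    have "h l = (\<lambda>z. l * f z l + (- (l powr (1 - a))) * f0 z)" by (simp add: h_def)
    then show "iter_pd \<gamma> (h l) z = l * iter_pd \<gamma> (\<lambda>z. f z l) z + (- (l powr (1 - a))) * iter_pd \<gamma> f0 z"
      using iter_pd_add[of UNIV \<gamma> "\<lambda>z. l * f z l" "\<lambda>z. (- (l powr (1 - a))) * f0 z" z]
        iter_pd_cmult[of UNIV \<gamma> "\<lambda>z. f z l" z l] iter_pd_cmult[of UNIV \<gamma> f0 z "- (l powr (1 - a))"]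
      by (simp only: m[OF Cf[OF l]] m[OF Cf0] Ck_on_cmult open_UNIV \<gamma>(1) UNIV_I)
  qed
  have cc: "c l = l powr (5/3 - a) / ((3 - a) * (2 - a))" if "l > 0" for l
    using that by (simp add: c_def tau_def flip: powr_add)
  have ccont: "continuous_on {0<..} c"
    unfolding c_def tau_def using a by (intro continuous_intros) auto
  have contg: "continuous_on ({0<..} \<times> UNIV) (\<lambda>(l, z). iter_pd \<gamma> (g l) z)"
    if \<gamma>: "set \<gamma> \<subseteq> Basis" "length \<gamma> \<le> k + 2" for \<gamma>
  proof -
    have "continuous_on (UNIV \<times> {0<..}) (iter_pd (map (\<lambda>b. (b, 0)) \<gamma>) (case_prod f))"
      using f \<gamma> set_map_slice[OF \<gamma>(1)] unfolding Ck_on_def by simp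
    then have "continuous_on ({0<..} \<times> UNIV) (\<lambda>q. iter_pd (map (\<lambda>b. (b, 0)) \<gamma>) (case_prod f) (snd q, fst q))"
      by (rule continuous_on_compose2) (auto intro!: continuous_intros)
    then have 1: "continuous_on ({0<..} \<times> UNIV) (\<lambda>q. iter_pd \<gamma> (\<lambda>z. f z (fst q)) (snd q))"
      using iter_pd_slice[of \<gamma> "case_prod f"] by simp
    have 2: "continuous_on UNIV (iter_pd \<gamma> f0)" "continuous_on UNIV (iter_pd \<gamma> D)"
      using Cf0 CD \<gamma> by (auto simp: Ck_on_def)
    have "continuous_on ({0<..} \<times> UNIV) (\<lambda>q. (fst q * iter_pd \<gamma> (\<lambda>z. f z (fst q)) (snd q) +
        (- (fst q powr (1 - a))) * iter_pd \<gamma> f0 (snd q)) + c (fst q) * iter_pd \<gamma> D (snd q))"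
      by (intro continuous_intros 1 continuous_on_compose2[OF 2(1)] continuous_on_compose2[OF 2(2)] continuous_on_compose2[OF ccont]) auto
    then show ?thesis
      by (rule continuous_on_cong[THEN iffD1, rotated 2]) (auto simp: ig[OF \<gamma>] ih[OF \<gamma>])
  qed
  have "\<exists>C. \<forall>l z. 0 < l \<longrightarrow> l \<le> L \<longrightarrow> norm z \<le> \<rho> \<longrightarrow> \<bar>iter_pd \<gamma> (g l) z\<bar> \<le> C * l powr (\<delta> - 1)"
    if \<gamma>: "set \<gamma> \<subseteq> Basis" "length \<gamma> \<le> k + 2" for \<gamma> and \<rho> L :: real
  proof -
    \<comment> \<open>For l < S both l < T and l \<le> 1 hold, so a larger exponent gives a smaller
      power. From S on, the quotient by l^(\<delta>-1) is continuous on a compact set.\<close>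
    define S where "S = min T 1 / 2"
    have S: "0 < S" "S < T" "S \<le> 1" using T by (auto simp: S_def)
    obtain C1 where "\<forall>x. \<forall>t\<in>{0<..<T}. \<bar>iter_pd \<gamma> (h t) x\<bar> \<le> C1 * t powr (\<epsilon> - 1)"
      using bnd[OF \<gamma>] unfolding h_def by blast
    then have C1: "\<bar>iter_pd \<gamma> (h t) x\<bar> \<le> C1 * t powr (\<epsilon> - 1)" if "0 < t" "t < T" for x t
      using that by simp
    \<comment> \<open>The sign of the constant is not given; evaluation at the admissible time S
      shows that it is \<ge> 0.\<close>
    have C1pos: "C1 \<ge> 0"
    proof -
      have "0 \<le> C1 * S powr (\<epsilon> - 1)" using C1[OF S(1,2), of 0] by linarith
      then show ?thesis using S(1) by (simp add: zero_le_mult_iff)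
    qed
    have "compact (iter_pd \<gamma> D ` cball 0 \<rho>)"
      using CD \<gamma> by (intro compact_continuous_image compact_cball) (auto simp: Ck_on_def intro: continuous_on_subset)
    from compact_imp_bounded[OF this] obtain C2 where C2: "C2 > 0" "\<forall>y\<in>iter_pd \<gamma> D ` cball 0 \<rho>. norm y \<le> C2"
      unfolding bounded_pos by blast
    define A where "A = 1 / \<bar>(3 - a) * (2 - a)\<bar>"
    have "continuous_on ({S..L} \<times> cball 0 \<rho>) (\<lambda>q. iter_pd \<gamma> (g (fst q)) (snd q) / fst q powr (\<delta> - 1))"
      using S contg[OF \<gamma>] unfolding split_beta
      by (intro continuous_intros) (auto elim: continuous_on_subset)
    then have "compact ((\<lambda>q. iter_pd \<gamma> (g (fst q)) (snd q) / fst q powr (\<delta> - 1)) ` ({S..L} \<times> cball 0 \<rho>))"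
      by (intro compact_continuous_image compact_Times) auto
    from compact_imp_bounded[OF this] obtain C3 where C3: "C3 > 0"
      "\<forall>y\<in>(\<lambda>q. iter_pd \<gamma> (g (fst q)) (snd q) / fst q powr (\<delta> - 1)) ` ({S..L} \<times> cball 0 \<rho>). norm y \<le> C3"
      unfolding bounded_pos by blast
    show ?thesis
    proof (intro exI[of _ "C1 + A * C2 + C3"] allI impI)
      fix l :: real and z :: 'a assume l: "0 < l" "l \<le> L" and z: "norm z \<le> \<rho>"
      define p where "p = l powr (\<delta> - 1)"
      have p: "p > 0" using l by (simp add: p_def)
      have AC: "0 \<le> A * C2" using C2 by (simp add: A_def)
      show "\<bar>iter_pd \<gamma> (g l) z\<bar> \<le> (C1 + A * C2 + C3) * l powr (\<delta> - 1)"
      proof (cases "l < S")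
        case True
        then have l1: "l \<le> 1" "l < T" using S by auto
        have "l powr (\<epsilon> - 1) \<le> p" unfolding p_def using l l1 \<delta> by (intro powr_mono') auto
        then have 1: "\<bar>iter_pd \<gamma> (h l) z\<bar> \<le> C1 * p"
          using C1[OF l(1) l1(2), of z] mult_left_mono[OF _ C1pos] by fastforce
        have "\<bar>c l\<bar> = A * l powr (5/3 - a)" using cc[OF l(1)] by (simp add: A_def abs_divide abs_mult)
        also have "\<dots> \<le> A * p" unfolding p_def using l l1 \<delta> by (intro mult_left_mono powr_mono') (auto simp: A_def)
        finally have "\<bar>c l\<bar> * \<bar>iter_pd \<gamma> D z\<bar> \<le> (A * p) * C2"
          using C2 z p by (intro mult_mono) (auto simp: A_def)
        then have 2: "\<bar>c l * iter_pd \<gamma> D z\<bar> \<le> (A * C2) * p" by (simp add: abs_mult mult_ac)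
        have "\<bar>iter_pd \<gamma> (g l) z\<bar> \<le> C1 * p + (A * C2) * p"
          unfolding ig[OF \<gamma> l(1)] using 1 2 by linarith
        also have "\<dots> \<le> (C1 + A * C2 + C3) * p" using p C3 by (simp add: distrib_right)
        finally show ?thesis by (simp add: p_def)
      next
        case False
        then have "norm (iter_pd \<gamma> (g l) z / p) \<le> C3" using C3(2) l z unfolding p_def by force
        then have "\<bar>iter_pd \<gamma> (g l) z\<bar> \<le> C3 * p" using p by (simp add: abs_divide divide_le_eq)
        also have "\<dots> \<le> (C1 + A * C2 + C3) * p" using p C1pos AC by (intro mult_right_mono) auto
        finally show ?thesis by (simp add: p_def)
      qed
    qed
  qed
  then have "source_family g (k + 2) \<delta>"
    using \<delta> Cg contg by unfold_locales auto
  then show ?thesis unfolding g_def h_def c_def D_def \<delta>_def by simp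
qed

text \<open>\<open>tau\<close> is a second primitive of t^(1-a): in u = t \<psi> the term \<tau> f0
  reproduces the singular part of t f.\<close>

lemma DERIV_tau:
  assumes "2 < a" "a < 8/3" "t > 0"
  shows "(tau a has_real_derivative t powr (2 - a) / (2 - a)) (at t)"
    and "((\<lambda>t. t powr (2 - a) / (2 - a)) has_real_derivative t powr (1 - a)) (at t)"
proof -
  have "((\<lambda>t. t powr (3 - a) / ((3 - a) * (2 - a))) has_real_derivative ((3 - a) * t powr (3 - a - 1)) / ((3 - a) * (2 - a))) (at t)"
    using assms by (intro DERIV_cdivide has_real_derivative_powr) auto
  then show "(tau a has_real_derivative t powr (2 - a) / (2 - a)) (at t)"
    unfolding tau_def[abs_def] using assms by simp
  have "((\<lambda>t. t powr (2 - a) / (2 - a)) has_real_derivative ((2 - a) * t powr (2 - a - 1)) / (2 - a)) (at t)"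
    using assms by (intro DERIV_cdivide has_real_derivative_powr) auto
  then show "((\<lambda>t. t powr (2 - a) / (2 - a)) has_real_derivative t powr (1 - a)) (at t)"
    using assms by simp
qed

text \<open>Since \<psi>_tt + (2/t) \<psi>_t = (t \<psi>)_tt / t, the equation is one for u = \<tau>
  f0 + w. Its source is t f: \<tau>'' f0 restores t^(1-a) f0, and -t^(-4/3) \<tau> \<Delta>f0
  cancels the last term of g. The two limits are those of \<open>w\<close> and
  \<open>wt\<close>.\<close>

lemma (in wave_source) renormalized_solution:
  fixes f0 :: "'a \<Rightarrow> real" and f :: "'a \<Rightarrow> real \<Rightarrow> real" and \<psi> :: "'a \<times> real \<Rightarrow> real" and a :: real
  assumes a: "2 < a" "a < 8/3" and f0: "Ck_on 2 UNIV f0"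
    and g: "\<And>t x. t > 0 \<Longrightarrow> g t x = t * f x t - t powr (1 - a) * f0 x
      + t powr (-4/3) * tau a t * (\<Sum>b\<in>Basis. pd b (pd b f0) x)"
    and \<psi>: "\<And>x t. t > 0 \<Longrightarrow> \<psi> (x, t) = 1 / t * (f0 x * tau a t + w (x, t))"
  shows "Ck_on 2 (UNIV \<times> {0<..}) \<psi>"
    and "t > 0 \<Longrightarrow> pd (0, 1) (pd (0, 1) \<psi>) (x, t) - t powr (-4/3) * (\<Sum>b\<in>Basis. pd (b, 0) (pd (b, 0) \<psi>) (x, t))
        + 2 / t * pd (0, 1) \<psi> (x, t) = f x t"
    and "((\<lambda>t. t * \<psi> (x, t) - 1 / ((3 - a) * (2 - a)) * t powr (3 - a) * f0 x) \<longlongrightarrow> 0) (at_right 0)"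
    and "((\<lambda>t. t * pd (0, 1) \<psi> (x, t) + \<psi> (x, t) - 1 / (2 - a) * t powr (2 - a) * f0 x) \<longlongrightarrow> 0) (at_right 0)"
proof -
  define S where "S = (UNIV \<times> {0<..} :: ('a \<times> real) set)"
  have S: "open S" unfolding S_def by (intro open_Times) auto
  have inS: "(x, t) \<in> S \<longleftrightarrow> t > 0" for x t by (simp add: S_def)
  define tau1 where "tau1 = (\<lambda>t. t powr (2 - a) / (2 - a))"
  have f0C: "Ck_on (Suc (Suc 0)) UNIV f0" using f0 by (simp add: numeral_2_eq_2)
  define u where "u = (\<lambda>q. f0 (fst q) * tau a (snd q) + w q)"
  define ut where "ut = (\<lambda>q. f0 (fst q) * tau1 (snd q) + wt q)"
  define utt where "utt = (\<lambda>q. f0 (fst q) * snd q powr (1 - a) + wtt q)"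
  define ux where "ux = (\<lambda>b q. pd b f0 (fst q) * tau a (snd q) + wx b q)"
  define uxx where "uxx = (\<lambda>b q. pd b (pd b f0) (fst q) * tau a (snd q) + wxx b b q)"
  define P where "P = (\<lambda>q. 1 / snd q * u q)"
  define Pt where "Pt = (\<lambda>q. 1 / snd q * ut q + (- 1 / (snd q)\<^sup>2) * u q)"
  define Px where "Px = (\<lambda>b q. 1 / snd q * ux b q)"
  have \<psi>P: "\<psi> q = P q" if "q \<in> S" for q
    using that \<psi> by (cases q) (auto simp: inS P_def u_def)
  have Pd: "((\<lambda>t::real. 1 / t) has_real_derivative - 1 / t\<^sup>2) (at t)" "((\<lambda>t::real. - 1 / t\<^sup>2) has_real_derivative 2 / t ^ 3) (at t)"
    if "t > 0" for t :: real
    using that by (auto intro!: derivative_eq_intros simp: power2_eq_square power3_eq_cube field_simps)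
  have ru: "has_pd (0, 1) u (ut (x, t)) (x, t)" if t: "t > 0" for x t
  proof -
    have "has_pd (0, 1) u ((f0 (fst (x, t)) * tau1 t + 0 * tau a (snd (x, t))) + wt (x, t)) (x, t)"
      unfolding u_def using DERIV_tau(1)[OF a t]
      by (intro has_pd_add has_pd_mult has_pd_fst_0 has_pd_snd w_t t) (simp add: tau1_def)
    then show ?thesis by (simp add: ut_def)
  qed
  have rut: "has_pd (0, 1) ut (utt (x, t)) (x, t)" if t: "t > 0" for x t
  proof -
    have "has_pd (0, 1) ut ((f0 (fst (x, t)) * t powr (1 - a) + 0 * tau1 (snd (x, t))) + wtt (x, t)) (x, t)"
      unfolding ut_def using DERIV_tau(2)[OF a t]
      by (intro has_pd_add has_pd_mult has_pd_fst_0 has_pd_snd wt_t t) (simp add: tau1_def)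
    then show ?thesis by (simp add: utt_def)
  qed
  have xu: "has_pd (b, 0) u (ux b (x, t)) (x, t)" if b: "b \<in> Basis" and t: "t > 0" for b x t
  proof -
    have "has_pd (b, 0) (\<lambda>q. f0 (fst q)) (pd b f0 x) (x, t)"
      by (rule has_pd_fst) (simp add: Ck_on_Suc_has_pd[OF Ck_on_SucD[OF f0C] b])
    then have "has_pd (b, 0) u ((f0 (fst (x, t)) * 0 + pd b f0 x * tau a (snd (x, t))) + wx b (x, t)) (x, t)"
      unfolding u_def by (intro has_pd_add has_pd_mult has_pd_snd_0 w_x t b)
    then show ?thesis by (simp add: ux_def)
  qed
  have xux: "has_pd (b, 0) (ux b) (uxx b (x, t)) (x, t)" if b: "b \<in> Basis" and t: "t > 0" for b x t
  proof -
    have "has_pd (b, 0) (\<lambda>q. pd b f0 (fst q)) (pd b (pd b f0) x) (x, t)"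
      by (rule has_pd_fst) (simp add: Ck_on_Suc_has_pd[OF Ck_on_pd[OF f0C b] b])
    then have "has_pd (b, 0) (ux b) ((pd b f0 (fst (x, t)) * 0 + pd b (pd b f0) x * tau a (snd (x, t))) + wxx b b (x, t)) (x, t)"
      unfolding ux_def by (intro has_pd_add has_pd_mult has_pd_snd_0 wx_x t b)
    then show ?thesis by (simp add: uxx_def)
  qed
  have rP: "has_pd (0, 1) P (Pt (x, t)) (x, t)" if t: "t > 0" for x t
  proof -
    have "has_pd (0, 1) P (1 / snd (x, t) * ut (x, t) + (- 1 / t\<^sup>2) * u (x, t)) (x, t)"
      unfolding P_def using Pd(1)[OF t] by (intro has_pd_mult has_pd_snd ru t) simp
    then show ?thesis by (simp add: Pt_def)
  qed
  have rPt: "has_pd (0, 1) Pt (1 / t * utt (x, t) + (- 1 / t\<^sup>2) * ut (x, t) + ((- 1 / t\<^sup>2) * ut (x, t) + 2 / t ^ 3 * u (x, t))) (x, t)"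
    if t: "t > 0" for x t
  proof -
    have "has_pd (0, 1) Pt ((1 / snd (x, t) * utt (x, t) + (- 1 / t\<^sup>2) * ut (x, t)) + ((- 1 / (snd (x, t))\<^sup>2) * ut (x, t) + 2 / t ^ 3 * u (x, t))) (x, t)"
      unfolding Pt_def using Pd[OF t] by (intro has_pd_add has_pd_mult has_pd_snd ru rut t) simp_all
    then show ?thesis by simp
  qed
  have xP: "has_pd (b, 0) P (Px b (x, t)) (x, t)" if b: "b \<in> Basis" and t: "t > 0" for b x t
  proof -
    have "has_pd (b, 0) P (1 / snd (x, t) * ux b (x, t) + 0 * u (x, t)) (x, t)"
      unfolding P_def by (intro has_pd_mult has_pd_snd_0 xu t b)
    then show ?thesis by (simp add: Px_def)
  qed
  have xPx: "has_pd (b, 0) (Px b) (1 / t * uxx b (x, t)) (x, t)" if b: "b \<in> Basis" and t: "t > 0" for b x t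
  proof -
    have "has_pd (b, 0) (Px b) (1 / snd (x, t) * uxx b (x, t) + 0 * ux b (x, t)) (x, t)"
      unfolding Px_def by (intro has_pd_mult has_pd_snd_0 xux t b)
    then show ?thesis by simp
  qed
  \<comment> \<open>\<psi> is given by the formula for t > 0 only; as S is open, this determines its
    derivatives on S.\<close>
  have \<psi>t: "pd (0, 1) \<psi> q = Pt q" if "q \<in> S" for q
    using pd_cong_open[where b="(0, 1)", OF S that \<psi>P] that has_pd_imp_pd[OF rP] by (cases q) (simp add: inS)
  have \<psi>x: "pd (b, 0) \<psi> q = Px b q" if "b \<in> Basis" "q \<in> S" for b q
    using pd_cong_open[where b="(b, 0)", OF S that(2) \<psi>P] that has_pd_imp_pd[OF xP] by (cases q) (simp add: inS)
  have \<psi>tt: "pd (0, 1) (pd (0, 1) \<psi>) (x, t) = 1 / t * utt (x, t) + (- 1 / t\<^sup>2) * ut (x, t) + ((- 1 / t\<^sup>2) * ut (x, t) + 2 / t ^ 3 * u (x, t))"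
    if "t > 0" for x t
    using pd_cong_open[where b="(0, 1)" and x="(x, t)", OF S _ \<psi>t] that has_pd_imp_pd[OF rPt[OF that]] by (simp add: inS)
  have \<psi>xx: "pd (b, 0) (pd (b, 0) \<psi>) (x, t) = 1 / t * uxx b (x, t)" if "b \<in> Basis" "t > 0" for b x t
    using pd_cong_open[where b="(b, 0)" and x="(x, t)", OF S _ \<psi>x[OF that(1)]] that has_pd_imp_pd[OF xPx[OF that]] by (simp add: inS)
  have Ctau: "Ck_on 2 S (\<lambda>q. tau a (snd q))"
    unfolding S_def
    by (rule Ck_on_2_snd[of "tau a" tau1 "\<lambda>t. t powr (1 - a)"])
      (use DERIV_tau[OF a] in \<open>auto simp: tau1_def intro!: continuous_intros\<close>)
  have Cinv: "Ck_on 2 S (\<lambda>q. 1 / snd q)"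
    unfolding S_def
    by (rule Ck_on_2_snd[of "\<lambda>t. 1 / t" "\<lambda>t. - 1 / t\<^sup>2" "\<lambda>t. 2 / t ^ 3"]) (use Pd in \<open>auto intro!: continuous_intros\<close>)
  have CP: "Ck_on 2 S P"
    unfolding P_def u_def
    by (intro Ck_on_mult Ck_on_add Ck_on_fst S Cinv Ctau f0) (simp add: S_def w_Ck2)
  show "Ck_on 2 (UNIV \<times> {0<..}) \<psi>"
    unfolding S_def[symmetric] by (rule Ck_on_cong_open[OF S _ CP]) (simp add: \<psi>P)
  show "pd (0, 1) (pd (0, 1) \<psi>) (x, t) - t powr (-4/3) * (\<Sum>b\<in>Basis. pd (b, 0) (pd (b, 0) \<psi>) (x, t))
        + 2 / t * pd (0, 1) \<psi> (x, t) = f x t" if t: "t > 0"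
  proof -
    have L: "(\<Sum>b\<in>Basis. pd (b, 0) (pd (b, 0) \<psi>) (x, t)) = 1 / t * (\<Sum>b\<in>Basis. uxx b (x, t))"
      by (simp add: \<psi>xx t sum_distrib_left)
    have "utt (x, t) - t powr (-4/3) * (\<Sum>b\<in>Basis. uxx b (x, t)) = t * f x t"
    proof -
      define W where "W = (\<Sum>b\<in>Basis. wxx b b (x, t))"
      have "(\<Sum>b\<in>Basis. uxx b (x, t)) = (\<Sum>b\<in>Basis. pd b (pd b f0) x) * tau a t + W"
        by (simp add: uxx_def W_def sum.distrib sum_distrib_right)
      moreover have "wtt (x, t) - t powr (-4/3) * W = g t x"
        unfolding W_def by (rule wave_equation[OF t])
      ultimately show ?thesis unfolding g[OF t] utt_def by (simp add: algebra_simps)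
    qed
    then have "utt (x, t) = t * f x t + t powr (-4/3) * (\<Sum>b\<in>Basis. uxx b (x, t))" by simp
    then show ?thesis
      unfolding \<psi>tt[OF t] L using \<psi>t[of "(x, t)"] t
      by (simp add: inS Pt_def) (simp add: field_simps power2_eq_square power3_eq_cube)
  qed
  have "((\<lambda>t. t * \<psi> (x, t) - 1 / ((3 - a) * (2 - a)) * t powr (3 - a) * f0 x) \<longlongrightarrow> 0) (at_right 0) \<longleftrightarrow> ((\<lambda>t. w (x, t)) \<longlongrightarrow> 0) (at_right 0)"
    by (intro filterlim_cong refl) (auto simp: eventually_at_filter \<psi> tau_def field_simps)
  then show "((\<lambda>t. t * \<psi> (x, t) - 1 / ((3 - a) * (2 - a)) * t powr (3 - a) * f0 x) \<longlongrightarrow> 0) (at_right 0)"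
    using w_tendsto_0 by simp
  \<comment> \<open>t \<psi>_t + \<psi> is the t-derivative of u, and t^(2-a) / (2-a) is
    \<tau>'.\<close>
  have *: "t * pd (0, 1) \<psi> (x, t) + \<psi> (x, t) - 1 / (2 - a) * t powr (2 - a) * f0 x = wt (x, t)" if "t > 0" for t
  proof -
    have "t * Pt (x, t) + P (x, t) = ut (x, t)"
      using that by (simp add: Pt_def P_def field_simps power2_eq_square)
    then show ?thesis using \<psi>t[of "(x, t)"] \<psi>P[of "(x, t)"] that by (simp add: inS ut_def tau1_def)
  qed
  have "((\<lambda>t. t * pd (0, 1) \<psi> (x, t) + \<psi> (x, t) - 1 / (2 - a) * t powr (2 - a) * f0 x) \<longlongrightarrow> 0) (at_right 0) \<longleftrightarrow> ((\<lambda>t. wt (x, t)) \<longlongrightarrow> 0) (at_right 0)"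
    by (intro filterlim_cong refl, unfold eventually_at_filter, intro always_eventually allI impI, rule *) simp
  then show "((\<lambda>t. t * pd (0, 1) \<psi> (x, t) + \<psi> (x, t) - 1 / (2 - a) * t powr (2 - a) * f0 x) \<longlongrightarrow> 0) (at_right 0)"
    using wt_tendsto_0 by simp
qed

text \<open>The equation and the limits are known for \<tau> f0 + \<open>w\<close>; it remains to
  recognize the integrand of \<open>psi\<close> as \<open>Zr\<close> applied to the renormalized
  source, which rests on uniqueness for each datum f(., l) and for f0.\<close>

theorem theorem2p2:
  fixes f :: "real^'n::finite \<Rightarrow> real \<Rightarrow> real"
    and f0 :: "real^'n \<Rightarrow> real"
    and a :: real
  defines "k \<equiv> CARD('n) div 2"
  assumes a_range: "2 < a" "a < 8/3"
    and f_reg: "Ck_on (k + 4) (UNIV \<times> {0<..}) (case_prod f)"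
    and f_cont0: "\<exists>g. continuous_on (UNIV \<times> {0..}) g \<and>
                      (\<forall>x t. t > 0 \<longrightarrow> g (x, t) = t powr a * f x t)"
    and f_bounds: "\<exists>T>0. \<forall>(\<alpha>::'n list) (\<beta>::'n list).
          length \<alpha> \<le> k + 4 \<and> length \<beta> \<le> k + 1 \<longrightarrow>
          (\<exists>C. \<forall>x. \<forall>t\<in>{0<..<T}.
             \<bar>iter_pd (map xdir \<alpha>) (case_prod f) (x, t)\<bar>
             + \<bar>t * iter_pd (tdir # map xdir \<beta>) (case_prod f) (x, t)\<bar> \<le> C * t powr (-a))"
    and f0_def: "\<forall>x. ((\<lambda>t. t powr a * f x t) \<longlongrightarrow> f0 x) (at_right 0)"
    and f0_reg: "Ck_on (k + 4) UNIV f0"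
    and f_f0_bounds: "\<exists>\<epsilon>>0. \<exists>T>0. \<forall>(\<alpha>::'n list) (\<beta>::'n list).
          length \<alpha> \<le> k + 2 \<and> length \<beta> \<le> k + 1 \<longrightarrow>
          (\<exists>C. \<forall>x. \<forall>t\<in>{0<..<T}.
             \<bar>iter_pd (map xdir \<alpha>) (\<lambda>(y, s). s * f y s - s powr (1 - a) * f0 y) (x, t)\<bar>
             + \<bar>t * iter_pd (tdir # map xdir \<beta>) (\<lambda>(y, s). s * f y s - s powr (1 - a) * f0 y) (x, t)\<bar>
             \<le> C * t powr (\<epsilon> - 1))"
  shows "Ck_on 2 (UNIV \<times> {0<..}) (case_prod (psi a f f0))
     \<and> (\<forall>x. \<forall>t>0.
          iter_pd [tdir, tdir] (case_prod (psi a f f0)) (x, t)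
          - t powr (-4/3) * (\<Sum>i\<in>UNIV. iter_pd [xdir i, xdir i] (case_prod (psi a f f0)) (x, t))
          + 2 / t * pd tdir (case_prod (psi a f f0)) (x, t) = f x t)
     \<and> (\<forall>x. ((\<lambda>t. t * psi a f f0 x t - 1 / ((3 - a) * (2 - a)) * t powr (3 - a) * f0 x)
               \<longlongrightarrow> 0) (at_right 0))
     \<and> (\<forall>x. ((\<lambda>t. t * pd tdir (case_prod (psi a f f0)) (x, t) + psi a f f0 x t
                    - 1 / (2 - a) * t powr (2 - a) * f0 x) \<longlongrightarrow> 0) (at_right 0))"
proof -
  have k: "DIM(real^'n) div 2 = k" by (simp add: k_def)
  obtain \<epsilon> T where \<epsilon>: "\<epsilon> > 0" and T: "T > 0" and bd: "\<And>(\<alpha>::'n list) (\<beta>::'n list).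
          length \<alpha> \<le> k + 2 \<Longrightarrow> length \<beta> \<le> k + 1 \<Longrightarrow>
          (\<exists>C. \<forall>x. \<forall>t\<in>{0<..<T}.
             \<bar>iter_pd (map xdir \<alpha>) (\<lambda>(y, s). s * f y s - s powr (1 - a) * f0 y) (x, t)\<bar>
             + \<bar>t * iter_pd (tdir # map xdir \<beta>) (\<lambda>(y, s). s * f y s - s powr (1 - a) * f0 y) (x, t)\<bar>
             \<le> C * t powr (\<epsilon> - 1))"
    using f_f0_bounds by blast
  define D where "D = (\<lambda>z. \<Sum>b\<in>Basis. pd b (pd b f0) z)"
  define g where "g = (\<lambda>l z. l * f z l - l powr (1 - a) * f0 z + l powr (-4/3) * tau a l * D z)"
  define \<delta> where "\<delta> = min \<epsilon> (8/3 - a)"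
  interpret sf: source_family g "k + 2" \<delta>
    unfolding g_def D_def \<delta>_def
  proof (rule source_family_renormalized[OF a_range f_reg f0_reg \<epsilon> T])
    fix \<gamma> :: "(real^'n) list" assume \<gamma>: "set \<gamma> \<subseteq> Basis" "length \<gamma> \<le> k + 2"
    \<comment> \<open>The hypothesis is indexed by coordinates, \<open>source_family\<close> by
      basis vectors; every list of basis vectors comes from a list of coordinates.\<close>
    have "\<forall>b\<in>set \<gamma>. \<exists>i. b = axis i (1::real)" using \<gamma>(1) by (auto simp: Basis_vec_def)
    then obtain \<alpha> :: "'n list" where \<alpha>: "\<gamma> = map (\<lambda>i. axis i 1) \<alpha>" unfolding ex_map_conv[symmetric] by blast
    have xd: "map xdir \<alpha> = map (\<lambda>b. (b, 0)) \<gamma>" by (simp add: \<alpha> xdir_def)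
    obtain C where C: "\<forall>x. \<forall>t\<in>{0<..<T}.
             \<bar>iter_pd (map xdir \<alpha>) (\<lambda>(y, s). s * f y s - s powr (1 - a) * f0 y) (x, t)\<bar>
             + \<bar>t * iter_pd (tdir # map xdir []) (\<lambda>(y, s). s * f y s - s powr (1 - a) * f0 y) (x, t)\<bar>
             \<le> C * t powr (\<epsilon> - 1)" using bd[of \<alpha> "[]"] \<gamma>(2) \<alpha> by auto
    show "\<exists>C. \<forall>x. \<forall>t\<in>{0<..<T}. \<bar>iter_pd \<gamma> (\<lambda>y. t * f y t - t powr (1 - a) * f0 y) x\<bar> \<le> C * t powr (\<epsilon> - 1)"
    proof (intro exI[of _ C] allI ballI)
      fix x t assume t: "t \<in> {0<..<T}"
      have "iter_pd \<gamma> (\<lambda>y. t * f y t - t powr (1 - a) * f0 y) x =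
         iter_pd (map xdir \<alpha>) (\<lambda>(y, s). s * f y s - s powr (1 - a) * f0 y) (x, t)"
        unfolding xd using iter_pd_slice[of \<gamma> "\<lambda>(y, s). s * f y s - s powr (1 - a) * f0 y" t x] by simp
      then show "\<bar>iter_pd \<gamma> (\<lambda>y. t * f y t - t powr (1 - a) * f0 y) x\<bar> \<le> C * t powr (\<epsilon> - 1)"
        using C[rule_format, of t x] t by linarith
    qed
  qed
  obtain U Z Zr Zrr N :: "(real^'n \<Rightarrow> real) \<Rightarrow> (real^'n) \<times> real \<Rightarrow> real"
    where "wave_operators k U Z Zr Zrr N"
    using ex_wave_operators[where 'a="real^'n"] unfolding k by blast
  then interpret ws: wave_source g \<delta> k U Z Zr Zrr N
    by (intro wave_source.intro sf.source_family_axioms)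
  \<comment> \<open>\<open>Zr\<close> takes k + 1 derivatives and \<open>wave_cauchy\<close> asks
    for a C^2 solution, hence k + 3.\<close>
  have sol: "wave_sol h = (\<lambda>x r. Zr h (x, r))" if h: "Ck_on (k + 3) UNIV h" for h
  proof (rule wave_sol_eqI)
    have h2: "Ck_on (k + 2) UNIV h" by (rule Ck_on_mono[OF h]) simp
    have "Ck_on 2 UNIV (Zr h)" by (rule mean_operator_Ck[OF ws.Zr]) (use h in \<open>simp add: numeral_3_eq_3 numeral_2_eq_2\<close>)
    moreover have "(\<lambda>(x, r). Zr h (x, r)) = Zr h" by auto
    ultimately show "wave_cauchy h (\<lambda>x r. Zr h (x, r))"
      unfolding wave_cauchy_def tdir_def xdir_def using ws.Zr_wave[OF h] ws.Zr_r_0[OF h] ws.Zr_0[OF h2]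
      by (simp add: sum_Basis_axis)
  qed
  have f0C: "Ck_on (k + 3) UNIV f0" "Ck_on (k + 2) UNIV f0" "Ck_on (k + 1) UNIV f0" "Ck_on (Suc (Suc (k + 1))) UNIV f0"
    and f02: "Ck_on 2 UNIV f0"
    using f0_reg by (auto elim: Ck_on_mono)
  have DC: "Ck_on (k + 1) UNIV D"
    unfolding D_def by (intro Ck_on_lap Ck_on_mono[OF f0_reg]) simp
  \<comment> \<open>x-derivatives pass to the data. The outcome is \<open>Zr D\<close> and not
    \<open>wave_sol D\<close>: f0 of class C^(k+4) gives D class C^(k+2), one order below what
    \<open>sol\<close> requires.\<close>
  have lap_sol: "lap (\<lambda>y. wave_sol f0 y r) x = Zr D (x, r)" for x r
  proof -
    have slice: "has_pd b (\<lambda>y. F (y, r)) d y" if "has_pd (b, 0) F d (y, r)" for b F d and y :: "real^'n"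
      using that by (simp add: has_pd_def)
    have "pd b (pd b (\<lambda>y. Zr f0 (y, r))) x = Zr (pd b (pd b f0)) (x, r)" if b: "b \<in> Basis" for b
    proof -
      have "pd b (\<lambda>y. Zr f0 (y, r)) = (\<lambda>y. Zr (pd b f0) (y, r))"
        by (rule ext, rule has_pd_imp_pd, rule slice, rule mean_operator_has_pd_x[OF ws.Zr b]) (use f0C in simp)
      moreover have "pd b (\<lambda>y. Zr (pd b f0) (y, r)) x = Zr (pd b (pd b f0)) (x, r)"
        by (rule has_pd_imp_pd, rule slice, rule mean_operator_has_pd_x[OF ws.Zr b], rule Ck_on_pd[OF _ b]) (use f0C in simp)
      ultimately show ?thesis by simp
    qed
    then have "lap (\<lambda>y. wave_sol f0 y r) x = (\<Sum>b\<in>Basis. Zr (pd b (pd b f0)) (x, r))"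
      unfolding sol[OF f0C(1)] lap_eq_sum_Basis by simp
    also have "\<dots> = Zr D (x, r)"
      unfolding D_def
      by (rule mean_operator_sum_arg[OF ws.Zr, symmetric]) (rule finite_Basis, rule Ck_on_pd[OF Ck_on_pd[OF f0C(4)]])
    finally show ?thesis .
  qed
  \<comment> \<open>Superposition: \<open>Zr\<close> is linear in its data, and each of the three
    terms is \<open>Zr\<close> of one piece of \<open>g l\<close>.\<close>
  have Zr_g: "l * wave_sol (\<lambda>y. f y l) x r - l powr (1 - a) * wave_sol f0 x r
          + l powr (-4/3) * tau a l * lap (\<lambda>y. wave_sol f0 y r) x = Zr (g l) (x, r)" if l: "l > 0" for l x r
  proof -
    have "Ck_on (k + 4) UNIV (\<lambda>y. f y l)" using Ck_on_slice[OF f_reg l] by simp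
    then have fC: "Ck_on (k + 3) UNIV (\<lambda>y. f y l)" "Ck_on (k + 1) UNIV (\<lambda>y. f y l)" by (auto elim: Ck_on_mono)
    define c where "c = - (l powr (1 - a))"
    define e where "e = l powr (-4/3) * tau a l"
    have "g l = (\<lambda>z. (l * f z l + c * f0 z) + e * D z)" by (simp add: g_def c_def e_def)
    moreover have "Zr (\<lambda>z. (l * f z l + c * f0 z) + e * D z) (x, r) =
        (l * Zr (\<lambda>y. f y l) (x, r) + c * Zr f0 (x, r)) + e * Zr D (x, r)"
    proof -
      note C = Ck_on_cmult[OF open_UNIV fC(2), of l] Ck_on_cmult[OF open_UNIV f0C(3), of c] Ck_on_cmult[OF open_UNIV DC, of e]
      show ?thesis
        using mean_operator_add_arg[OF ws.Zr Ck_on_add[OF open_UNIV C(1,2)] C(3)] mean_operator_add_arg[OF ws.Zr C(1,2)]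
          mean_operator_cmult_arg[OF ws.Zr fC(2), of l] mean_operator_cmult_arg[OF ws.Zr f0C(3), of c]
          mean_operator_cmult_arg[OF ws.Zr DC, of e] by simp
    qed
    ultimately show ?thesis
      unfolding lap_sol unfolding sol[OF fC(1)] sol[OF f0C(1)] by (simp add: c_def e_def)
  qed
  \<comment> \<open>The factor 1/(18 t) meets the 18 of \<open>w_eq_integral\<close> and leaves w /
    t.\<close>
  have psi: "case_prod (psi a f f0) (x, t) = 1 / t * (f0 x * tau a t + ws.w (x, t))" if t: "t > 0" for x t
    unfolding psi_def case_prod_conv
    by (subst ws.w_eq_integral[OF t Zr_g]) (simp_all add: distrib_left)
  have g: "g t x = t * f x t - t powr (1 - a) * f0 x + t powr (-4/3) * tau a t * (\<Sum>b\<in>Basis. pd b (pd b f0) x)" for t x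
    by (simp add: g_def D_def)
  note R = ws.renormalized_solution[OF a_range f02 g psi]
  show ?thesis
    using R by (simp add: tdir_def xdir_def sum_Basis_axis)
qed

end
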